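(* Let $0<q<1/2$, $p=1-q$, $\lambda=q/p$, let $z\geq 1$ and $A\geq z$ be integers, and write $[n]=\frac{1-\lambda^n}{1-\lambda}$ for $n\in\mathbb{N}$. For the $A$-Nakamoto double spend strategy (described in the context), with block reward $b>0$ and double-spent amount $v\geq 0$, the expected revenue $\mathbb{E}[\mathbf{R}_A]$ and the expected duration $\mathbb{E}[\mathbf{T}_A]$ of an attack cycle are \begin{align*} \frac{\mathbb{E}[\mathbf{R}_A]}{b} &= \frac{qz}{2p} I_{4pq}(z,1/2) - \frac{(A+1)\lambda^{A+1}}{p(1-\lambda)^3[A+1]^2} I_{(p-q)^2}(1/2,z) + \frac{2-\lambda+\lambda^{A+2}}{(1-\lambda)^2[A+1]}\,\frac{p^{z-1}q^z}{B(z,z)} + P_A(z)\left(\frac{v}{b}+1\right),\\ \frac{\mathbb{E}[\mathbf{T}_A]}{\tau_0} &= \frac{z}{2p} I_{4pq}(z,1/2) + \frac{A+1}{p(1-\lambda)^2[A+1]} I_{(p-q)^2}(1/2,z) - \frac{p^{z-1}q^z}{p(1-\lambda)B(z,z)} + \frac{1}{q}, \end{align*} where $P_A(z)$ is the probability of success of the attack, $I_x(a,b)=\frac{1}{B(a,b)}\int_0^x t^{a-1}(1-t)^{b-1}\,dt$ is the regularized incomplete Beta function and $B(a,b)=\int_0^1 t^{a-1}(1-t)^{b-1}\,dt$.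
   Context: Mining model: the attacker has relative hashrate $q$ and the honest miners relative hashrate $p=1-q$; blocks found by the honest miners and by the attacker form independent Poisson processes with rates $p/\tau_0$ and $q/\tau_0$ respectively ($\tau_0>0$ the mean interblock time); block propagation is instantaneous and difficulty is constant. The recipient of a transaction requires $z$ confirmations. The $A$-Nakamoto double spend strategy (with one pre-mined block) is: (1) the attacker mines on top of the last block of the official blockchain a block containing a transaction returning the payment funds to an address he controls; if the honest miners find a block first, he restarts mining on top of the new last official block; (2) once he has mined this one block (kept secret), he sends the paying transaction to the vendor and keeps mining on his secret fork, while the honest miners extend the official chain; (3) the lag is (number of official blocks after the fork point) minus (number of blocks of the secret fork); if the lag reaches $A$ the attacker gives up and the attack fails; (4) if, at a moment when the official chain has added at least $z$ blocks (confirmations of the vendor transaction), the secret fork is strictly longer than the official chain, the attacker publishes it and the attack succeeds. An attack cycle starts at step (1) and ends at success or failure; $\mathbf{T}_A$ is its duration (including the pre-mining time). The revenue $\mathbf{R}_A$ of a cycle is $v+b\cdot(\text{number of blocks of the published secret fork, including the pre-mined block})$ if the attack succeeds, and $0$ if it fails. *)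

theory Defs
  imports "HOL-Probability.Probability"
begin

definition inc_beta :: "real \<Rightarrow> real \<Rightarrow> real \<Rightarrow> real" where
  "inc_beta x a b = integral {0..x} (\<lambda>t. t powr (a - 1) * (1 - t) powr (b - 1)) / Beta a b"

definition qint :: "real \<Rightarrow> nat \<Rightarrow> real" where
  "qint l n = (1 - l ^ n) / (1 - l)"

text \<open>Sample point: omega i = (i-th honest interarrival time, i-th attacker interarrival time).
  Both sequences are i.i.d. exponential, rates p/tau0 and q/tau0, all independent:
  this is exactly a pair of independent Poisson processes.\<close>
definition mining_space :: "real \<Rightarrow> real \<Rightarrow> (nat \<Rightarrow> real \<times> real) measure" where
  "mining_space q tau0 = (\<Pi>\<^sub>M i\<in>UNIV.
      (density lborel (exponential_density ((1 - q) / tau0)) \<Otimes>\<^sub>M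
       density lborel (exponential_density (q / tau0))))"

definition hon_time :: "(nat \<Rightarrow> real \<times> real) \<Rightarrow> nat \<Rightarrow> real" where
  "hon_time \<omega> k = (\<Sum>i\<le>k. fst (\<omega> i))"
definition att_time :: "(nat \<Rightarrow> real \<times> real) \<Rightarrow> nat \<Rightarrow> real" where
  "att_time \<omega> k = (\<Sum>i\<le>k. snd (\<omega> i))"

definition Nh :: "(nat \<Rightarrow> real \<times> real) \<Rightarrow> real \<Rightarrow> nat" where
  "Nh \<omega> t = card {k. hon_time \<omega> k \<le> t}"
definition Na :: "(nat \<Rightarrow> real \<times> real) \<Rightarrow> real \<Rightarrow> nat" where
  "Na \<omega> t = card {k. att_time \<omega> k \<le> t}"

text \<open>End of pre-mining: first attacker block (honest blocks before it only move the
  fork point).\<close>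
definition premine_end :: "(nat \<Rightarrow> real \<times> real) \<Rightarrow> real" where
  "premine_end \<omega> = att_time \<omega> 0"

text \<open>Official blocks after the fork point, and blocks of the secret fork (incl. pre-mined).\<close>
definition off_len :: "(nat \<Rightarrow> real \<times> real) \<Rightarrow> real \<Rightarrow> int" where
  "off_len \<omega> t = int (Nh \<omega> t) - int (Nh \<omega> (premine_end \<omega>))"
definition sec_len :: "(nat \<Rightarrow> real \<times> real) \<Rightarrow> real \<Rightarrow> int" where
  "sec_len \<omega> t = 1 + int (Na \<omega> t) - int (Na \<omega> (premine_end \<omega>))"

definition attack_ended :: "nat \<Rightarrow> nat \<Rightarrow> (nat \<Rightarrow> real \<times> real) \<Rightarrow> real \<Rightarrow> bool" where
  "attack_ended A z \<omega> t \<longleftrightarrow> premine_end \<omega> \<le> t \<and>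
     (off_len \<omega> t - sec_len \<omega> t = int A \<or> (off_len \<omega> t \<ge> int z \<and> sec_len \<omega> t > off_len \<omega> t))"

definition end_time :: "nat \<Rightarrow> nat \<Rightarrow> (nat \<Rightarrow> real \<times> real) \<Rightarrow> real" where
  "end_time A z \<omega> = Inf {t. attack_ended A z \<omega> t}"

definition attack_success :: "nat \<Rightarrow> nat \<Rightarrow> (nat \<Rightarrow> real \<times> real) \<Rightarrow> bool" where
  "attack_success A z \<omega> \<longleftrightarrow> (\<exists>t. attack_ended A z \<omega> t) \<and>
     sec_len \<omega> (end_time A z \<omega>) > off_len \<omega> (end_time A z \<omega>)"

definition revenue :: "real \<Rightarrow> real \<Rightarrow> nat \<Rightarrow> nat \<Rightarrow> (nat \<Rightarrow> real \<times> real) \<Rightarrow> real" where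
  "revenue v b A z \<omega> = (if attack_success A z \<omega>
      then v + b * real_of_int (sec_len \<omega> (end_time A z \<omega>)) else 0)"

text \<open>Duration T_A of a cycle (0 on the null event that the cycle never ends).\<close>
definition duration :: "nat \<Rightarrow> nat \<Rightarrow> (nat \<Rightarrow> real \<times> real) \<Rightarrow> real" where
  "duration A z \<omega> = (if \<exists>t. attack_ended A z \<omega> t then end_time A z \<omega> else 0)"

end

theory Submission
  imports Defs
begin

text \<open>
  By the lack of memory of the exponential distribution, the pair of waiting-time sequences is
  reproduced after the first block: the waiting time is exponential with mean \<open>tau0\<close>, and
  independently of it the block is honest with probability \<open>p\<close> and the attacker's with
  probability \<open>q\<close>. Hence the expected value of a time-plus-terminal reward, as a function of the
  numbers \<open>h\<close> and \<open>s\<close> of official and secret blocks, solves a linear one-step equation on the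
  strip \<open>h \<le> s + A\<close>. A geometric supersolution shows that this equation has only one solution of at
  most linear growth, so it suffices to exhibit one. Since \<open>z \<le> A\<close>, the cycle cannot end before
  the \<open>z\<close>-th official block; afterwards the lag is a gambler's ruin walk between \<open>-1\<close> and \<open>A\<close>.
  The solution is therefore a truncated negative binomial average of gambler's ruin values, and such
  truncated sums are incomplete Beta functions.
\<close>

section \<open>Negative binomial sums and the incomplete Beta function\<close>

text \<open>Two circularities shape the argument. An expected value can be moved around in a linear
  equation only once it is known to be finite; and time can be collected at the first block only if
  the race ends almost surely, since a race that never ends is worth 0 by convention. The second is
  removed by the same machinery with time reward 0 and terminal reward 1, which yields the
  probability of ending. The first is removed by truncating the payoff at \<open>K\<close>: the
  one-step equation survives as an inequality, and \<open>K\<close> tends to infinity. Some growth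
  condition is indispensable: the homogeneous equation with value 0 on all final states has a
  solution equal to \<open>1 / q ^ s\<close> at \<open>h = z - 1\<close> and to 0 for
  \<open>h \<ge> z\<close>.\<close>

definition nbin_head :: "nat \<Rightarrow> real \<Rightarrow> real \<Rightarrow> real" where
  "nbin_head z p q = (\<Sum>N<z. real ((z + N - 1) choose N) * p ^ z * q ^ N)"

text \<open>\<open>nbin_head\<close> and \<open>nbin_head_mean\<close> are the mass and the first
  moment, restricted to values below \<open>z\<close>, of the number of attacker blocks found before
  the \<open>z\<close>-th honest block. These are the cases in which the secret fork is not yet
  ahead.\<close>

definition nbin_head_mean :: "nat \<Rightarrow> real \<Rightarrow> real \<Rightarrow> real" where
  "nbin_head_mean z p q = (\<Sum>N<z. real N * (real ((z + N - 1) choose N) * p ^ z * q ^ N))"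

text \<open>This is 1 / B(n + 1, n + 1), see \<open>Beta_diag\<close>; it is used with
  \<open>z = Suc n\<close>.\<close>

definition beta_const :: "nat \<Rightarrow> real" where
  "beta_const n = real (2 * n + 1) * real ((2 * n) choose n)"

text \<open>With \<open>p = 1 - q\<close> each summand is the difference of the right-hand side at
  \<open>N\<close> and at \<open>N - 1\<close>, by the absorption identity for binomial
  coefficients.\<close>

lemma nbin_head_telescope:
  fixes p q :: real
  assumes "p + q = 1"
  shows "(\<Sum>N\<le>m. real ((n + N) choose N) * (real (n + 1) * q - real N * p) * q ^ N)
    = real (n + 1 + m) * real ((n + m) choose m) * q ^ (m + 1)"
proof (induction m)
  case 0
  show ?case by simp
next
  case (Suc m)
  have ch: "real (Suc m) * real ((n + Suc m) choose Suc m) = real (n + 1 + m) * real ((n + m) choose m)"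
    using Suc_times_binomial_eq[of "n + m" m] by (simp flip: of_nat_mult add: algebra_simps)
  have p: "p = 1 - q" using assms by simp
  have "(\<Sum>N\<le>Suc m. real ((n + N) choose N) * (real (n + 1) * q - real N * p) * q ^ N)
    = real (n + 1 + m) * real ((n + m) choose m) * q ^ (m + 1)
      + real ((n + Suc m) choose Suc m) * (real (n + 1) * q - real (Suc m) * p) * q ^ Suc m"
    by (simp only: sum.atMost_Suc Suc)
  also have "\<dots> = real (Suc m) * real ((n + Suc m) choose Suc m) * q ^ (m + 1)
      + real ((n + Suc m) choose Suc m) * (real (n + 1) * q - real (Suc m) * p) * q ^ Suc m"
    by (simp only: ch)
  also have "\<dots> = real (n + 1 + Suc m) * real ((n + Suc m) choose Suc m) * q ^ (Suc m + 1)"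
    unfolding p by (simp add: algebra_simps)
  finally show ?case .
qed

text \<open>The untruncated mean is \<open>z * q / p\<close>. Cutting off at \<open>N < z\<close>
  leaves the last boundary term of the telescoping sum, the source of the terms with 1 / B(z, z) in
  the theorem.\<close>

lemma nbin_head_mean_eq:
  fixes p q :: real
  assumes "p + q = 1"
  shows "p * nbin_head_mean (Suc n) p q = real (Suc n) * q * nbin_head (Suc n) p q - beta_const n * p ^ Suc n * q ^ Suc n"
proof -
  have "real (Suc n) * q * nbin_head (Suc n) p q - p * nbin_head_mean (Suc n) p q
     = p ^ Suc n * (\<Sum>N\<le>n. real ((n + N) choose N) * (real (n + 1) * q - real N * p) * q ^ N)"
    by (simp only: nbin_head_def nbin_head_mean_def sum_distrib_left lessThan_Suc_atMost sum_subtractf[symmetric])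
       (intro sum.cong refl, simp add: algebra_simps)
  also have "\<dots> = beta_const n * p ^ Suc n * q ^ Suc n"
    unfolding nbin_head_telescope[OF assms] beta_const_def mult_2 by (simp add: mult_ac)
  finally show ?thesis by simp
qed

text \<open>The derivative telescopes to the Beta density with both parameters \<open>Suc n\<close>;
  this is the link from truncated sums to incomplete Beta functions.\<close>

lemma nbin_head_has_derivative:
  "((\<lambda>p. nbin_head (Suc n) p (1 - p)) has_real_derivative beta_const n * (p * (1 - p)) ^ n) (at p)"
proof -
  have *: "((\<lambda>p. nbin_head (Suc n) p (1 - p)) has_real_derivative
     (\<Sum>N\<le>n. real ((n + N) choose N) * (real (Suc n) * p ^ n * (1 - p) ^ N
         - p ^ Suc n * (real N * (1 - p) ^ (N - 1))))) (at p)"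
    unfolding nbin_head_def lessThan_Suc_atMost
    apply (rule derivative_eq_intros refl)+
    apply (rule sum.cong[OF refl])
    apply (simp del: power_Suc)
    apply (simp add: algebra_simps)
    done
  have tele: "(\<Sum>N\<le>m. real ((n + N) choose N) * (real (Suc n) * p ^ n * (1 - p) ^ N
         - p ^ Suc n * (real N * (1 - p) ^ (N - 1))))
    = real (n + 1 + m) * real ((n + m) choose m) * p ^ n * (1 - p) ^ m" for m
  proof (induction m)
    case 0
    show ?case by simp
  next
    case (Suc m)
    have ch: "real (Suc m) * real ((n + Suc m) choose Suc m) = real (n + 1 + m) * real ((n + m) choose m)"
      using Suc_times_binomial_eq[of "n + m" m] by (simp flip: of_nat_mult add: algebra_simps)
    show ?case
      unfolding sum.atMost_Suc Suc ch[symmetric] by (simp add: algebra_simps)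
  qed
  have "real (n + 1 + n) * real ((n + n) choose n) * p ^ n * (1 - p) ^ n = beta_const n * (p * (1 - p)) ^ n"
    unfolding beta_const_def mult_2 by (simp add: power_mult_distrib mult.assoc)
  then show ?thesis
    using * unfolding tele by (simp only:)
qed

lemma nbin_head_Suc_1: "nbin_head (Suc n) 1 0 = 1"
  unfolding nbin_head_def sum.lessThan_Suc_shift by simp

text \<open>Among \<open>2 * n + 1\<close> blocks exactly one side finds at least
  \<open>n + 1\<close>. The proof is analytic: the derivative depends on \<open>p * (1 - p)\<close>
  only, so the sum is constant, and it is evaluated at \<open>p = 1\<close>.\<close>

lemma nbin_head_symmetric:
  fixes p q :: real
  assumes "p + q = 1"
  shows "nbin_head (Suc n) p q + nbin_head (Suc n) q p = 1"
proof -
  let ?f = "\<lambda>p. nbin_head (Suc n) p (1 - p) + nbin_head (Suc n) (1 - p) (1 - (1 - p))"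
  have "(?f has_real_derivative 0) (at p)" for p
  proof -
    have "((\<lambda>p. nbin_head (Suc n) (1 - p) (1 - (1 - p))) has_real_derivative
        beta_const n * ((1 - p) * (1 - (1 - p))) ^ n * (- 1)) (at p)"
      by (rule DERIV_chain2[OF nbin_head_has_derivative]) (auto intro!: derivative_eq_intros)
    from DERIV_add[OF nbin_head_has_derivative this] show ?thesis
      by (rule DERIV_cong) (simp add: mult.commute[of p])
  qed
  then have "?f p = ?f 1"
    by (intro DERIV_isconst_all) auto
  moreover have "nbin_head (Suc n) 0 1 = 0" by (simp add: nbin_head_def)
  moreover have "q = 1 - p" using assms by simp
  ultimately show ?thesis by (simp add: nbin_head_Suc_1)
qed

section \<open>Normalising constants of the Beta functions\<close>

lemma beta_const_pos: "beta_const n > 0"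
  by (simp add: beta_const_def)

lemma beta_const_Suc: "real (n + 1) * beta_const (Suc n) = 2 * real (2 * n + 3) * beta_const n"
proof -
  have "Suc n * (Suc (Suc (2 * n)) choose Suc n) = Suc (Suc (2 * n)) * (Suc (2 * n) choose n)"
    by (rule Suc_times_binomial_eq[symmetric, simplified mult.commute])
  moreover have "Suc (2 * n) choose n = Suc (2 * n) choose Suc n"
    by (subst binomial_symmetric) auto
  moreover have "Suc n * (Suc (2 * n) choose Suc n) = Suc (2 * n) * ((2 * n) choose n)"
    by (rule Suc_times_binomial_eq[symmetric, simplified mult.commute])
  ultimately have "Suc n * (Suc n * (Suc (Suc (2 * n)) choose Suc n))
      = Suc (Suc (2 * n)) * (Suc (2 * n) * ((2 * n) choose n))"
    by (metis mult.left_commute)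
  also have "\<dots> = Suc n * (2 * Suc (2 * n) * ((2 * n) choose n))"
    by (simp only: mult_Suc mult_Suc_right) (simp add: algebra_simps)
  finally have "Suc n * (Suc (Suc (2 * n)) choose Suc n) = 2 * Suc (2 * n) * ((2 * n) choose n)"
    by (metis mult_left_cancel nat.distinct(1))
  then have "real (Suc n) * real (Suc (Suc (2 * n)) choose Suc n) = 2 * real (Suc (2 * n)) * real ((2 * n) choose n)"
    by (metis of_nat_mult of_nat_numeral)
  then show ?thesis
    unfolding beta_const_def by (simp del: binomial_Suc_Suc of_nat_Suc add: algebra_simps)
       (simp add: algebra_simps del: binomial_Suc_Suc)
qed

text \<open>Normalisation for the change of variable \<open>p = (1 + y) / 2\<close>: it turns
  \<open>beta_const n / 4 ^ n\<close> into 2 / B(1/2, n + 1), which is how the parameters 1/2 and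
  \<open>z\<close> arise.\<close>

lemma Beta_half_Suc: "Beta (1/2) (real (Suc n)) * beta_const n = 2 * 4 ^ n"
proof (induction n)
  case 0
  have "Beta (1/2 :: real) 1 = 2"
  proof -
    have "(1/2 :: real) \<notin> \<int>\<^sub>\<le>\<^sub>0" by (auto dest: nonpos_Ints_nonpos)
    moreover have "(3/2 :: real) \<notin> \<int>\<^sub>\<le>\<^sub>0" by (auto dest: nonpos_Ints_nonpos)
    ultimately show ?thesis
      using Gamma_plus1[of "1/2 :: real"] by (simp add: Beta_def field_simps Gamma_eq_zero_iff)
  qed
  then show ?case by (simp add: beta_const_def)
next
  case (Suc n)
  have "(1/2 + real (Suc n)) * Beta (1/2) (real (Suc n) + 1) = real (Suc n) * Beta (1/2) (real (Suc n))"
    by (rule Beta_plus1_right) auto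
  then have "real (2 * n + 3) * Beta (1/2) (real (Suc (Suc n))) = 2 * real (Suc n) * Beta (1/2) (real (Suc n))"
    by (simp add: field_simps)
  then have "real (Suc n) * real (2 * n + 3) * (Beta (1/2) (real (Suc (Suc n))) * beta_const (Suc n))
     = 4 * real (Suc n) * real (2 * n + 3) * (Beta (1/2) (real (Suc n)) * beta_const n)"
  proof -
    assume a: "real (2 * n + 3) * Beta (1/2) (real (Suc (Suc n))) = 2 * real (Suc n) * Beta (1/2) (real (Suc n))"
    have "real (Suc n) * real (2 * n + 3) * (Beta (1/2) (real (Suc (Suc n))) * beta_const (Suc n))
       = (real (2 * n + 3) * Beta (1/2) (real (Suc (Suc n)))) * (real (n + 1) * beta_const (Suc n))"
      by (simp only: mult_ac Suc_eq_plus1)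
    then show ?thesis unfolding a beta_const_Suc by (simp only: mult_ac)
  qed
  then have "real (Suc n) * real (2 * n + 3) * (Beta (1/2) (real (Suc (Suc n))) * beta_const (Suc n))
     = real (Suc n) * real (2 * n + 3) * (2 * 4 ^ Suc n)"
    unfolding Suc.IH by (simp only: power_Suc mult_ac)
  then show ?case by (subst (asm) mult_left_cancel) auto
qed

lemma Beta_diag: "Beta (real (Suc n)) (real (Suc n)) * beta_const n = 1"
proof -
  have "Beta (real (Suc n)) (real (Suc n)) = fact n * fact n / fact (2 * n + 1)"
    using Gamma_fact[of n, where ?'a=real] Gamma_fact[of "2 * n + 1", where ?'a=real]
    by (simp add: Beta_def algebra_simps)
  moreover have "real ((2 * n) choose n) = fact (2 * n) / (fact n * fact n)"
    by (subst binomial_fact) auto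
  moreover have "(fact (2 * n + 1) :: real) = real (2 * n + 1) * fact (2 * n)" by simp
  ultimately show ?thesis by (simp add: beta_const_def del: fact_Suc of_nat_add)
qed

lemma Beta_half_pos: "Beta (1/2) (real (Suc n)) > 0"
  using Beta_half_Suc[of n] beta_const_pos[of n] by (metis mult_pos_pos zero_less_mult_pos2 zero_less_numeral zero_less_power)

section \<open>Incomplete Beta functions in the variable y = p - q\<close>

context
  fixes n :: nat
begin

text \<open>As a function of \<open>y = p - q\<close>, this is the head for \<open>(p, q)\<close>
  minus the head for \<open>(q, p)\<close>; that the heads sum to 1 gives the present form, see
  \<open>nbin_gap_eq\<close>.\<close>

definition nbin_gap :: "real \<Rightarrow> real" where
  "nbin_gap y = 2 * nbin_head (Suc n) ((1 + y) / 2) (1 - (1 + y) / 2) - 1"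

lemma nbin_gap_has_derivative:
  "(nbin_gap has_real_derivative 2 * (1 - y\<^sup>2) ^ n / Beta (1/2) (real (Suc n))) (at y)"
proof -
  have "(nbin_gap has_real_derivative 2 * (beta_const n * ((1 + y) / 2 * (1 - (1 + y) / 2)) ^ n * (1/2))) (at y)"
    unfolding nbin_gap_def
    by (auto intro!: derivative_eq_intros DERIV_chain2[OF nbin_head_has_derivative])
  moreover have "(1 + y) / 2 * (1 - (1 + y) / 2) = (1 - y\<^sup>2) / 4"
    by (simp add: field_simps power2_eq_square)
  moreover have "beta_const n / 4 ^ n = 2 / Beta (1/2) (real (Suc n))"
    using Beta_half_Suc[of n] Beta_half_pos[of n] by (simp add: field_simps)
  ultimately show ?thesis
    by (simp add: power_divide field_simps)
qed

text \<open>Since \<open>p * q = (1 - y\<^sup>2) / 4\<close>, the substitution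
  \<open>t = y\<^sup>2\<close> turns the derivative of \<open>nbin_gap\<close> into the Beta density
  with parameters 1/2 and \<open>Suc n\<close>.\<close>

lemma inc_beta_half_left:
  assumes "0 \<le> y" "y < 1"
  shows "inc_beta (y\<^sup>2) (1/2) (real (Suc n)) = nbin_gap y"
proof -
  let ?B = "Beta (1/2) (real (Suc n))"
  \<comment> \<open>The integrand and the derivative of \<open>sqrt\<close> blow up near 0, so the
    fundamental theorem is used in the form that asks for derivatives in the interior and for mere
    continuity at the endpoints.\<close>
  have "((\<lambda>t. t powr (1/2 - 1) * (1 - t) powr (real (Suc n) - 1)) has_integral
      ?B * nbin_gap (sqrt (y\<^sup>2)) - ?B * nbin_gap (sqrt 0)) {0..y\<^sup>2}"
  proof (rule fundamental_theorem_of_calculus_interior)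
    show "continuous_on {0..y\<^sup>2} (\<lambda>x. ?B * nbin_gap (sqrt x))"
      by (auto intro!: continuous_intros continuous_on_compose2[where g=nbin_gap and t=UNIV]
          DERIV_continuous_on[OF has_field_derivative_at_within[OF nbin_gap_has_derivative]])
    fix t assume t: "t \<in> {0<..<y\<^sup>2}"
    then have t': "0 < t" "t < 1" using assms
      by (auto simp: power_strict_mono intro: less_trans[of t "y\<^sup>2" 1] simp: power_less_one_iff abs_square_less_1)
    have "((\<lambda>x. ?B * nbin_gap (sqrt x)) has_real_derivative
       ?B * (2 * (1 - (sqrt t)\<^sup>2) ^ n / ?B * (inverse (sqrt t) / 2))) (at t)"
      using t' by (auto intro!: derivative_eq_intros DERIV_chain2[OF nbin_gap_has_derivative] DERIV_real_sqrt)
    moreover have "?B * (2 * (1 - (sqrt t)\<^sup>2) ^ n / ?B * (inverse (sqrt t) / 2)) =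
         t powr (1/2 - 1) * (1 - t) powr (real (Suc n) - 1)"
      using t' Beta_half_pos[of n]
      by (simp add: powr_realpow powr_minus powr_half_sqrt)
    ultimately show "((\<lambda>x. ?B * nbin_gap (sqrt x)) has_vector_derivative
        t powr (1/2 - 1) * (1 - t) powr (real (Suc n) - 1)) (at t)"
      by (simp add: has_real_derivative_iff_has_vector_derivative)
  qed auto
  moreover have "nbin_gap 0 = 0"
    using nbin_head_symmetric[of "1/2" "1/2" n] by (simp add: nbin_gap_def)
  ultimately show ?thesis
    using assms Beta_half_pos[of n] unfolding inc_beta_def by (simp add: integral_unique)
qed

text \<open>The same antiderivative with \<open>1 - t\<close> in place of \<open>t\<close>. It
  serves the argument \<open>4 * p * q\<close>, which equals \<open>1 - (p - q)\<^sup>2\<close>;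
  \<open>0 < y\<close> keeps the upper limit below 1.\<close>

lemma inc_beta_half_right:
  assumes "0 < y" "y < 1"
  shows "inc_beta (1 - y\<^sup>2) (real (Suc n)) (1/2) = 1 - nbin_gap y"
proof -
  let ?B = "Beta (1/2) (real (Suc n))"
  have y2: "0 < y\<^sup>2" "y\<^sup>2 < 1" using assms by (auto simp: power_less_one_iff abs_square_less_1)
  have "((\<lambda>t. t powr (real (Suc n) - 1) * (1 - t) powr (1/2 - 1)) has_integral
      (- ?B * nbin_gap (sqrt (1 - (1 - y\<^sup>2)))) - (- ?B * nbin_gap (sqrt (1 - 0)))) {0..1 - y\<^sup>2}"
  proof (rule fundamental_theorem_of_calculus_interior)
    show "continuous_on {0..1 - y\<^sup>2} (\<lambda>x. - ?B * nbin_gap (sqrt (1 - x)))"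
      by (auto intro!: continuous_intros continuous_on_compose2[where g=nbin_gap and t=UNIV]
          DERIV_continuous_on[OF has_field_derivative_at_within[OF nbin_gap_has_derivative]])
    fix t assume t: "t \<in> {0<..<1 - y\<^sup>2}"
    then have t': "0 < t" "t < 1" using y2 unfolding greaterThanLessThan_iff by linarith+
    have "((\<lambda>x. sqrt (1 - x)) has_real_derivative (inverse (sqrt (1 - t)) / 2) * (- 1)) (at t)"
      using t' by (intro DERIV_chain2[OF DERIV_real_sqrt]) (auto intro!: derivative_eq_intros)
    then have "((\<lambda>x. - ?B * nbin_gap (sqrt (1 - x))) has_real_derivative
       - ?B * (2 * (1 - (sqrt (1 - t))\<^sup>2) ^ n / ?B * ((inverse (sqrt (1 - t)) / 2) * (- 1)))) (at t)"
      by (intro DERIV_cmult DERIV_chain2[OF nbin_gap_has_derivative])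
    moreover have "- ?B * (2 * (1 - (sqrt (1 - t))\<^sup>2) ^ n / ?B * ((inverse (sqrt (1 - t)) / 2) * (- 1))) =
         t powr (real (Suc n) - 1) * (1 - t) powr (1/2 - 1)"
      using t' Beta_half_pos[of n]
      by (simp add: powr_realpow powr_minus powr_half_sqrt)
    ultimately show "((\<lambda>x. - ?B * nbin_gap (sqrt (1 - x))) has_vector_derivative
        t powr (real (Suc n) - 1) * (1 - t) powr (1/2 - 1)) (at t)"
      by (simp add: has_real_derivative_iff_has_vector_derivative)
  qed (use y2 in auto)
  moreover have "nbin_gap 1 = 1"
    by (simp add: nbin_gap_def nbin_head_Suc_1)
  moreover have "Beta (real (Suc n)) (1/2) = ?B" by (rule Beta_commute)
  ultimately show ?thesis
    using assms Beta_half_pos[of n] unfolding inc_beta_def by (simp add: integral_unique field_simps)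
qed

lemma nbin_gap_eq:
  assumes "p + q = 1"
  shows "nbin_gap (p - q) = nbin_head (Suc n) p q - nbin_head (Suc n) q p"
proof -
  have e: "(1 + (p - q)) / 2 = p" "1 - p = q" using assms by (auto simp: field_simps)
  show ?thesis using nbin_head_symmetric[OF assms, of n] unfolding nbin_gap_def e by simp
qed

end

section \<open>Two independent sequences of exponential waiting times\<close>

abbreviation exp_measure :: "real \<Rightarrow> real measure" where
  "exp_measure r \<equiv> density lborel (exponential_density r)"

abbreviation exp_seq :: "real \<Rightarrow> (nat \<Rightarrow> real) measure" where
  "exp_seq r \<equiv> \<Pi>\<^sub>M i\<in>UNIV. exp_measure r"

abbreviation exp_seq2 :: "real \<Rightarrow> real \<Rightarrow> ((nat \<Rightarrow> real) \<times> (nat \<Rightarrow> real)) measure" where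
  "exp_seq2 a b \<equiv> exp_seq a \<Otimes>\<^sub>M exp_seq b"

text \<open>Case split on which clock rings first. Stated for an arbitrary nonnegative
  \<open>g\<close>, the identity contains at once the law of the first ring, its independence of the
  winner and the loser's lack of memory.\<close>

lemma nn_integral_competing_exponentials:
  fixes g :: "real \<Rightarrow> real \<Rightarrow> ennreal"
  assumes a: "0 < a" and b: "0 < b"
    and g[measurable]: "(\<lambda>(x, y). g x y) \<in> borel_measurable (borel \<Otimes>\<^sub>M borel)"
  shows "(\<integral>\<^sup>+x. \<integral>\<^sup>+y. g x y \<partial>exp_measure b \<partial>exp_measure a) =
    (\<integral>\<^sup>+u. ennreal (a / (a + b)) * (\<integral>\<^sup>+w. g u (u + w) \<partial>exp_measure b)
         + ennreal (b / (a + b)) * (\<integral>\<^sup>+w. g (u + w) u \<partial>exp_measure a) \<partial>exp_measure (a + b))"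
proof -
  let ?e = exponential_density
  \<comment> \<open>Joint density of a first ring at \<open>u\<close> and a second one at
    \<open>u + w\<close>, factored into the law of the minimum, the probability of the winner and a
    fresh waiting time of the loser.\<close>
  have e: "ennreal (?e a' u) * ennreal (?e b' (u + w)) * indicator {0<..} w =
      ennreal (?e (a' + b') u) * ennreal (a' / (a' + b')) * ennreal (?e b' w) * indicator {0<..} w"
    if "0 < a'" "0 < b'" for a' b' u w :: real
    using that by (auto simp: exponential_density_def ennreal_mult[symmetric] indicator_def
        exp_add[symmetric] field_simps)
  \<comment> \<open>The contribution of one winner, for generic rates because it is used a second
    time with the rates exchanged.\<close>
  have half: "(\<integral>\<^sup>+x. \<integral>\<^sup>+y. ennreal (?e a' x) * ennreal (?e b' y) * k x y * (if x < y then 1 else 0) \<partial>lborel \<partial>lborel) =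
     (\<integral>\<^sup>+u. ennreal (a' / (a' + b')) * (\<integral>\<^sup>+w. k u (u + w) \<partial>exp_measure b') \<partial>exp_measure (a' + b'))"
    if ab: "0 < a'" "0 < b'" and k[measurable]: "(\<lambda>(x, y). k x y) \<in> borel_measurable (borel \<Otimes>\<^sub>M borel)"
    for a' b' :: real and k
  proof -
    have "(\<integral>\<^sup>+y. ennreal (?e a' x) * ennreal (?e b' y) * k x y * (if x < y then 1 else 0) \<partial>lborel) =
        ennreal (?e (a' + b') x) * (ennreal (a' / (a' + b')) * (\<integral>\<^sup>+w. ennreal (?e b' w) * k x (x + w) \<partial>lborel))" for x
    proof -
      have "(\<integral>\<^sup>+y. ennreal (?e a' x) * ennreal (?e b' y) * k x y * (if x < y then 1 else 0) \<partial>lborel)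
        = (\<integral>\<^sup>+w. ennreal (?e a' x) * ennreal (?e b' (x + w)) * k x (x + w) * (if x < x + w then 1 else 0) \<partial>lborel)"
        by (subst nn_integral_real_affine[where c=1 and t=x]) auto
      also have "\<dots> = (\<integral>\<^sup>+w. (ennreal (?e a' x) * ennreal (?e b' (x + w)) * indicator {0<..} w) * k x (x + w) \<partial>lborel)"
        by (intro nn_integral_cong) (auto simp: indicator_def)
      also have "\<dots> = (\<integral>\<^sup>+w. (ennreal (?e (a' + b') x) * ennreal (a' / (a' + b')) * ennreal (?e b' w) * indicator {0<..} w) * k x (x + w) \<partial>lborel)"
        by (simp only: e[OF ab])
      also have "\<dots> = (\<integral>\<^sup>+w. (ennreal (?e (a' + b') x) * ennreal (a' / (a' + b'))) * (ennreal (?e b' w) * k x (x + w)) \<partial>lborel)"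
      proof (intro nn_integral_cong_AE)
        have "AE w in lborel. w \<noteq> (0::real)" by (rule AE_lborel_singleton)
        then show "AE w in lborel. (ennreal (?e (a' + b') x) * ennreal (a' / (a' + b')) * ennreal (?e b' w) * indicator {0<..} w) * k x (x + w)
          = (ennreal (?e (a' + b') x) * ennreal (a' / (a' + b'))) * (ennreal (?e b' w) * k x (x + w))"
          by eventually_elim (auto simp: indicator_def exponential_density_def mult_ac)
      qed
      also have "\<dots> = (ennreal (?e (a' + b') x) * ennreal (a' / (a' + b'))) * (\<integral>\<^sup>+w. ennreal (?e b' w) * k x (x + w) \<partial>lborel)"
        by (rule nn_integral_cmult) measurable
      finally show ?thesis by (simp add: mult.assoc)
    qed
    then show ?thesis
      by (simp add: nn_integral_density)
  qed
  have "(\<integral>\<^sup>+x. \<integral>\<^sup>+y. g x y \<partial>exp_measure b \<partial>exp_measure a)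
     = (\<integral>\<^sup>+x. \<integral>\<^sup>+y. ennreal (?e a x) * ennreal (?e b y) * g x y \<partial>lborel \<partial>lborel)"
    by (simp add: nn_integral_density nn_integral_cmult[symmetric] mult.assoc)
  also have "\<dots> = (\<integral>\<^sup>+x. \<integral>\<^sup>+y. ennreal (?e a x) * ennreal (?e b y) * g x y * (if x < y then 1 else 0)
       + ennreal (?e b y) * ennreal (?e a x) * g x y * (if y < x then 1 else 0) \<partial>lborel \<partial>lborel)"
  proof (rule nn_integral_cong, rule nn_integral_cong_AE)
    fix x :: real
    have "AE y in lborel. y \<noteq> x" by (rule AE_lborel_singleton)
    then show "AE y in lborel. ennreal (?e a x) * ennreal (?e b y) * g x y =
       ennreal (?e a x) * ennreal (?e b y) * g x y * (if x < y then 1 else 0)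
       + ennreal (?e b y) * ennreal (?e a x) * g x y * (if y < x then 1 else 0)"
      by eventually_elim (auto simp: indicator_def mult_ac)
  qed
  also have "\<dots> = (\<integral>\<^sup>+x. \<integral>\<^sup>+y. ennreal (?e a x) * ennreal (?e b y) * g x y * (if x < y then 1 else 0) \<partial>lborel \<partial>lborel)
      + (\<integral>\<^sup>+x. \<integral>\<^sup>+y. ennreal (?e b y) * ennreal (?e a x) * g x y * (if y < x then 1 else 0) \<partial>lborel \<partial>lborel)"
    by (simp add: nn_integral_add)
  also have "(\<integral>\<^sup>+x. \<integral>\<^sup>+y. ennreal (?e b y) * ennreal (?e a x) * g x y * (if y < x then 1 else 0) \<partial>lborel \<partial>lborel)
      = (\<integral>\<^sup>+y. \<integral>\<^sup>+x. ennreal (?e b y) * ennreal (?e a x) * g x y * (if y < x then 1 else 0) \<partial>lborel \<partial>lborel)"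
    by (rule lborel_pair.Fubini'[symmetric]) measurable
  also have "\<dots> = (\<integral>\<^sup>+u. ennreal (b / (b + a)) * (\<integral>\<^sup>+w. g (u + w) u \<partial>exp_measure a) \<partial>exp_measure (b + a))"
    by (rule half[OF b a]) measurable
  also have "(\<integral>\<^sup>+x. \<integral>\<^sup>+y. ennreal (?e a x) * ennreal (?e b y) * g x y * (if x < y then 1 else 0) \<partial>lborel \<partial>lborel)
      = (\<integral>\<^sup>+u. ennreal (a / (a + b)) * (\<integral>\<^sup>+w. g u (u + w) \<partial>exp_measure b) \<partial>exp_measure (a + b))"
    by (rule half[OF a b]) measurable
  finally show ?thesis
    by (simp add: nn_integral_add add.commute[of b a] nn_integral_density)
qed

section \<open>Splitting off the first block from both sequences\<close>

lemma sequence_space_exp_measure: "0 < r \<Longrightarrow> sequence_space (exp_measure r)"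
  unfolding sequence_space_def product_prob_space_def product_sigma_finite_def product_prob_space_axioms_def
  by (simp add: prob_space_exponential_density prob_space_imp_sigma_finite)

lemma prob_space_exp_seq: "0 < r \<Longrightarrow> prob_space (exp_seq r)"
  by (intro prob_space_PiM prob_space_exponential_density)

lemma nn_integral_exp_seq_Cons:
  assumes "0 < r" and [measurable]: "f \<in> borel_measurable (exp_seq r)"
  shows "(\<integral>\<^sup>+x. f x \<partial>exp_seq r) = (\<integral>\<^sup>+h. \<integral>\<^sup>+x. f (case_nat h x) \<partial>exp_seq r \<partial>exp_measure r)"
proof -
  interpret S: prob_space "exp_seq r" by (rule prob_space_exp_seq) fact
  interpret sequence_space "exp_measure r" by (rule sequence_space_exp_measure) fact
  have "(\<integral>\<^sup>+x. f x \<partial>exp_seq r) = (\<integral>\<^sup>+x. f x \<partial>distr (exp_measure r \<Otimes>\<^sub>M exp_seq r) (exp_seq r) (\<lambda>(s, \<omega>). case_nat s \<omega>))"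
    by (simp only: PiM_iter)
  also have "\<dots> = (\<integral>\<^sup>+x. f (case x of (s, \<omega>) \<Rightarrow> case_nat s \<omega>) \<partial>(exp_measure r \<Otimes>\<^sub>M exp_seq r))"
    by (subst nn_integral_distr) auto
  also have "\<dots> = (\<integral>\<^sup>+h. \<integral>\<^sup>+x. f (case_nat h x) \<partial>exp_seq r \<partial>exp_measure r)"
    by (subst S.nn_integral_fst[symmetric]) auto
  finally show ?thesis .
qed

text \<open>The sequence of the side that did not find the first block, when that block came at time
  \<open>u\<close>: lengthening the first waiting time postpones all its event times by
  \<open>u\<close>.\<close>

definition delay :: "real \<Rightarrow> (nat \<Rightarrow> real) \<Rightarrow> nat \<Rightarrow> real" where
  "delay u x = x(0 := u + x 0)"

lemma delay_case_nat: "delay u (case_nat w x) = case_nat (u + w) x"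
  by (auto simp: delay_def fun_eq_iff split: nat.split)

lemma measurable_delay[measurable]:
  "(\<lambda>(u, x). delay u x) \<in> borel \<Otimes>\<^sub>M exp_seq r \<rightarrow>\<^sub>M exp_seq r"
proof (rule measurable_PiM_single')
  show "(\<lambda>\<omega>. (case \<omega> of (u, x) \<Rightarrow> delay u x) i) \<in> borel \<Otimes>\<^sub>M exp_seq r \<rightarrow>\<^sub>M exp_measure r" for i
    by (cases i) (auto simp: delay_def case_prod_beta')
qed (auto simp: space_PiM)

lemma measurable_case_nat_seq[measurable]:
  "(\<lambda>(u, x). case_nat u x) \<in> borel \<Otimes>\<^sub>M exp_seq r \<rightarrow>\<^sub>M exp_seq r"
proof (rule measurable_PiM_single')
  show "(\<lambda>\<omega>. (case \<omega> of (u, x) \<Rightarrow> case_nat u x) i) \<in> borel \<Otimes>\<^sub>M exp_seq r \<rightarrow>\<^sub>M exp_measure r" for i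
    by (cases i) (auto simp: case_prod_beta')
qed (auto simp: space_PiM)

text \<open>The first waiting times are split off and compared, and the loser's excess is put back
  in front of its tail. The two sequences left over have the original joint law again.\<close>

lemma nn_integral_first_block:
  fixes F :: "(nat \<Rightarrow> real) \<times> (nat \<Rightarrow> real) \<Rightarrow> ennreal"
  assumes a: "0 < a" and b: "0 < b" and F[measurable]: "F \<in> borel_measurable (exp_seq2 a b)"
  shows "(\<integral>\<^sup>+\<omega>. F \<omega> \<partial>exp_seq2 a b) =
    (\<integral>\<^sup>+u. \<integral>\<^sup>+(x, y). ennreal (a / (a + b)) * F (case_nat u x, delay u y)
        + ennreal (b / (a + b)) * F (delay u x, case_nat u y) \<partial>exp_seq2 a b \<partial>exp_measure (a + b))"
proof -
  interpret A: prob_space "exp_seq a" by (rule prob_space_exp_seq) fact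
  interpret B: prob_space "exp_seq b" by (rule prob_space_exp_seq) fact
  interpret EA: prob_space "exp_measure a" by (rule prob_space_exponential_density) fact
  interpret EB: prob_space "exp_measure b" by (rule prob_space_exponential_density) fact
  interpret AEB: pair_sigma_finite "exp_seq a" "exp_measure b" ..
  interpret AB: pair_sigma_finite "exp_seq a" "exp_seq b" ..
  interpret EAB: pair_sigma_finite "exp_measure a" "exp_seq b" ..
  \<comment> \<open>Average over both tails with the first waiting times held fixed: a function of
    two reals, to which the competition of two clocks applies.\<close>
  define g where "g h k = (\<integral>\<^sup>+x. \<integral>\<^sup>+y. F (case_nat h x, case_nat k y) \<partial>exp_seq b \<partial>exp_seq a)" for h k
  have g[measurable]: "(\<lambda>(h, k). g h k) \<in> borel_measurable (borel \<Otimes>\<^sub>M borel)"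
    unfolding g_def by measurable
  have "(\<integral>\<^sup>+\<omega>. F \<omega> \<partial>exp_seq2 a b) = (\<integral>\<^sup>+x. \<integral>\<^sup>+y. F (x, y) \<partial>exp_seq b \<partial>exp_seq a)"
    by (rule B.nn_integral_fst[symmetric]) measurable
  also have "\<dots> = (\<integral>\<^sup>+h. \<integral>\<^sup>+x. \<integral>\<^sup>+y. F (case_nat h x, y) \<partial>exp_seq b \<partial>exp_seq a \<partial>exp_measure a)"
    by (rule nn_integral_exp_seq_Cons[OF a]) measurable
  also have "\<dots> = (\<integral>\<^sup>+h. \<integral>\<^sup>+x. \<integral>\<^sup>+k. \<integral>\<^sup>+y. F (case_nat h x, case_nat k y) \<partial>exp_seq b \<partial>exp_measure b \<partial>exp_seq a \<partial>exp_measure a)"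
    by (intro nn_integral_cong nn_integral_exp_seq_Cons[OF b]) measurable
  also have "\<dots> = (\<integral>\<^sup>+h. \<integral>\<^sup>+k. g h k \<partial>exp_measure b \<partial>exp_measure a)"
    unfolding g_def by (intro nn_integral_cong AEB.Fubini'[symmetric]) measurable
  also have "\<dots> = (\<integral>\<^sup>+u. ennreal (a / (a + b)) * (\<integral>\<^sup>+w. g u (u + w) \<partial>exp_measure b)
         + ennreal (b / (a + b)) * (\<integral>\<^sup>+w. g (u + w) u \<partial>exp_measure a) \<partial>exp_measure (a + b))"
    by (rule nn_integral_competing_exponentials[OF a b g])
  also have "\<dots> = (\<integral>\<^sup>+u. \<integral>\<^sup>+(x, y). ennreal (a / (a + b)) * F (case_nat u x, delay u y)
        + ennreal (b / (a + b)) * F (delay u x, case_nat u y) \<partial>exp_seq2 a b \<partial>exp_measure (a + b))"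
  proof (intro nn_integral_cong)
    fix u :: real
    have "(\<integral>\<^sup>+w. g u (u + w) \<partial>exp_measure b) = (\<integral>\<^sup>+x. \<integral>\<^sup>+w. \<integral>\<^sup>+y. F (case_nat u x, delay u (case_nat w y)) \<partial>exp_seq b \<partial>exp_measure b \<partial>exp_seq a)"
      unfolding g_def delay_case_nat by (rule AEB.Fubini') measurable
    also have "\<dots> = (\<integral>\<^sup>+x. \<integral>\<^sup>+y. F (case_nat u x, delay u y) \<partial>exp_seq b \<partial>exp_seq a)"
      by (intro nn_integral_cong nn_integral_exp_seq_Cons[OF b, symmetric]) measurable
    also have "\<dots> = (\<integral>\<^sup>+(x, y). F (case_nat u x, delay u y) \<partial>exp_seq2 a b)"
      by (subst B.nn_integral_fst[symmetric]) auto
    finally have 1: "(\<integral>\<^sup>+w. g u (u + w) \<partial>exp_measure b) = (\<integral>\<^sup>+(x, y). F (case_nat u x, delay u y) \<partial>exp_seq2 a b)" .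
    have "(\<integral>\<^sup>+w. g (u + w) u \<partial>exp_measure a) = (\<integral>\<^sup>+w. \<integral>\<^sup>+x. \<integral>\<^sup>+y. F (delay u (case_nat w x), case_nat u y) \<partial>exp_seq b \<partial>exp_seq a \<partial>exp_measure a)"
      unfolding g_def delay_case_nat ..
    also have "\<dots> = (\<integral>\<^sup>+x. \<integral>\<^sup>+y. F (delay u x, case_nat u y) \<partial>exp_seq b \<partial>exp_seq a)"
      by (intro nn_integral_exp_seq_Cons[OF a, symmetric]) measurable
    also have "\<dots> = (\<integral>\<^sup>+(x, y). F (delay u x, case_nat u y) \<partial>exp_seq2 a b)"
      by (subst B.nn_integral_fst[symmetric]) auto
    finally have 2: "(\<integral>\<^sup>+w. g (u + w) u \<partial>exp_measure a) = (\<integral>\<^sup>+(x, y). F (delay u x, case_nat u y) \<partial>exp_seq2 a b)" .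
    show "ennreal (a / (a + b)) * (\<integral>\<^sup>+w. g u (u + w) \<partial>exp_measure b)
         + ennreal (b / (a + b)) * (\<integral>\<^sup>+w. g (u + w) u \<partial>exp_measure a) =
      (\<integral>\<^sup>+(x, y). ennreal (a / (a + b)) * F (case_nat u x, delay u y)
        + ennreal (b / (a + b)) * F (delay u x, case_nat u y) \<partial>exp_seq2 a b)"
      unfolding 1 2
      by (subst nn_integral_cmult[symmetric], measurable)+
         (subst nn_integral_add[symmetric], auto simp: case_prod_beta')
  qed
  finally show ?thesis .
qed

section \<open>Sequences of pairs and pairs of sequences\<close>

lemma nn_integral_PiM_prod:
  assumes M: "prob_space M" and J: "finite J" and f: "\<And>i. i \<in> J \<Longrightarrow> f i \<in> borel_measurable M"
  shows "(\<integral>\<^sup>+x. (\<Prod>i\<in>J. f i (x i)) \<partial>(\<Pi>\<^sub>M i\<in>UNIV. M)) = (\<Prod>i\<in>J. \<integral>\<^sup>+x. f i x \<partial>M)"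
proof -
  interpret M: prob_space M by fact
  interpret product_prob_space "\<lambda>_. M" UNIV by standard
  have "(\<integral>\<^sup>+x. (\<Prod>i\<in>J. f i (x i)) \<partial>(\<Pi>\<^sub>M i\<in>UNIV. M))
      = (\<integral>\<^sup>+x. (\<Prod>i\<in>J. f i (restrict x J i)) \<partial>(\<Pi>\<^sub>M i\<in>UNIV. M))"
    by (intro nn_integral_cong prod.cong) auto
  also have "\<dots> = (\<integral>\<^sup>+x. (\<Prod>i\<in>J. f i (x i)) \<partial>distr (\<Pi>\<^sub>M i\<in>UNIV. M) (\<Pi>\<^sub>M i\<in>J. M) (\<lambda>x. restrict x J))"
    using f by (subst nn_integral_distr) (auto intro!: borel_measurable_prod_ennreal measurable_compose[OF measurable_component_singleton])
  also have "\<dots> = (\<integral>\<^sup>+x. (\<Prod>i\<in>J. f i (x i)) \<partial>(\<Pi>\<^sub>M i\<in>J. M))"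
    using J by (subst distr_PiM_restrict_finite) auto
  also have "\<dots> = (\<Prod>i\<in>J. \<integral>\<^sup>+x. f i x \<partial>M)"
    using J f by (rule product_nn_integral_prod)
  finally show ?thesis .
qed

text \<open>The sample space has one index for both miners, but a block advances only one of the two
  sequences; hence the passage to a pair of sequences. The measures are compared on finite cylinders
  whose sides \<open>X i\<close> need not be rectangles: for fixed \<open>y\<close> the integral
  over \<open>x\<close> factors over \<open>J\<close>, and then so does the integral over
  \<open>y\<close>.\<close>

lemma distr_zip_PiM:
  fixes A :: "'a measure" and B :: "'b measure"
  assumes A: "prob_space A" and B: "prob_space B"
  shows "distr ((\<Pi>\<^sub>M i\<in>(UNIV::nat set). A) \<Otimes>\<^sub>M (\<Pi>\<^sub>M i\<in>(UNIV::nat set). B)) (\<Pi>\<^sub>M i\<in>UNIV. A \<Otimes>\<^sub>M B)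
      (\<lambda>(x, y) i. (x i, y i)) = (\<Pi>\<^sub>M i\<in>UNIV. A \<Otimes>\<^sub>M B)" (is "distr ?N ?M ?z = ?M")
proof -
  interpret A: prob_space A by fact
  interpret B: prob_space B by fact
  interpret AB: pair_prob_space A B ..
  interpret PA: product_prob_space "\<lambda>_. A" "UNIV :: nat set" by standard
  interpret PB: product_prob_space "\<lambda>_. B" "UNIV :: nat set" by standard
  interpret P: product_prob_space "\<lambda>_. A \<Otimes>\<^sub>M B" "UNIV :: nat set" by standard
  interpret N: pair_prob_space "\<Pi>\<^sub>M i\<in>(UNIV::nat set). A" "\<Pi>\<^sub>M i\<in>(UNIV::nat set). B" ..
  have z[measurable]: "?z \<in> ?N \<rightarrow>\<^sub>M ?M"
  proof (rule measurable_PiM_single')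
    show "(\<lambda>\<omega>. (case \<omega> of (x, y) \<Rightarrow> \<lambda>i. (x i, y i)) i) \<in> ?N \<rightarrow>\<^sub>M A \<Otimes>\<^sub>M B" for i
      by (simp add: case_prod_beta')
  qed (auto simp: space_PiM space_pair_measure)
  show ?thesis
  proof (rule measure_eqI_PiM_infinite)
    fix X :: "nat \<Rightarrow> ('a \<times> 'b) set" and J :: "nat set"
    assume J: "finite J" "J \<subseteq> UNIV" and X[measurable]: "\<And>i. i \<in> J \<Longrightarrow> X i \<in> sets (A \<Otimes>\<^sub>M B)"
    have "emeasure (distr ?N ?M ?z) (prod_emb UNIV (\<lambda>_. A \<Otimes>\<^sub>M B) J (Pi\<^sub>E J X))
       = (\<integral>\<^sup>+\<omega>. indicator (prod_emb UNIV (\<lambda>_. A \<Otimes>\<^sub>M B) J (Pi\<^sub>E J X)) (?z \<omega>) \<partial>?N)"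
    proof -
      have [measurable]: "prod_emb UNIV (\<lambda>_. A \<Otimes>\<^sub>M B) J (Pi\<^sub>E J X) \<in> sets ?M"
        using J X by (intro sets_PiM_I) auto
      then show ?thesis
        by (subst nn_integral_distr[OF z, symmetric]) simp_all
    qed
    also have "\<dots> = (\<integral>\<^sup>+\<omega>. (\<Prod>i\<in>J. indicator (X i) (fst \<omega> i, snd \<omega> i)) \<partial>?N)"
    proof (intro nn_integral_cong)
      fix \<omega> assume \<omega>: "\<omega> \<in> space ?N"
      have "?z \<omega> \<in> space ?M" using measurable_space[OF z \<omega>] .
      then have "?z \<omega> \<in> prod_emb UNIV (\<lambda>_. A \<Otimes>\<^sub>M B) J (Pi\<^sub>E J X) \<longleftrightarrow> (\<forall>i\<in>J. (fst \<omega> i, snd \<omega> i) \<in> X i)"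
        by (auto simp: prod_emb_def space_PiM case_prod_beta' PiE_iff)
      then show "indicator (prod_emb UNIV (\<lambda>_. A \<Otimes>\<^sub>M B) J (Pi\<^sub>E J X)) (?z \<omega>)
         = (\<Prod>i\<in>J. indicator (X i) (fst \<omega> i, snd \<omega> i) :: ennreal)"
        using J(1) by (auto simp: indicator_def prod_zero_iff)
    qed
    also have "\<dots> = (\<integral>\<^sup>+y. \<integral>\<^sup>+x. (\<Prod>i\<in>J. indicator (X i) (x i, y i)) \<partial>(\<Pi>\<^sub>M i\<in>UNIV. A) \<partial>(\<Pi>\<^sub>M i\<in>UNIV. B))"
      by (subst N.nn_integral_snd[symmetric]) (auto intro!: borel_measurable_prod_ennreal simp: case_prod_beta')
    also have "\<dots> = (\<integral>\<^sup>+y. (\<Prod>i\<in>J. \<integral>\<^sup>+x. indicator (X i) (x, y i) \<partial>A) \<partial>(\<Pi>\<^sub>M i\<in>UNIV. B))"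
      by (intro nn_integral_cong nn_integral_PiM_prod[OF A J(1)])
        (auto simp: space_PiM PiE_iff)
    also have "\<dots> = (\<Prod>i\<in>J. \<integral>\<^sup>+y. \<integral>\<^sup>+x. indicator (X i) (x, y) \<partial>A \<partial>B)"
      by (rule nn_integral_PiM_prod[OF B J(1)]) measurable
    also have "\<dots> = (\<Prod>i\<in>J. emeasure (A \<Otimes>\<^sub>M B) (X i))"
      by (intro prod.cong refl) (subst AB.nn_integral_snd, auto)
    also have "\<dots> = emeasure ?M (prod_emb UNIV (\<lambda>_. A \<Otimes>\<^sub>M B) J (Pi\<^sub>E J X))"
      using J X by (subst P.emeasure_PiM_emb) auto
    finally show "emeasure (distr ?N ?M ?z) (prod_emb UNIV (\<lambda>_. A \<Otimes>\<^sub>M B) J (Pi\<^sub>E J X)) = \<dots>" .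
  next
    show "finite_measure (distr ?N ?M ?z)"
      by (intro N.finite_measure_distr) measurable
  qed auto
qed

text \<open>Excludes accumulation of blocks, where \<open>card\<close> of an infinite set would be
  0. The product of the first \<open>n\<close> factors \<open>exp (- x i)\<close> has expectation
  \<open>\<rho> ^ n\<close> with \<open>\<rho> = r / (r + 1) < 1\<close>, so the infinite product
  \<open>Y\<close> vanishes almost surely, which means that the partial sums are unbounded.\<close>

lemma AE_exp_seq_good:
  assumes r: "0 < r"
  shows "AE x in exp_seq r. (\<forall>i. 0 < x i) \<and> (\<forall>t. finite {k. (\<Sum>i\<le>k. x i) \<le> t})"
proof -
  interpret E: prob_space "exp_measure r" by (rule prob_space_exponential_density) fact
  interpret S: prob_space "exp_seq r" by (rule prob_space_exp_seq) fact
  have "AE x in lborel. x \<noteq> (0::real)" by (rule AE_lborel_singleton)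
  then have "AE x in exp_measure r. 0 < x"
    by (subst AE_density) (auto simp: exponential_density_def elim!: eventually_mono)
  then have "AE x in exp_seq r. 0 < x i" for i
    by (intro AE_PiM_component) (auto intro: E.prob_space_axioms)
  then have pos: "AE x in exp_seq r. \<forall>i. 0 < x i"
    by (simp add: AE_all_countable)
  define \<rho> where "\<rho> = (\<integral>\<^sup>+x. ennreal (exp (- x)) \<partial>exp_measure r)"
  have \<rho>: "\<rho> = ennreal (r / (r + 1))"
  proof -
    have "\<rho> = (\<integral>\<^sup>+x. ennreal (r / (r + 1)) * ennreal (exponential_density (r + 1) x) \<partial>lborel)"
      unfolding \<rho>_def using r
      by (subst nn_integral_density)
        (auto intro!: nn_integral_cong simp: exponential_density_def ennreal_mult[symmetric] exp_add[symmetric] field_simps)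
    also have "\<dots> = ennreal (r / (r + 1)) * emeasure (exp_measure (r + 1)) (space (exp_measure (r + 1)))"
      by (simp add: nn_integral_cmult emeasure_density)
    finally show ?thesis
      using prob_space.emeasure_space_1[OF prob_space_exponential_density[of "r + 1"]] r by simp
  qed
  define Y where "Y x = (INF n. \<Prod>i\<in>{..<n}. ennreal (exp (- x i)))" for x :: "nat \<Rightarrow> real"
  have [measurable]: "Y \<in> borel_measurable (exp_seq r)"
    unfolding Y_def by measurable
  have "(\<integral>\<^sup>+x. Y x \<partial>exp_seq r) \<le> ennreal ((r / (r + 1)) ^ n)" for n
  proof -
    have "(\<integral>\<^sup>+x. Y x \<partial>exp_seq r) \<le> (\<integral>\<^sup>+x. (\<Prod>i\<in>{..<n}. ennreal (exp (- x i))) \<partial>exp_seq r)"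
      unfolding Y_def by (intro nn_integral_mono INF_lower) auto
    also have "\<dots> = \<rho> ^ n"
      by (subst nn_integral_PiM_prod) (auto simp: \<rho>_def intro: E.prob_space_axioms)
    finally show ?thesis using r by (simp add: \<rho> ennreal_power)
  qed
  moreover have "(\<lambda>n. ennreal ((r / (r + 1)) ^ n)) \<longlonglongrightarrow> ennreal 0"
    using r by (intro tendsto_ennrealI LIMSEQ_power_zero) auto
  ultimately have "(\<integral>\<^sup>+x. Y x \<partial>exp_seq r) \<le> ennreal 0"
    by (intro LIMSEQ_le_const) auto
  then have "AE x in exp_seq r. Y x = 0"
    by (subst (asm) ennreal_0, subst (asm) le_zero_eq, subst (asm) nn_integral_0_iff_AE) auto
  with pos show ?thesis
  proof eventually_elim
    fix x :: "nat \<Rightarrow> real" assume x: "\<forall>i. 0 < x i" "Y x = 0"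
    have "finite {k. (\<Sum>i\<le>k. x i) \<le> t}" for t
    proof -
      have "Y x < ennreal (exp (- t))" using x by simp
      then obtain n where n: "(\<Prod>i\<in>{..<n}. ennreal (exp (- x i))) < ennreal (exp (- t))"
        unfolding Y_def by (auto simp: INF_less_iff)
      then have "exp (- (\<Sum>i<n. x i)) < exp (- t)"
        by (simp add: prod_ennreal exp_sum sum_negf[symmetric] ennreal_less_iff prod_nonneg)
      then have "t < (\<Sum>i<n. x i)" by simp
      then have "k < n" if "(\<Sum>i\<le>k. x i) \<le> t" for k
      proof (rule_tac ccontr)
        assume "\<not> k < n"
        then have "(\<Sum>i<n. x i) \<le> (\<Sum>i\<le>k. x i)"
          using x by (intro sum_mono2) (auto simp: less_imp_le)
        with that \<open>t < _\<close> show False by simp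
      qed
      then have "{k. (\<Sum>i\<le>k. x i) \<le> t} \<subseteq> {..<n}" by auto
      then show ?thesis by (rule finite_subset) simp
    qed
    with x show "(\<forall>i. 0 < x i) \<and> (\<forall>t. finite {k. (\<Sum>i\<le>k. x i) \<le> t})" by blast
  qed
qed

section \<open>Measurability of first times determined by two counting processes\<close>

definition cnt :: "(nat \<Rightarrow> real) \<Rightarrow> real \<Rightarrow> nat" where
  "cnt X t = card {k. X k \<le> t}"

lemma measurable_cnt[measurable (raw)]:
  assumes [measurable]: "\<And>k. X k \<in> borel_measurable S" "T \<in> borel_measurable S"
  shows "(\<lambda>\<omega>. cnt (\<lambda>k. X k \<omega>) (T \<omega>)) \<in> measurable S (count_space UNIV)"
  unfolding cnt_def by (rule measurable_card) simp

text \<open>Measurability is shown at every sample point, so \<open>X\<close> is an arbitrary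
  sequence. If finitely many events lie at or below \<open>t\<close>, the latest of them marks
  \<open>s\<close>. If infinitely many do, the count is 0 by the convention for \<open>card\<close>,
  and it is already 0 slightly earlier unless \<open>t\<close> is exactly the liminf.\<close>

lemma cnt_locally_constant:
  assumes "t \<notin> range X" "t \<noteq> real_of_ereal (liminf (\<lambda>k. ereal (X k)))"
  shows "\<exists>s<t. \<forall>r\<in>{s..t}. cnt X r = cnt X t"
proof (cases "finite {k. X k \<le> t}")
  case True
  \<comment> \<open>\<open>t - 1\<close> serves when no event lies at or below
    \<open>t\<close>.\<close>
  define s where "s = Max (insert (t - 1) (X ` {k. X k \<le> t}))"
  have "s < t" unfolding s_def using True assms(1) by (subst Max_less_iff) (auto simp: less_le)
  moreover have "cnt X r = cnt X t" if "r \<in> {s..t}" for r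
  proof -
    have "X k \<le> s" if "X k \<le> t" for k using True that by (auto simp: s_def)
    with that have "{k. X k \<le> r} = {k. X k \<le> t}" by (auto intro: order.trans)
    then show ?thesis by (simp only: cnt_def)
  qed
  ultimately show ?thesis by blast
next
  case False
  have "\<exists>s<t. infinite {k. X k \<le> s}"
  proof (rule ccontr)
    assume "\<not> ?thesis"
    then have fin: "finite {k. X k \<le> s}" if "s < t" for s using that by auto
    have "ereal t \<le> liminf (\<lambda>k. ereal (X k))"
    proof (subst le_Liminf_iff, safe)
      fix y assume "y < ereal t"
      then obtain s where s: "y < ereal s" "s < t" by (meson ereal_dense2 less_ereal.simps(1))
      have "eventually (\<lambda>k. k \<notin> {k. X k \<le> s}) sequentially"
        using fin[OF s(2)] by (simp flip: cofinite_eq_sequentially add: eventually_cofinite)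
      then show "\<forall>\<^sub>F k in sequentially. y < ereal (X k)"
        by eventually_elim (use s in \<open>auto intro: less_trans\<close>)
    qed
    moreover have "liminf (\<lambda>k. ereal (X k)) \<le> ereal t"
    proof (rule ccontr)
      assume "\<not> ?thesis"
      then have "\<forall>\<^sub>F k in sequentially. ereal t < ereal (X k)"
        using less_LiminfD[of "ereal t" sequentially "\<lambda>k. ereal (X k)"] by (simp add: not_le)
      then have "finite {k. \<not> t < X k}" by (simp flip: cofinite_eq_sequentially add: eventually_cofinite)
      with False show False by (simp add: not_less)
    qed
    ultimately have "liminf (\<lambda>k. ereal (X k)) = ereal t" by (rule antisym[rotated])
    with assms(2) show False by simp
  qed
  then obtain s where s: "s < t" "infinite {k. X k \<le> s}" by blast
  have "cnt X r = 0" if "r \<in> {s..t}" for r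
  proof -
    have "{k. X k \<le> s} \<subseteq> {k. X k \<le> r}" using that by auto
    with s(2) have "infinite {k. X k \<le> r}" using finite_subset by blast
    then show ?thesis by (simp add: cnt_def)
  qed
  with s(1) show ?thesis by (intro exI[of _ s]) simp
qed

text \<open>An uncountable infimum is measurable here because a countable set of measurable candidate
  times suffices: a time at which both counts are locally constant to the left can be moved to a
  rational, and the other times are event times or accumulation points of event times.\<close>

fun cand :: "(nat \<Rightarrow> real) \<Rightarrow> (nat \<Rightarrow> real) \<Rightarrow> real \<Rightarrow> rat + nat + nat + nat \<Rightarrow> real" where
  "cand X Y t0 (Inl r) = of_rat r"
| "cand X Y t0 (Inr (Inl k)) = X k"
| "cand X Y t0 (Inr (Inr (Inl k))) = Y k"
| "cand X Y t0 (Inr (Inr (Inr k))) = (if k = 0 then t0 else if k = 1 then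
      real_of_ereal (liminf (\<lambda>k. ereal (X k))) else real_of_ereal (liminf (\<lambda>k. ereal (Y k))))"

text \<open>The candidate found does not exceed \<open>t\<close>, so restricting to candidates
  leaves the infimum unchanged.\<close>

lemma cand_exists:
  assumes "t0 \<le> t" "Q (cnt X t) (cnt Y t)"
  shows "\<exists>i. t0 \<le> cand X Y t0 i \<and> Q (cnt X (cand X Y t0 i)) (cnt Y (cand X Y t0 i)) \<and> cand X Y t0 i \<le> t"
proof (cases "t \<in> range (cand X Y t0)")
  case True
  then obtain i where "t = cand X Y t0 i" by blast
  with assms show ?thesis by (intro exI[of _ i]) simp
next
  case False
  have n: "t \<noteq> cand X Y t0 i" for i using False by blast
  have X: "t \<notin> range X" "t \<noteq> real_of_ereal (liminf (\<lambda>k. ereal (X k)))"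
    using n[of "Inr (Inl _)"] n[of "Inr (Inr (Inr 1))"] by auto
  have Y: "t \<notin> range Y" "t \<noteq> real_of_ereal (liminf (\<lambda>k. ereal (Y k)))"
    using n[of "Inr (Inr (Inl _))"] n[of "Inr (Inr (Inr 2))"] by auto
  have "t0 < t" using assms(1) n[of "Inr (Inr (Inr 0))"] by auto
  obtain s where s: "s < t" "\<forall>r\<in>{s..t}. cnt X r = cnt X t"
    using cnt_locally_constant[OF X] by blast
  obtain s' where s': "s' < t" "\<forall>r\<in>{s'..t}. cnt Y r = cnt Y t"
    using cnt_locally_constant[OF Y] by blast
  obtain r where r: "max t0 (max s s') < of_rat r" "of_rat r < t"
    using of_rat_dense[of "max t0 (max s s')" t] \<open>t0 < t\<close> s(1) s'(1) by auto
  then have "cnt X (of_rat r) = cnt X t" "cnt Y (of_rat r) = cnt Y t"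
    using s(2) s'(2) by (meson atLeastAtMost_iff less_imp_le max_less_iff_conj)+
  with r assms(2) show ?thesis by (intro exI[of _ "Inl r"]) simp
qed

lemma measurable_cand[measurable (raw)]:
  assumes [measurable]: "\<And>k. X k \<in> borel_measurable S" "\<And>k. Y k \<in> borel_measurable S"
    "start \<in> borel_measurable S"
  shows "(\<lambda>\<omega>. cand (\<lambda>k. X k \<omega>) (\<lambda>k. Y k \<omega>) (start \<omega>) i) \<in> borel_measurable S"
proof -
  consider r where "i = Inl r" | k where "i = Inr (Inl k)" | k where "i = Inr (Inr (Inl k))"
    | k where "i = Inr (Inr (Inr k))"
    by (metis sum.exhaust)
  then show ?thesis by cases simp_all
qed

text \<open>\<open>Q\<close> may depend on the sample point because the lag is measured from a fork
  point that is fixed at the random end of the pre-mining.\<close>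

lemma
  fixes start :: "'a \<Rightarrow> real" and Q :: "'a \<Rightarrow> nat \<Rightarrow> nat \<Rightarrow> bool"
  assumes X[measurable]: "\<And>k. X k \<in> borel_measurable S" and Y[measurable]: "\<And>k. Y k \<in> borel_measurable S"
    and start[measurable]: "start \<in> borel_measurable S" and Q[measurable]: "\<And>n m. Measurable.pred S (\<lambda>\<omega>. Q \<omega> n m)"
  defines "D \<equiv> \<lambda>\<omega> t. start \<omega> \<le> t \<and> Q \<omega> (cnt (\<lambda>k. X k \<omega>) t) (cnt (\<lambda>k. Y k \<omega>) t)"
  shows pred_Ex_cnt: "Measurable.pred S (\<lambda>\<omega>. \<exists>t. D \<omega> t)"
    and measurable_Inf_cnt: "(\<lambda>\<omega>. Inf {t. D \<omega> t}) \<in> borel_measurable S"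
proof -
  define c where "c i \<omega> = cand (\<lambda>k. X k \<omega>) (\<lambda>k. Y k \<omega>) (start \<omega>) i" for i \<omega>
  have [measurable]: "c i \<in> borel_measurable S" for i
    unfolding c_def by measurable
  have Q': "Measurable.pred S (\<lambda>\<omega>. Q \<omega> (n \<omega>) (m \<omega>))"
    if [measurable]: "n \<in> S \<rightarrow>\<^sub>M count_space UNIV" "m \<in> S \<rightarrow>\<^sub>M count_space UNIV" for n m
  proof -
    have "(\<lambda>\<omega>. Q \<omega> (n \<omega>) (m \<omega>)) = (\<lambda>\<omega>. \<exists>i j. n \<omega> = i \<and> m \<omega> = j \<and> Q \<omega> i j)" by auto
    then show ?thesis by simp
  qed
  have D[measurable]: "Measurable.pred S (\<lambda>\<omega>. D \<omega> (c i \<omega>))" for i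
    unfolding D_def by (intro pred_intros_logic Q') measurable
  have ex: "\<exists>i. D \<omega> (c i \<omega>) \<and> c i \<omega> \<le> t" if "D \<omega> t" for \<omega> t
    using cand_exists[of "start \<omega>" t "Q \<omega>"] that unfolding D_def c_def by blast
  have Ex: "(\<exists>t. D \<omega> t) \<longleftrightarrow> (\<exists>i. D \<omega> (c i \<omega>))" for \<omega> using ex by blast
  show "Measurable.pred S (\<lambda>\<omega>. \<exists>t. D \<omega> t)"
    unfolding Ex by measurable
  have bdd: "bdd_below {t. D \<omega> t}" for \<omega>
    by (auto simp: bdd_below_def D_def)
  \<comment> \<open>\<open>Inf {}\<close> is one fixed real number, so the case without any stopping
    time contributes a condition independent of the sample point.\<close>
  have *: "Inf {t. D \<omega> t} < a \<longleftrightarrow> (if \<exists>i. D \<omega> (c i \<omega>) then \<exists>i. D \<omega> (c i \<omega>) \<and> c i \<omega> < a else Inf {} < a)" for \<omega> a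
  proof (cases "\<exists>t. D \<omega> t")
    case True
    then have "Inf {t. D \<omega> t} < a \<longleftrightarrow> (\<exists>t. D \<omega> t \<and> t < a)"
      by (subst cInf_less_iff) (auto intro: bdd)
    also have "\<dots> \<longleftrightarrow> (\<exists>i. D \<omega> (c i \<omega>) \<and> c i \<omega> < a)" using ex by (meson le_less_trans)
    finally show ?thesis using True Ex by auto
  next
    case False
    then have "{t. D \<omega> t} = {}" by auto
    with False show ?thesis using Ex[of \<omega>] by simp
  qed
  show "(\<lambda>\<omega>. Inf {t. D \<omega> t}) \<in> borel_measurable S"
    unfolding borel_measurable_iff_less
    by (simp only: *) measurable
qed

section \<open>The race as a functional of the waiting times\<close>

definition psum :: "(nat \<Rightarrow> real) \<Rightarrow> nat \<Rightarrow> real" where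
  "psum x k = (\<Sum>i\<le>k. x i)"

definition good :: "(nat \<Rightarrow> real) \<Rightarrow> bool" where
  "good x \<longleftrightarrow> (\<forall>i. 0 < x i) \<and> (\<forall>t. finite {k. psum x k \<le> t})"

lemma psum_case_nat_Suc: "psum (case_nat u x) (Suc k) = u + psum x k"
  unfolding psum_def sum.atMost_Suc_shift by simp

lemma psum_delay: "psum (delay u x) k = u + psum x k"
  unfolding psum_def by (induction k) (simp_all add: delay_def)

lemma psum_ge_first: "good x \<Longrightarrow> x 0 \<le> psum x k"
  unfolding psum_def good_def by (intro member_le_sum) (auto simp: less_imp_le)

text \<open>\<open>good\<close> supplies finiteness; for infinitely many events both counts would be
  0 and the \<open>Suc\<close> would be wrong.\<close>

lemma cnt_case_nat:
  assumes "good x" "0 \<le> t"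
  shows "cnt (psum (case_nat u x)) (u + t) = Suc (cnt (psum x) t)"
proof -
  have "{k. psum (case_nat u x) k \<le> u + t} = insert 0 (Suc ` {k. psum x k \<le> t})"
    (is "?L = ?R")
  proof (rule set_eqI)
    fix k show "k \<in> ?L \<longleftrightarrow> k \<in> ?R"
      using assms(2) by (cases k) (auto simp: psum_case_nat_Suc, simp add: psum_def)
  qed
  then show ?thesis
    using assms(1) unfolding cnt_def good_def by (simp add: card_image)
qed

lemma cnt_delay: "cnt (psum (delay u x)) (u + t) = cnt (psum x) t"
  by (simp add: cnt_def psum_delay)

lemma cnt_eq_0: "good x \<Longrightarrow> t < x 0 \<Longrightarrow> cnt (psum x) t = 0"
  using psum_ge_first[of x] unfolding cnt_def by (metis (mono_tags, lifting) Collect_empty_eq card.empty less_le_trans not_less)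

lemma cnt_mono: "good x \<Longrightarrow> s \<le> t \<Longrightarrow> cnt (psum x) s \<le> cnt (psum x) t"
  unfolding cnt_def good_def by (intro card_mono) auto

lemma good_case_nat:
  assumes "good x" "0 < u"
  shows "good (case_nat u x)"
proof -
  have "{k. psum (case_nat u x) k \<le> t} \<subseteq> insert 0 (Suc ` {k. psum x k \<le> t - u})" for t
  proof
    fix k assume "k \<in> {k. psum (case_nat u x) k \<le> t}"
    then show "k \<in> insert 0 (Suc ` {k. psum x k \<le> t - u})"
      by (cases k) (auto simp: psum_case_nat_Suc)
  qed
  from finite_subset[OF this] have "finite {k. psum (case_nat u x) k \<le> t}" for t
    using assms(1) by (simp add: good_def)
  with assms show ?thesis
    unfolding good_def by (auto split: nat.split)
qed

lemma good_delay:
  assumes "good x" "0 < u"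
  shows "good (delay u x)"
proof -
  have "{k. psum (delay u x) k \<le> t} = {k. psum x k \<le> t - u}" for t
    by (auto simp: psum_delay)
  with assms show ?thesis
    unfolding good_def by (auto simp: delay_def add_pos_pos)
qed

definition outcome :: "(real \<Rightarrow> bool) \<Rightarrow> (real \<Rightarrow> real) \<Rightarrow> real" where
  "outcome D g = (if \<exists>t. D t then g (Inf {t. D t}) else 0)"

lemma Inf_first_time:
  assumes "\<exists>t. D t" "\<And>t. D t \<Longrightarrow> t0 \<le> t"
  shows "t0 \<le> Inf {t::real. D t}"
  using assms by (intro cInf_greatest) auto

text \<open>Time \<open>u\<close> passes before the shifted process starts, so its first stopping
  time moves by \<open>u\<close>. A process that never stops keeps the default 0 and does not
  collect \<open>c * u\<close>; this case distinction is what later calls for almost sure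
  ending.\<close>

lemma outcome_shift:
  assumes D: "\<And>t. D t \<longleftrightarrow> u \<le> t \<and> D' (t - u)" and D': "\<And>t. D' t \<Longrightarrow> 0 \<le> t"
    and g: "\<And>t. 0 \<le> t \<Longrightarrow> g (u + t) = c * u + g' t"
  shows "outcome D g = (if \<exists>t. D' t then c * u + outcome D' g' else 0)"
proof (cases "\<exists>t. D' t")
  case True
  then obtain t' where t': "D' t'" by blast
  then have ex: "D (u + t')" using D D' by simp
  have "Inf {t. D t} = u + Inf {t. D' t}"
  proof (rule cInf_eq_non_empty)
    show "{t. D t} \<noteq> {}" using ex by blast
    fix x assume "x \<in> {t. D t}"
    then have "D' (x - u)" using D by blast
    then have "Inf {t. D' t} \<le> x - u"
      using D' by (intro cInf_lower) (auto simp: bdd_below_def)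
    then show "u + Inf {t. D' t} \<le> x" by simp
  next
    fix y assume y: "\<And>x. x \<in> {t. D t} \<Longrightarrow> y \<le> x"
    have "y - u \<le> Inf {t. D' t}"
    proof (rule cInf_greatest)
      show "{t. D' t} \<noteq> {}" using t' by blast
      fix x assume "x \<in> {t. D' t}"
      then have "D (u + x)" using D D' by simp
      then show "y - u \<le> x" using y[of "u + x"] by simp
    qed
    then show "y \<le> u + Inf {t. D' t}" by simp
  qed
  moreover have "0 \<le> Inf {t. D' t}" using True D' by (rule Inf_first_time)
  ultimately show ?thesis using True ex g by (auto simp: outcome_def)
next
  case False
  then show ?thesis using D by (auto simp: outcome_def)
qed

text \<open>The lag condition is a sum because \<open>h\<close> and \<open>s\<close> are natural
  numbers. An equality is enough, as the lag changes by one block at a time.\<close>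

definition final :: "nat \<Rightarrow> nat \<Rightarrow> nat \<Rightarrow> nat \<Rightarrow> bool" where
  "final A z h s \<longleftrightarrow> h = s + A \<or> (z \<le> h \<and> h < s)"

text \<open>The race continued from h official and s secret blocks: x and y are the remaining
  interarrival times, c is the reward per unit of time and f the terminal reward.\<close>

definition race_ended :: "nat \<Rightarrow> nat \<Rightarrow> nat \<Rightarrow> nat \<Rightarrow> (nat \<Rightarrow> real) \<times> (nat \<Rightarrow> real) \<Rightarrow> real \<Rightarrow> bool" where
  "race_ended A z h s xy t \<longleftrightarrow> 0 \<le> t \<and> final A z (h + cnt (psum (fst xy)) t) (s + cnt (psum (snd xy)) t)"

definition race :: "nat \<Rightarrow> nat \<Rightarrow> real \<Rightarrow> (nat \<Rightarrow> nat \<Rightarrow> real) \<Rightarrow> nat \<Rightarrow> nat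
    \<Rightarrow> (nat \<Rightarrow> real) \<times> (nat \<Rightarrow> real) \<Rightarrow> real" where
  "race A z c f h s xy = outcome (race_ended A z h s xy)
     (\<lambda>t. c * t + f (h + cnt (psum (fst xy)) t) (s + cnt (psum (snd xy)) t))"

lemma race_nonneg: "0 \<le> c \<Longrightarrow> (\<And>h s. 0 \<le> f h s) \<Longrightarrow> 0 \<le> race A z c f h s xy"
  unfolding race_def outcome_def
  by (auto intro!: add_nonneg_nonneg mult_nonneg_nonneg Inf_first_time simp: race_ended_def)

lemma race_final:
  assumes "final A z h s" "good x" "good y"
  shows "race_ended A z h s (x, y) 0" "race A z c f h s (x, y) = f h s"
proof -
  have 0: "cnt (psum x) 0 = 0" "cnt (psum y) 0 = 0"
    using assms by (auto intro!: cnt_eq_0 simp: good_def)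
  then show e: "race_ended A z h s (x, y) 0" using assms by (simp add: race_ended_def)
  have "Inf {t. race_ended A z h s (x, y) t} = 0"
    using e by (intro cInf_eq_minimum) (auto simp: race_ended_def)
  with e show "race A z c f h s (x, y) = f h s"
    by (auto simp: race_def outcome_def 0)
qed

text \<open>Before \<open>u\<close> both counts are 0 and the state is not final, so no stopping
  occurs; from \<open>u\<close> on, the race is the one started at
  \<open>(Suc h, s)\<close>.\<close>

lemma race_step_honest:
  assumes nf: "\<not> final A z h s" and "good x" "good y" "0 < u"
  shows "race A z c f h s (case_nat u x, delay u y) =
      (if \<exists>t. race_ended A z (Suc h) s (x, y) t then c * u + race A z c f (Suc h) s (x, y) else 0)"
  unfolding race_def
proof (rule outcome_shift)
  fix t
  show "race_ended A z h s (case_nat u x, delay u y) t \<longleftrightarrow> u \<le> t \<and> race_ended A z (Suc h) s (x, y) (t - u)"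
  proof (cases "u \<le> t")
    case True
    then show ?thesis
      using cnt_case_nat[OF assms(2), of "t - u" u] cnt_delay[of u y "t - u"] assms
      by (simp add: race_ended_def)
  next
    case False
    then have "cnt (psum (case_nat u x)) t = 0" "cnt (psum (delay u y)) t = 0"
      using assms good_case_nat[of x u] good_delay[of y u]
      by (auto intro!: cnt_eq_0 simp: delay_def) (smt (verit) good_def)
    with False nf show ?thesis by (simp add: race_ended_def)
  qed
next
  show "0 \<le> t" if "race_ended A z (Suc h) s (x, y) t" for t using that by (simp add: race_ended_def)
qed (use assms in \<open>simp add: cnt_case_nat cnt_delay distrib_left\<close>)

lemma race_step_attacker:
  assumes nf: "\<not> final A z h s" and "good x" "good y" "0 < u"
  shows "race A z c f h s (delay u x, case_nat u y) =
      (if \<exists>t. race_ended A z h (Suc s) (x, y) t then c * u + race A z c f h (Suc s) (x, y) else 0)"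
  unfolding race_def
proof (rule outcome_shift)
  fix t
  show "race_ended A z h s (delay u x, case_nat u y) t \<longleftrightarrow> u \<le> t \<and> race_ended A z h (Suc s) (x, y) (t - u)"
  proof (cases "u \<le> t")
    case True
    then show ?thesis
      using cnt_case_nat[OF assms(3), of "t - u" u] cnt_delay[of u x "t - u"] assms
      by (simp add: race_ended_def)
  next
    case False
    then have "cnt (psum (case_nat u y)) t = 0" "cnt (psum (delay u x)) t = 0"
      using assms good_case_nat[of y u] good_delay[of x u]
      by (auto intro!: cnt_eq_0 simp: delay_def) (smt (verit) good_def)
    with False nf show ?thesis by (simp add: race_ended_def)
  qed
next
  show "0 \<le> t" if "race_ended A z h (Suc s) (x, y) t" for t using that by (simp add: race_ended_def)
qed (use assms in \<open>simp add: cnt_case_nat cnt_delay distrib_left\<close>)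

section \<open>The pre-mining phase\<close>

definition attack_value :: "nat \<Rightarrow> nat \<Rightarrow> real \<Rightarrow> (nat \<Rightarrow> nat \<Rightarrow> real) \<Rightarrow> (nat \<Rightarrow> real \<times> real) \<Rightarrow> real" where
  "attack_value A z c f \<omega> = outcome (attack_ended A z \<omega>)
     (\<lambda>t. c * t + f (nat (off_len \<omega> t)) (nat (sec_len \<omega> t)))"

definition zip_seq :: "(nat \<Rightarrow> 'a) \<times> (nat \<Rightarrow> 'b) \<Rightarrow> nat \<Rightarrow> 'a \<times> 'b" where
  "zip_seq xy i = (fst xy i, snd xy i)"

lemma Nh_cnt: "Nh \<omega> = cnt (psum (fst \<circ> \<omega>))" and Na_cnt: "Na \<omega> = cnt (psum (snd \<circ> \<omega>))"
  by (auto simp: Nh_def Na_def cnt_def psum_def hon_time_def att_time_def)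

lemma Nh_zip: "Nh (zip_seq (x, y)) = cnt (psum x)" and Na_zip: "Na (zip_seq (x, y)) = cnt (psum y)"
  and premine_zip: "premine_end (zip_seq (x, y)) = y 0"
  by (simp_all add: Nh_cnt Na_cnt comp_def premine_end_def att_time_def zip_seq_def)

text \<open>An honest block during the pre-mining is counted both at \<open>t\<close> and at
  \<open>premine_end\<close>, so it cancels in \<open>off_len\<close> and the cycle starts
  afresh.\<close>

lemma attack_value_step_honest:
  assumes "good x" "good y" "0 < u"
  shows "attack_value A z c f (zip_seq (case_nat u x, delay u y)) =
      (if \<exists>t. attack_ended A z (zip_seq (x, y)) t then c * u + attack_value A z c f (zip_seq (x, y)) else 0)"
proof -
  let ?w = "zip_seq (case_nat u x, delay u y)" and ?w' = "zip_seq (x, y)"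
  have y0: "0 < y 0" using assms by (simp add: good_def)
  have len: "off_len ?w (u + t) = off_len ?w' t" "sec_len ?w (u + t) = sec_len ?w' t" if "0 \<le> t" for t
    using that assms y0
    by (simp_all add: off_len_def sec_len_def Nh_zip Na_zip premine_zip cnt_delay cnt_case_nat
        delay_def[of u y, THEN fun_cong, of 0])
  have e0: "premine_end ?w' \<le> t" if "attack_ended A z ?w' t" for t
    using that by (simp add: attack_ended_def)
  then have e0: "0 \<le> t" if "attack_ended A z ?w' t" for t
    using that y0 premine_zip[of x y] by fastforce
  have "attack_ended A z ?w t \<longleftrightarrow> u \<le> t \<and> attack_ended A z ?w' (t - u)" for t
  proof (cases "u \<le> t")
    case True
    then show ?thesis using len[of "t - u"]
      by (auto simp add: attack_ended_def premine_zip delay_def[of u y, THEN fun_cong, of 0])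
  next
    case False
    then show ?thesis using y0
      by (auto simp add: attack_ended_def premine_zip delay_def[of u y, THEN fun_cong, of 0])
  qed
  then show ?thesis
    unfolding attack_value_def by (rule outcome_shift) (use e0 len in \<open>auto simp: algebra_simps\<close>)
qed

text \<open>The first attacker block ends the pre-mining and leaves a race with no official block
  and one secret block.\<close>

lemma attack_value_step_attacker:
  assumes "good x" "good y" "0 < u"
  shows "attack_value A z c f (zip_seq (delay u x, case_nat u y)) =
      (if \<exists>t. race_ended A z 0 1 (x, y) t then c * u + race A z c f 0 1 (x, y) else 0)"
proof -
  let ?w = "zip_seq (delay u x, case_nat u y)"
  have 0: "cnt (psum x) 0 = 0" "cnt (psum y) 0 = 0"
    using assms by (auto intro!: cnt_eq_0 simp: good_def)
  have pre: "premine_end ?w = u" by (simp add: premine_zip)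
  have len: "off_len ?w (u + t) = int (cnt (psum x) t)" "sec_len ?w (u + t) = int (1 + cnt (psum y) t)" if "0 \<le> t" for t
    using that assms cnt_delay[of u x 0] cnt_case_nat[of y 0 u] 0
    by (simp_all add: off_len_def sec_len_def Nh_zip Na_zip pre cnt_delay cnt_case_nat)
  have "attack_ended A z ?w t \<longleftrightarrow> u \<le> t \<and> race_ended A z 0 1 (x, y) (t - u)" for t
    using len[of "t - u"]
    by (auto simp add: attack_ended_def pre race_ended_def final_def)
  then show ?thesis
    unfolding attack_value_def race_def
    by (rule outcome_shift) (use len in \<open>auto simp: algebra_simps nat_add_distrib race_ended_def\<close>)
qed

section \<open>One-step analysis and the maximum principle\<close>

lemma measurable_psum[measurable (raw)]:
  assumes [measurable]: "\<And>i. (\<lambda>\<omega>. X \<omega> i) \<in> borel_measurable S"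
  shows "(\<lambda>\<omega>. psum (X \<omega>) k) \<in> borel_measurable S"
  unfolding psum_def by measurable

lemma measurable_compose_nat2:
  fixes f :: "nat \<Rightarrow> nat \<Rightarrow> 'b"
  assumes m: "m \<in> S \<rightarrow>\<^sub>M count_space UNIV" and n: "n \<in> S \<rightarrow>\<^sub>M count_space UNIV"
    and "\<And>i j. f i j \<in> space R"
  shows "(\<lambda>\<omega>. f (m \<omega>) (n \<omega>)) \<in> S \<rightarrow>\<^sub>M R"
  by (rule measurable_compose_countable[OF _ m], rule measurable_compose_countable[OF _ n])
    (use assms in simp)

lemma measurable_fst_seq[measurable]: "(\<lambda>\<omega>. fst \<omega> i) \<in> borel_measurable (exp_seq2 a b)"
  and measurable_snd_seq[measurable]: "(\<lambda>\<omega>. snd \<omega> i) \<in> borel_measurable (exp_seq2 a b)"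
proof -
  have *: "(\<lambda>x. x i) \<in> borel_measurable (exp_seq r)" for r
    using measurable_component_singleton[of i UNIV "\<lambda>_. exp_measure r"] by simp
  show "(\<lambda>\<omega>. fst \<omega> i) \<in> borel_measurable (exp_seq2 a b)"
    by (rule measurable_compose[OF measurable_fst *])
  show "(\<lambda>\<omega>. snd \<omega> i) \<in> borel_measurable (exp_seq2 a b)"
    by (rule measurable_compose[OF measurable_snd *])
qed

lemma pred_race_ended: "Measurable.pred (exp_seq2 a b) (\<lambda>xy. \<exists>t. race_ended A z h s xy t)"
  and measurable_race: "race A z c f h s \<in> borel_measurable (exp_seq2 a b)"
proof -
  show [measurable]: "Measurable.pred (exp_seq2 a b) (\<lambda>xy. \<exists>t. race_ended A z h s xy t)"
    unfolding race_ended_def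
    by (rule pred_Ex_cnt[where start="\<lambda>_. 0" and X="\<lambda>k xy. psum (fst xy) k" and Y="\<lambda>k xy. psum (snd xy) k"
          and Q="\<lambda>_ n m. final A z (h + n) (s + m)"]) measurable
  have [measurable]: "(\<lambda>xy. Inf {t. race_ended A z h s xy t}) \<in> borel_measurable (exp_seq2 a b)"
    unfolding race_ended_def
    by (rule measurable_Inf_cnt[where start="\<lambda>_. 0" and X="\<lambda>k xy. psum (fst xy) k" and Y="\<lambda>k xy. psum (snd xy) k"
          and Q="\<lambda>_ n m. final A z (h + n) (s + m)"]) measurable
  have [measurable]: "(\<lambda>xy. f (h + cnt (psum (fst xy)) (Inf {t. race_ended A z h s xy t}))
      (s + cnt (psum (snd xy)) (Inf {t. race_ended A z h s xy t}))) \<in> borel_measurable (exp_seq2 a b)"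
    by (rule measurable_compose_nat2[where f=f]) measurable
  show "race A z c f h s \<in> borel_measurable (exp_seq2 a b)"
    unfolding race_def[abs_def] outcome_def by measurable
qed

lemma
  fixes M assumes [measurable]: "\<And>i. (\<lambda>\<omega>. fst (\<omega> i)) \<in> borel_measurable M" "\<And>i. (\<lambda>\<omega>. snd (\<omega> i)) \<in> borel_measurable M"
  shows pred_attack_ended: "Measurable.pred M (\<lambda>\<omega>. \<exists>t. attack_ended A z \<omega> t)"
    and measurable_end_time: "end_time A z \<in> borel_measurable M"
    and measurable_off_len: "(\<lambda>\<omega>. off_len \<omega> (end_time A z \<omega>)) \<in> M \<rightarrow>\<^sub>M count_space UNIV"
    and measurable_sec_len: "(\<lambda>\<omega>. sec_len \<omega> (end_time A z \<omega>)) \<in> M \<rightarrow>\<^sub>M count_space UNIV"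
    and measurable_attack_value: "attack_value A z c f \<in> borel_measurable M"
proof -
  define X where "X k \<omega> = psum (fst \<circ> \<omega>) k" for k and \<omega> :: "nat \<Rightarrow> real \<times> real"
  define Y where "Y k \<omega> = psum (snd \<circ> \<omega>) k" for k and \<omega> :: "nat \<Rightarrow> real \<times> real"
  have [measurable]: "X k \<in> borel_measurable M" "Y k \<in> borel_measurable M" for k
    unfolding X_def Y_def by (simp_all add: measurable_psum comp_def)
  have [measurable]: "premine_end \<in> borel_measurable M"
    unfolding premine_end_def att_time_def by simp
  have cnt: "Nh \<omega> = cnt (\<lambda>k. X k \<omega>)" "Na \<omega> = cnt (\<lambda>k. Y k \<omega>)" for \<omega>
    by (auto simp: Nh_cnt Na_cnt X_def Y_def)
  \<comment> \<open>The counts at the end of the pre-mining go into the sample-dependent stopping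
    condition, so that only the counts at \<open>t\<close> remain as arguments.\<close>
  define Q where "Q \<omega> n m \<longleftrightarrow> (int n - int (Nh \<omega> (premine_end \<omega>)) - (1 + int m - int (Na \<omega> (premine_end \<omega>))) = int A
      \<or> (int z \<le> int n - int (Nh \<omega> (premine_end \<omega>)) \<and>
         int n - int (Nh \<omega> (premine_end \<omega>)) < 1 + int m - int (Na \<omega> (premine_end \<omega>))))" for \<omega> n m
  have Q: "Measurable.pred M (\<lambda>\<omega>. Q \<omega> n m)" for n m
    unfolding Q_def cnt by (rule measurable_compose_nat2[where f="\<lambda>a b. int n - int a - (1 + int m - int b) = int A
      \<or> (int z \<le> int n - int a \<and> int n - int a < 1 + int m - int b)"]) measurable
  have att: "attack_ended A z \<omega> = (\<lambda>t. premine_end \<omega> \<le> t \<and> Q \<omega> (cnt (\<lambda>k. X k \<omega>) t) (cnt (\<lambda>k. Y k \<omega>) t))" for \<omega>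
    by (auto simp: fun_eq_iff attack_ended_def Q_def off_len_def sec_len_def cnt)
  show [measurable]: "Measurable.pred M (\<lambda>\<omega>. \<exists>t. attack_ended A z \<omega> t)"
    unfolding att by (rule pred_Ex_cnt) (use Q in measurable)
  have "(\<lambda>\<omega>. Inf {t. attack_ended A z \<omega> t}) \<in> borel_measurable M"
    unfolding att by (rule measurable_Inf_cnt) (use Q in measurable)
  then show [measurable]: "end_time A z \<in> borel_measurable M"
    by (simp add: end_time_def[abs_def])
  show [measurable]: "(\<lambda>\<omega>. off_len \<omega> (end_time A z \<omega>)) \<in> M \<rightarrow>\<^sub>M count_space UNIV"
    unfolding off_len_def cnt by (rule measurable_compose_nat2[where f="\<lambda>a b. int a - int b"]) measurable
  show [measurable]: "(\<lambda>\<omega>. sec_len \<omega> (end_time A z \<omega>)) \<in> M \<rightarrow>\<^sub>M count_space UNIV"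
    unfolding sec_len_def cnt by (rule measurable_compose_nat2[where f="\<lambda>a b. 1 + int a - int b"]) measurable
  have [measurable]: "(\<lambda>\<omega>. f (nat (off_len \<omega> (end_time A z \<omega>))) (nat (sec_len \<omega> (end_time A z \<omega>)))) \<in> borel_measurable M"
    by (rule measurable_compose_nat2[where f=f]) measurable
  show "attack_value A z c f \<in> borel_measurable M"
    unfolding attack_value_def[abs_def] outcome_def end_time_def[symmetric] by measurable
qed

lemma nn_integral_exp_measure_ident:
  assumes "0 < r" "0 \<le> c"
  shows "(\<integral>\<^sup>+u. ennreal (c * u) \<partial>exp_measure r) = ennreal (c / r)"
proof -
  have "(\<integral>\<^sup>+u. ennreal (c * u) \<partial>exp_measure r) = (\<integral>\<^sup>+u. ennreal c * ennreal (exponential_density r u * u ^ 1) \<partial>lborel)"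
    using assms by (subst nn_integral_density)
      (auto intro!: nn_integral_cong simp: exponential_density_def ennreal_mult[symmetric] mult_ac split: if_split)
  also have "\<dots> = ennreal c * ennreal (fact (0 + 1) / (fact 0 * r ^ 1))"
    using nn_integral_erlang_ith_moment[OF assms(1), of 0 1] by (subst nn_integral_cmult) auto
  finally show ?thesis using assms by (simp add: ennreal_mult[symmetric])
qed

lemma AE_exp_measure_pos: "0 < r \<Longrightarrow> AE u in exp_measure r. 0 < u"
  using AE_lborel_singleton[of "0::real"]
  by (subst AE_density) (auto simp: exponential_density_def elim!: eventually_mono)

locale mining =
  fixes q p tau0 :: real and A z :: nat
  assumes q: "0 < q" "q < 1/2" and p: "p = 1 - q" and tau0: "0 < tau0" and z: "1 \<le> z" and A: "z \<le> A"
begin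

lemma p_pos: "0 < p" and p_gt: "1/2 < p" and pq: "p + q = 1" using q p by auto

abbreviation "N \<equiv> exp_seq2 (p / tau0) (q / tau0)"

lemma rates: "0 < p / tau0" "0 < q / tau0" "p / tau0 + q / tau0 = 1 / tau0"
  "p / tau0 / (1 / tau0) = p" "q / tau0 / (1 / tau0) = q"
  using q p tau0 by (auto simp: add_divide_distrib[symmetric])

lemma rate_total: "0 < 1 / tau0"
  using tau0 by simp

sublocale N: prob_space N
proof -
  interpret a: prob_space "exp_seq (p / tau0)" by (rule prob_space_exp_seq) (rule rates)
  interpret b: prob_space "exp_seq (q / tau0)" by (rule prob_space_exp_seq) (rule rates)
  interpret pair_prob_space "exp_seq (p / tau0)" "exp_seq (q / tau0)" ..
  show "prob_space N" by unfold_locales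
qed

lemma AE_good: "AE xy in N. good (fst xy) \<and> good (snd xy)"
proof -
  interpret a: prob_space "exp_seq (p / tau0)" by (rule prob_space_exp_seq) (rule rates)
  interpret b: prob_space "exp_seq (q / tau0)" by (rule prob_space_exp_seq) (rule rates)
  interpret pair_prob_space "exp_seq (p / tau0)" "exp_seq (q / tau0)" ..
  have "AE xy in N. good (fst xy)"
    using AE_exp_seq_good[OF rates(1)]
    by (intro AE_distrD[OF measurable_fst[of _ "exp_seq (q / tau0)"]], subst b.distr_pair_fst)
      (simp_all add: good_def psum_def)
  moreover have "AE xy in N. good (snd xy)"
  proof -
    have "AE y in exp_seq (q / tau0). good y"
      using AE_exp_seq_good[OF rates(2)] by (simp add: good_def psum_def)
    then obtain S where S: "{y \<in> space (exp_seq (q / tau0)). \<not> good y} \<subseteq> S" "S \<in> null_sets (exp_seq (q / tau0))"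
      by (auto elim!: AE_E simp: null_sets_def)
    have "space (exp_seq (p / tau0)) \<times> S \<in> null_sets N"
      by (rule b.times_in_null_sets2[OF _ S(2)]) simp
    then show ?thesis
      by (rule AE_I') (use S(1) in \<open>auto simp: space_pair_measure\<close>)
  qed
  ultimately show ?thesis by simp
qed

lemma nn_integral_block_rewards:
  assumes [measurable]: "F1 \<in> borel_measurable N" "F2 \<in> borel_measurable N" and c: "0 \<le> c"
  shows "(\<integral>\<^sup>+u. \<integral>\<^sup>+xy. ennreal p * (ennreal (c * u) + F1 xy) + ennreal q * (ennreal (c * u) + F2 xy) \<partial>N \<partial>exp_measure (1 / tau0))
     = ennreal (c * tau0) + ennreal p * (\<integral>\<^sup>+xy. F1 xy \<partial>N) + ennreal q * (\<integral>\<^sup>+xy. F2 xy \<partial>N)"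
proof -
  have pq': "ennreal p + ennreal q = 1"
    using p_pos q pq by (simp flip: ennreal_plus)
  interpret E: prob_space "exp_measure (1 / tau0)" by (rule prob_space_exponential_density) (use tau0 in simp)
  have "(\<integral>\<^sup>+xy. ennreal p * (ennreal (c * u) + F1 xy) + ennreal q * (ennreal (c * u) + F2 xy) \<partial>N)
     = ennreal (c * u) + (ennreal p * (\<integral>\<^sup>+xy. F1 xy \<partial>N) + ennreal q * (\<integral>\<^sup>+xy. F2 xy \<partial>N))" for u
  proof -
    have "(\<integral>\<^sup>+xy. ennreal p * (ennreal (c * u) + F1 xy) + ennreal q * (ennreal (c * u) + F2 xy) \<partial>N)
       = ennreal p * (ennreal (c * u) + (\<integral>\<^sup>+xy. F1 xy \<partial>N)) + ennreal q * (ennreal (c * u) + (\<integral>\<^sup>+xy. F2 xy \<partial>N))"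
      by (simp add: nn_integral_add nn_integral_cmult N.emeasure_space_1)
    also have "\<dots> = (ennreal p + ennreal q) * ennreal (c * u) + (ennreal p * (\<integral>\<^sup>+xy. F1 xy \<partial>N) + ennreal q * (\<integral>\<^sup>+xy. F2 xy \<partial>N))"
      by (simp only: distrib_left distrib_right add_ac)
    finally show ?thesis by (simp add: pq')
  qed
  then show ?thesis
    using nn_integral_exp_measure_ident[of "1 / tau0" c] tau0 c
    by (simp add: nn_integral_add E.emeasure_space_1 add.assoc del: space_density)
qed

text \<open>The form for truncated payoffs, which satisfy the one-step relation only as an
  inequality.\<close>

lemma nn_integral_step_le:
  assumes [measurable]: "F \<in> borel_measurable N" "F1 \<in> borel_measurable N" "F2 \<in> borel_measurable N" and c: "0 \<le> c"
    and le: "AE xy in N. \<forall>u>0. F (case_nat u (fst xy), delay u (snd xy)) \<le> ennreal (c * u) + F1 xy \<and>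
      F (delay u (fst xy), case_nat u (snd xy)) \<le> ennreal (c * u) + F2 xy"
  shows "(\<integral>\<^sup>+xy. F xy \<partial>N) \<le> ennreal (c * tau0) + ennreal p * (\<integral>\<^sup>+xy. F1 xy \<partial>N) + ennreal q * (\<integral>\<^sup>+xy. F2 xy \<partial>N)"
proof -
  have "(\<integral>\<^sup>+xy. F xy \<partial>N) = (\<integral>\<^sup>+u. \<integral>\<^sup>+(x, y). ennreal p * F (case_nat u x, delay u y)
        + ennreal q * F (delay u x, case_nat u y) \<partial>N \<partial>exp_measure (1 / tau0))"
    using nn_integral_first_block[OF rates(1,2) assms(1)] unfolding rates .
  also have "\<dots> \<le> (\<integral>\<^sup>+u. \<integral>\<^sup>+xy. ennreal p * (ennreal (c * u) + F1 xy) + ennreal q * (ennreal (c * u) + F2 xy) \<partial>N \<partial>exp_measure (1 / tau0))"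
  proof (rule nn_integral_mono_AE)
    show "AE u in exp_measure (1 / tau0). (\<integral>\<^sup>+(x, y). ennreal p * F (case_nat u x, delay u y)
        + ennreal q * F (delay u x, case_nat u y) \<partial>N) \<le>
       (\<integral>\<^sup>+xy. ennreal p * (ennreal (c * u) + F1 xy) + ennreal q * (ennreal (c * u) + F2 xy) \<partial>N)"
      using AE_exp_measure_pos[OF rate_total]
    proof eventually_elim
      case (elim u)
      show ?case using le
        by (intro nn_integral_mono_AE, eventually_elim)
          (auto simp: case_prod_beta' elim intro!: add_mono mult_left_mono)
    qed
  qed
  also note nn_integral_block_rewards[OF assms(2,3) c]
  finally show ?thesis .
qed

lemma nn_integral_step:
  assumes [measurable]: "F \<in> borel_measurable N" "F1 \<in> borel_measurable N" "F2 \<in> borel_measurable N" and c: "0 \<le> c"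
    and eq: "AE xy in N. \<forall>u>0. F (case_nat u (fst xy), delay u (snd xy)) = ennreal (c * u) + F1 xy \<and>
      F (delay u (fst xy), case_nat u (snd xy)) = ennreal (c * u) + F2 xy"
  shows "(\<integral>\<^sup>+xy. F xy \<partial>N) = ennreal (c * tau0) + ennreal p * (\<integral>\<^sup>+xy. F1 xy \<partial>N) + ennreal q * (\<integral>\<^sup>+xy. F2 xy \<partial>N)"
proof -
  have "(\<integral>\<^sup>+xy. F xy \<partial>N) = (\<integral>\<^sup>+u. \<integral>\<^sup>+(x, y). ennreal p * F (case_nat u x, delay u y)
        + ennreal q * F (delay u x, case_nat u y) \<partial>N \<partial>exp_measure (1 / tau0))"
    using nn_integral_first_block[OF rates(1,2) assms(1)] unfolding rates .
  also have "\<dots> = (\<integral>\<^sup>+u. \<integral>\<^sup>+xy. ennreal p * (ennreal (c * u) + F1 xy) + ennreal q * (ennreal (c * u) + F2 xy) \<partial>N \<partial>exp_measure (1 / tau0))"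
  proof (rule nn_integral_cong_AE)
    show "AE u in exp_measure (1 / tau0). (\<integral>\<^sup>+(x, y). ennreal p * F (case_nat u x, delay u y)
        + ennreal q * F (delay u x, case_nat u y) \<partial>N) =
       (\<integral>\<^sup>+xy. ennreal p * (ennreal (c * u) + F1 xy) + ennreal q * (ennreal (c * u) + F2 xy) \<partial>N)"
      using AE_exp_measure_pos[OF rate_total]
    proof eventually_elim
      case (elim u)
      show ?case using eq
        by (intro nn_integral_cong_AE, eventually_elim) (auto simp: case_prod_beta' elim)
    qed
  qed
  also note nn_integral_block_rewards[OF assms(2,3) c]
  finally show ?thesis .
qed

text \<open>The geometric weight \<open>al ^ h * be ^ s\<close> is a strict supersolution of the one-step equation and
  still dominates linear growth in s along the whole strip, which gives uniqueness.\<close>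

lemma max_principle:
  fixes D :: "nat \<Rightarrow> nat \<Rightarrow> real"
  assumes B: "\<And>h s. h \<le> s + A \<Longrightarrow> D h s \<le> B * (1 + real s)" and "0 \<le> B"
    and fin: "\<And>h s. h \<le> s + A \<Longrightarrow> final A z h s \<Longrightarrow> D h s \<le> 0"
    and step: "\<And>h s. h \<le> s + A \<Longrightarrow> \<not> final A z h s \<Longrightarrow> D h s \<le> p * D (Suc h) s + q * D h (Suc s)"
    and "h \<le> s + A"
  shows "D h s \<le> 0"
proof -
  \<comment> \<open>With \<open>al = 1 - r * e\<close> and \<open>be = 1 + e\<close>, contraction
    \<open>th < 1\<close> asks for \<open>r > q / p\<close>, and growth \<open>al * be > 1\<close>
    for small \<open>e\<close> asks for \<open>r < 1\<close>. The choice \<open>r = 2 * q\<close>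
    meets both because \<open>p > 1/2\<close>, and \<open>e = (1 - 2 * q) / 2\<close> is small
    enough.\<close>
  define e where "e = (1 - 2 * q) / 2"
  define al where "al = 1 - 2 * q * e"
  define be where "be = 1 + e"
  define th where "th = p * al + q * be"
  define eta where "eta = al * be - 1"
  have e: "0 < e" "e < 1/2" using q by (auto simp: e_def)
  have "2 * q * e < 1 * (1/2)" using q e by (intro mult_strict_mono) auto
  moreover have "0 < 2 * q * e" using q e by simp
  ultimately have al: "0 < al" "al \<le> 1" unfolding al_def by linarith+
  have be: "0 < be" using e by (simp add: be_def)
  have "th = 1 - e * q * (2 * p - 1)"
    unfolding th_def al_def be_def p by (simp add: algebra_simps)
  moreover have "0 < e * q * (2 * p - 1)" using e q p_gt by simp
  ultimately have th1: "th < 1" by simp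
  have th0: "0 < th" using al be p_pos q by (simp add: th_def add_pos_pos)
  have "eta = e * ((1 - 2 * q) * (1 - q))"
    unfolding eta_def al_def be_def e_def by (simp add: field_simps)
  then have eta: "0 < eta" using e q by simp
  define k where "k = al ^ A * min 1 eta"
  have k: "0 < k" using al eta by (simp add: k_def)
  \<comment> \<open>On the strip \<open>al ^ h\<close> is at least \<open>al ^ (s + A)\<close>;
    Bernoulli's inequality for \<open>(1 + eta) ^ s\<close> then gives linear growth in
    \<open>s\<close>.\<close>
  have G: "k * (1 + real s) \<le> al ^ h * be ^ s" if "h \<le> s + A" for h s
  proof -
    have "min 1 eta * (1 + real s) \<le> 1 + real s * eta"
      using mult_right_mono[of "min 1 eta" eta "real s"] by (simp add: algebra_simps min_le_iff_disj)
    also have "\<dots> \<le> (1 + eta) ^ s" using eta by (intro Bernoulli_inequality) auto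
    also have "\<dots> = al ^ s * be ^ s" by (simp add: eta_def power_mult_distrib)
    finally have "al ^ A * (min 1 eta * (1 + real s)) \<le> al ^ A * (al ^ s * be ^ s)"
      using al by (intro mult_left_mono) auto
    also have "\<dots> = al ^ (s + A) * be ^ s" by (simp add: power_add)
    also have "\<dots> \<le> al ^ h * be ^ s"
      using al be that by (intro mult_right_mono power_decreasing) auto
    finally show ?thesis by (simp add: k_def mult.assoc)
  qed
  \<comment> \<open>Every use of the one-step inequality gains a factor \<open>th\<close>, so the
    bound tends to 0 with \<open>n\<close>. The strip is not left, because \<open>h = s + A\<close>
    is final.\<close>
  have main: "D h s \<le> B / k * th ^ n * (al ^ h * be ^ s)" if "h \<le> s + A" for n h s
    using that
  proof (induction n arbitrary: h s)
    case 0
    have "D h s \<le> B / k * (k * (1 + real s))" using B[OF 0] k by simp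
    also have "\<dots> \<le> B / k * (al ^ h * be ^ s)"
      using G[OF 0] k \<open>0 \<le> B\<close> by (intro mult_left_mono) auto
    finally show ?case by simp
  next
    case (Suc n)
    have "0 \<le> B / k * th ^ Suc n * (al ^ h * be ^ s)"
      using \<open>0 \<le> B\<close> k th0 al be by simp
    moreover have ?case if nf: "\<not> final A z h s"
    proof -
      have "Suc h \<le> s + A" "h \<le> Suc s + A" using nf Suc.prems by (auto simp: final_def)
      note IH = Suc.IH[OF this(1)] Suc.IH[OF this(2)]
      have "D h s \<le> p * D (Suc h) s + q * D h (Suc s)" by (rule step) fact+
      also have "\<dots> \<le> p * (B / k * th ^ n * (al ^ Suc h * be ^ s)) + q * (B / k * th ^ n * (al ^ h * be ^ Suc s))"
        using IH p_pos q by (intro add_mono mult_left_mono) auto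
      also have "\<dots> = B / k * th ^ Suc n * (al ^ h * be ^ s)"
        by (simp add: th_def algebra_simps)
      finally show ?thesis .
    qed
    ultimately show ?case using fin[OF Suc.prems] by (cases "final A z h s") auto
  qed
  have "(\<lambda>n. B / k * th ^ n * (al ^ h * be ^ s)) \<longlonglongrightarrow> B / k * 0 * (al ^ h * be ^ s)"
    using th0 th1 by (intro tendsto_intros LIMSEQ_power_zero) auto
  then have "D h s \<le> B / k * 0 * (al ^ h * be ^ s)"
    using main[OF \<open>h \<le> s + A\<close>] by (intro LIMSEQ_le_const) auto
  then show ?thesis by simp
qed

end

section \<open>Expected values as unique solutions of the one-step equation\<close>

lemma race_not_ended: "\<not> (\<exists>t. race_ended A z h s xy t) \<Longrightarrow> race A z c f h s xy = 0"
  by (simp add: race_def outcome_def)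

lemma attack_value_not_ended: "\<not> (\<exists>t. attack_ended A z \<omega> t) \<Longrightarrow> attack_value A z c f \<omega> = 0"
  by (simp add: attack_value_def outcome_def)

lemma premine_le_end_time:
  assumes "\<exists>t. attack_ended A z \<omega> t"
  shows "premine_end \<omega> \<le> end_time A z \<omega>"
  unfolding end_time_def using assms by (rule Inf_first_time) (simp add: attack_ended_def)

lemma attack_value_nonneg:
  assumes "good y" "0 \<le> c" "\<And>h s. 0 \<le> f h s"
  shows "0 \<le> attack_value A z c f (zip_seq (x, y))"
proof (cases "\<exists>t. attack_ended A z (zip_seq (x, y)) t")
  case True
  have "0 < y 0" using assms(1) by (simp add: good_def)
  then have "0 \<le> end_time A z (zip_seq (x, y))"
    using premine_le_end_time[OF True] unfolding premine_zip by linarith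
  then show ?thesis using assms True
    unfolding attack_value_def outcome_def end_time_def[symmetric] by simp
next
  case False
  then show ?thesis by (simp add: attack_value_not_ended)
qed

lemma ennreal_min_le_add:
  assumes "0 \<le> a" "0 \<le> r'" "0 \<le> K" "r \<le> a + r'"
  shows "ennreal (min r K) \<le> ennreal a + ennreal (min r' K)"
proof -
  have "min r K \<le> a + min r' K" using assms by auto
  then have "ennreal (min r K) \<le> ennreal (a + min r' K)" by (rule ennreal_leI)
  also have "\<dots> = ennreal a + ennreal (min r' K)" using assms by (intro ennreal_plus) auto
  finally show ?thesis .
qed

lemma ennreal_enn2real_le: "x \<le> ennreal r \<Longrightarrow> x = ennreal (enn2real x)"
  using ennreal_enn2real[of x] le_less_trans[OF _ ennreal_less_top] by simp

context mining
begin

lemma ennreal_affine: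
  assumes "0 \<le> c" "0 \<le> a" "0 \<le> b"
  shows "ennreal (c * tau0) + ennreal p * ennreal a + ennreal q * ennreal b = ennreal (c * tau0 + p * a + q * b)"
    and affine_nonneg: "0 \<le> c * tau0 + p * a + q * b"
  using assms p_pos q tau0 by (simp_all add: ennreal_mult[symmetric] ennreal_plus[symmetric] del: ennreal_plus)

lemma measurable_race_N[measurable]: "race A z c f h s \<in> borel_measurable N"
  by (rule measurable_race)

lemma zip_seq_measurable[measurable]: "zip_seq \<in> N \<rightarrow>\<^sub>M mining_space q tau0"
  and distr_zip_seq: "distr N (mining_space q tau0) zip_seq = mining_space q tau0"
proof -
  have M: "mining_space q tau0 = (\<Pi>\<^sub>M i\<in>UNIV. exp_measure (p / tau0) \<Otimes>\<^sub>M exp_measure (q / tau0))"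
    by (simp add: mining_space_def p)
  show "zip_seq \<in> N \<rightarrow>\<^sub>M mining_space q tau0"
    unfolding M
  proof (rule measurable_PiM_single')
    show "(\<lambda>xy. zip_seq xy i) \<in> N \<rightarrow>\<^sub>M exp_measure (p / tau0) \<Otimes>\<^sub>M exp_measure (q / tau0)" for i
      unfolding zip_seq_def by measurable
  qed (auto simp: space_pair_measure)
  have "zip_seq = (\<lambda>(x, y) i. (x i, y i) :: real \<times> real)"
    by (auto simp: fun_eq_iff zip_seq_def)
  then show "distr N (mining_space q tau0) zip_seq = mining_space q tau0"
    unfolding M using distr_zip_PiM[of "exp_measure (p / tau0)" "exp_measure (q / tau0)"] rates
    by (simp add: prob_space_exponential_density)
qed

lemma
  shows measurable_fst_mining[measurable]: "(\<lambda>\<omega>. fst (\<omega> i)) \<in> borel_measurable (mining_space q tau0)"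
    and measurable_snd_mining[measurable]: "(\<lambda>\<omega>. snd (\<omega> i)) \<in> borel_measurable (mining_space q tau0)"
proof -
  have *: "(\<lambda>\<omega>. \<omega> i) \<in> mining_space q tau0 \<rightarrow>\<^sub>M exp_measure ((1 - q) / tau0) \<Otimes>\<^sub>M exp_measure (q / tau0)"
    unfolding mining_space_def
    by (rule measurable_component_singleton) simp
  show "(\<lambda>\<omega>. fst (\<omega> i)) \<in> borel_measurable (mining_space q tau0)"
    using measurable_compose[OF * measurable_fst] by simp
  show "(\<lambda>\<omega>. snd (\<omega> i)) \<in> borel_measurable (mining_space q tau0)"
    using measurable_compose[OF * measurable_snd] by simp
qed

lemma measurable_attack_value_N[measurable]: "(\<lambda>xy. attack_value A z c f (zip_seq xy)) \<in> borel_measurable N"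
  by (rule measurable_compose[OF zip_seq_measurable measurable_attack_value]) measurable

lemma nn_integral_race_final:
  assumes "final A z h s"
  shows "(\<integral>\<^sup>+xy. ennreal (g (race A z c f h s xy)) \<partial>N) = ennreal (g (f h s))"
proof -
  have "(\<integral>\<^sup>+xy. ennreal (g (race A z c f h s xy)) \<partial>N) = (\<integral>\<^sup>+xy. ennreal (g (f h s)) \<partial>N)"
    using AE_good
    by (intro nn_integral_cong_AE, eventually_elim) (metis assms prod.collapse race_final(2))
  then show ?thesis by (simp add: N.emeasure_space_1)
qed

text \<open>The disjunct \<open>c = 0\<close> is the entry point: it leads to
  \<open>AE_race_ended\<close>, which in turn supplies the other disjunct for a positive time
  reward.\<close>

lemma nn_integral_race_step:
  assumes "\<not> final A z h s" "0 \<le> c" and f: "\<And>h s. 0 \<le> f h s"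
    and ended: "c = 0 \<or> (AE xy in N. (\<exists>t. race_ended A z (Suc h) s xy t) \<and> (\<exists>t. race_ended A z h (Suc s) xy t))"
  shows "(\<integral>\<^sup>+xy. ennreal (race A z c f h s xy) \<partial>N) = ennreal (c * tau0)
     + ennreal p * (\<integral>\<^sup>+xy. ennreal (race A z c f (Suc h) s xy) \<partial>N)
     + ennreal q * (\<integral>\<^sup>+xy. ennreal (race A z c f h (Suc s) xy) \<partial>N)"
proof (rule nn_integral_step)
  have "AE xy in N. c = 0 \<or> ((\<exists>t. race_ended A z (Suc h) s xy t) \<and> (\<exists>t. race_ended A z h (Suc s) xy t))"
    using ended by auto
  with AE_good show "AE xy in N. \<forall>u>0. ennreal (race A z c f h s (case_nat u (fst xy), delay u (snd xy))) =
        ennreal (c * u) + ennreal (race A z c f (Suc h) s xy) \<and>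
      ennreal (race A z c f h s (delay u (fst xy), case_nat u (snd xy))) =
        ennreal (c * u) + ennreal (race A z c f h (Suc s) xy)"
  proof eventually_elim
    case (elim xy)
    obtain x y where xy: "xy = (x, y)" by fastforce
    show ?case
      using elim assms(1,2) race_nonneg[OF assms(2), of f A z _ _ "(x, y)"] f
        race_not_ended[of A z "Suc h" s "(x, y)" 0 f] race_not_ended[of A z h "Suc s" "(x, y)" 0 f]
      by (auto simp: xy race_step_honest race_step_attacker)
  qed
qed (use assms in measurable)

text \<open>Truncated values are bounded by \<open>K\<close>, so the maximum principle applies to
  them before integrability is known. For an inequality, races that never end do no harm.\<close>

lemma nn_integral_race_min_step:
  assumes "\<not> final A z h s" "0 \<le> c" and f: "\<And>h s. 0 \<le> f h s" and K: "0 \<le> K"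
  shows "(\<integral>\<^sup>+xy. ennreal (min (race A z c f h s xy) K) \<partial>N) \<le> ennreal (c * tau0)
     + ennreal p * (\<integral>\<^sup>+xy. ennreal (min (race A z c f (Suc h) s xy) K) \<partial>N)
     + ennreal q * (\<integral>\<^sup>+xy. ennreal (min (race A z c f h (Suc s) xy) K) \<partial>N)"
proof (rule nn_integral_step_le)
  have b: "ennreal (min r K) \<le> ennreal (c * u) + ennreal (min r' K)" if "0 < u" "0 \<le> r'" "r \<le> c * u + r'" for r r' u :: real
    using that assms(2) K by (intro ennreal_min_le_add) auto
  show "AE xy in N. \<forall>u>0. ennreal (min (race A z c f h s (case_nat u (fst xy), delay u (snd xy))) K) \<le>
        ennreal (c * u) + ennreal (min (race A z c f (Suc h) s xy) K) \<and>
      ennreal (min (race A z c f h s (delay u (fst xy), case_nat u (snd xy))) K) \<le>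
        ennreal (c * u) + ennreal (min (race A z c f h (Suc s) xy) K)"
    using AE_good
  proof eventually_elim
    case (elim xy)
    obtain x y where xy: "xy = (x, y)" by fastforce
    have nn: "0 \<le> race A z c f h' s' (x, y)" for h' s' using race_nonneg[OF assms(2)] f by simp
    show ?case
      unfolding xy
    proof (intro allI impI conjI b nn)
      fix u :: real assume "0 < u"
      then show "race A z c f h s (case_nat u (fst (x, y)), delay u (snd (x, y))) \<le> c * u + race A z c f (Suc h) s (x, y)"
        "race A z c f h s (delay u (fst (x, y)), case_nat u (snd (x, y))) \<le> c * u + race A z c f h (Suc s) (x, y)"
        using elim assms nn[of "Suc h" s] nn[of h "Suc s"]
        by (auto simp: xy race_step_honest race_step_attacker)
    qed
  qed
qed (use assms in measurable)

text \<open>Time reward 0 and terminal reward 1 give the indicator of ending. The complement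
  \<open>1 - r\<close> solves the homogeneous equation, is bounded and is at most 0 on final states,
  so the maximum principle applies.\<close>

lemma AE_race_ended:
  assumes "h \<le> s + A"
  shows "AE xy in N. \<exists>t. race_ended A z h s xy t"
proof -
  let ?r = "\<lambda>h s xy. race A z 0 (\<lambda>_ _. 1) h s xy"
  define r where "r h s = enn2real (\<integral>\<^sup>+xy. ennreal (?r h s xy) \<partial>N)" for h s
  have r1: "?r h s xy = (if \<exists>t. race_ended A z h s xy t then 1 else 0)" for h s xy
    by (simp add: race_def outcome_def)
  have le1: "(\<integral>\<^sup>+xy. ennreal (?r h s xy) \<partial>N) \<le> 1" for h s
  proof -
    have "(\<integral>\<^sup>+xy. ennreal (?r h s xy) \<partial>N) \<le> (\<integral>\<^sup>+xy. 1 \<partial>N)"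
      by (intro nn_integral_mono) (simp add: r1)
    then show ?thesis by (simp add: N.emeasure_space_1)
  qed
  then have fin: "(\<integral>\<^sup>+xy. ennreal (?r h s xy) \<partial>N) = ennreal (r h s)" for h s
    unfolding r_def by (intro ennreal_enn2real_le[of _ 1]) simp
  have r0: "0 \<le> r h s" for h s by (simp add: r_def)
  have "1 - r h s \<le> 0"
  proof (rule max_principle[where B=1])
    show "1 - r h s \<le> 1 * (1 + real s)" for h s using r0[of h s] by simp
    show "1 - r h s \<le> 0" if "final A z h s" for h s
      using nn_integral_race_final[OF that, of "\<lambda>x. x" 0 "\<lambda>_ _. 1"] by (simp add: r_def)
    show "1 - r h s \<le> p * (1 - r (Suc h) s) + q * (1 - r h (Suc s))" if "\<not> final A z h s" for h s
    proof -
      have "ennreal (r h s) = ennreal p * ennreal (r (Suc h) s) + ennreal q * ennreal (r h (Suc s))"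
        using nn_integral_race_step[OF that, of 0 "\<lambda>_ _. 1"] by (simp add: fin)
      then have "r h s = p * r (Suc h) s + q * r h (Suc s)"
        using p_pos q r0 by (simp add: ennreal_mult[symmetric] ennreal_plus[symmetric] del: ennreal_plus)
      then show ?thesis using pq by (simp add: algebra_simps)
    qed
  qed (use assms in auto)
  then have "1 \<le> (\<integral>\<^sup>+xy. ennreal (?r h s xy) \<partial>N)" by (simp add: fin)
  also have "\<dots> = (\<integral>\<^sup>+xy. indicator {xy\<in>space N. \<exists>t. race_ended A z h s xy t} xy \<partial>N)"
    by (intro nn_integral_cong) (simp add: r1 indicator_def)
  also have "\<dots> = emeasure N {xy\<in>space N. \<exists>t. race_ended A z h s xy t}"
    using pred_race_ended[where A=A and z=z and h=h and s=s] by (intro nn_integral_indicator) (simp add: pred_def)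
  finally have "N.prob {xy\<in>space N. \<exists>t. race_ended A z h s xy t} = 1"
    using N.prob_le_1 by (simp add: N.emeasure_eq_measure antisym)
  from N.AE_prob_1[OF this] show ?thesis by simp
qed

text \<open>The upper bound comes from truncated values and monotone convergence. It makes the
  integral finite, and then the maximum principle for \<open>W - v'\<close> gives the lower bound;
  its growth condition follows from \<open>v' \<ge> 0\<close> and the bound on
  \<open>W\<close>.\<close>

lemma nn_integral_race:
  fixes W :: "nat \<Rightarrow> nat \<Rightarrow> real"
  assumes c: "0 \<le> c" and f: "\<And>h s. 0 \<le> f h s"
    and fin: "\<And>h s. h \<le> s + A \<Longrightarrow> final A z h s \<Longrightarrow> W h s = f h s"
    and step: "\<And>h s. h \<le> s + A \<Longrightarrow> \<not> final A z h s \<Longrightarrow> W h s = c * tau0 + p * W (Suc h) s + q * W h (Suc s)"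
    and W: "\<And>h s. h \<le> s + A \<Longrightarrow> \<bar>W h s\<bar> \<le> C * (1 + real s)"
    and hs: "h \<le> s + A"
  shows "(\<integral>\<^sup>+xy. ennreal (race A z c f h s xy) \<partial>N) = ennreal (W h s)" "0 \<le> W h s"
proof -
  have C: "0 \<le> C" using W[of 0 0] by simp
  define v where "v h s = (\<integral>\<^sup>+xy. ennreal (race A z c f h s xy) \<partial>N)" for h s
  have upperK: "(\<integral>\<^sup>+xy. ennreal (min (race A z c f h s xy) K) \<partial>N) \<le> ennreal (W h s) \<and> 0 \<le> W h s"
    if "h \<le> s + A" "0 \<le> K" for K h s
  proof -
    define w where "w h s = enn2real (\<integral>\<^sup>+xy. ennreal (min (race A z c f h s xy) K) \<partial>N)" for h s
    have leK: "(\<integral>\<^sup>+xy. ennreal (min (race A z c f h s xy) K) \<partial>N) \<le> ennreal K" for h s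
    proof -
      have "(\<integral>\<^sup>+xy. ennreal (min (race A z c f h s xy) K) \<partial>N) \<le> (\<integral>\<^sup>+xy. ennreal K \<partial>N)"
        by (intro nn_integral_mono ennreal_leI) simp
      then show ?thesis by (simp add: N.emeasure_space_1)
    qed
    then have w: "(\<integral>\<^sup>+xy. ennreal (min (race A z c f h s xy) K) \<partial>N) = ennreal (w h s)" for h s
      unfolding w_def by (rule ennreal_enn2real_le)
    have w0: "0 \<le> w h s" for h s by (simp add: w_def)
    have wK: "w h s \<le> K" for h s using leK[of h s] \<open>0 \<le> K\<close> by (simp add: w)
    have "w h s - W h s \<le> 0"
    proof (rule max_principle[where B="K + C"])
      show "w h s - W h s \<le> (K + C) * (1 + real s)" if "h \<le> s + A" for h s
      proof -
        have "w h s - W h s \<le> K + C * (1 + real s)" using wK[of h s] W[OF that] by linarith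
        also have "\<dots> \<le> (K + C) * (1 + real s)" using \<open>0 \<le> K\<close> by (simp add: algebra_simps)
        finally show ?thesis .
      qed
      show "w h s - W h s \<le> 0" if "h \<le> s + A" "final A z h s" for h s
        using nn_integral_race_final[OF that(2), of "\<lambda>x. min x K" c f] fin[OF that] f \<open>0 \<le> K\<close>
        by (simp add: w w0)
      show "w h s - W h s \<le> p * (w (Suc h) s - W (Suc h) s) + q * (w h (Suc s) - W h (Suc s))"
        if "h \<le> s + A" "\<not> final A z h s" for h s
      proof -
        have "ennreal (w h s) \<le> ennreal (c * tau0 + p * w (Suc h) s + q * w h (Suc s))"
          using nn_integral_race_min_step[of h s c f K, OF that(2) c f \<open>0 \<le> K\<close>]
          by (simp only: w ennreal_affine[OF c w0 w0])
        then have "w h s \<le> c * tau0 + p * w (Suc h) s + q * w h (Suc s)"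
          using affine_nonneg[OF c w0 w0] by (simp only: ennreal_le_iff)
        then show ?thesis using step[OF that] by (simp add: algebra_simps)
      qed
    qed (use that C in auto)
    then show ?thesis using w0[of h s] by (simp add: w ennreal_leI)
  qed
  \<comment> \<open>\<open>W\<close> dominates a truncated value, which is nonnegative;
    \<open>K = 0\<close> will do.\<close>
  have W0: "0 \<le> W h s" if "h \<le> s + A" for h s using upperK[OF that, of 0] by simp
  then show "0 \<le> W h s" using hs by blast
  have upper: "v h s \<le> ennreal (W h s)" if "h \<le> s + A" for h s
  proof -
    have "v h s = (\<integral>\<^sup>+xy. (SUP n. ennreal (min (race A z c f h s xy) (real n))) \<partial>N)"
      unfolding v_def
    proof (intro nn_integral_cong)
      fix xy
      show "ennreal (race A z c f h s xy) = (SUP n. ennreal (min (race A z c f h s xy) (real n)))" (is "?l = ?r")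
      proof (rule antisym)
        obtain n where "race A z c f h s xy \<le> real n" using real_arch_simple by blast
        then show "?l \<le> ?r" by (intro SUP_upper2[of n]) auto
        show "?r \<le> ?l" by (intro SUP_least ennreal_leI) simp
      qed
    qed
    also have "\<dots> = (SUP n. \<integral>\<^sup>+xy. ennreal (min (race A z c f h s xy) (real n)) \<partial>N)"
      by (intro nn_integral_monotone_convergence_SUP) (auto simp: incseq_def le_fun_def intro!: ennreal_leI)
    also have "\<dots> \<le> ennreal (W h s)"
      using upperK[OF that] by (intro SUP_least) auto
    finally show ?thesis .
  qed
  define v' where "v' h s = enn2real (v h s)" for h s
  have v: "v h s = ennreal (v' h s)" if "h \<le> s + A" for h s
    unfolding v'_def using upper[OF that] by (rule ennreal_enn2real_le)
  have v0: "0 \<le> v' h s" for h s by (simp add: v'_def)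
  have "W h s - v' h s \<le> 0"
  proof (rule max_principle[where B=C])
    show "W h s - v' h s \<le> C * (1 + real s)" if "h \<le> s + A" for h s
      using W[OF that] v0[of h s] by linarith
    show "W h s - v' h s \<le> 0" if "h \<le> s + A" "final A z h s" for h s
      using nn_integral_race_final[OF that(2), of "\<lambda>x. x" c f] fin[OF that] f[of h s]
      by (simp add: v'_def v_def)
    show "W h s - v' h s \<le> p * (W (Suc h) s - v' (Suc h) s) + q * (W h (Suc s) - v' h (Suc s))"
      if "h \<le> s + A" "\<not> final A z h s" for h s
    proof -
      have val: "Suc h \<le> s + A" "h \<le> Suc s + A" using that by (auto simp: final_def)
      have "v h s = ennreal (c * tau0) + ennreal p * v (Suc h) s + ennreal q * v h (Suc s)"
        unfolding v_def using that c f AE_race_ended[OF val(1)] AE_race_ended[OF val(2)]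
        by (intro nn_integral_race_step) auto
      then have "ennreal (v' h s) = ennreal (c * tau0 + p * v' (Suc h) s + q * v' h (Suc s))"
        using v[OF that(1)] v[OF val(1)] v[OF val(2)] c v0 by (simp only: ennreal_affine)
      then have "v' h s = c * tau0 + p * v' (Suc h) s + q * v' h (Suc s)"
        using affine_nonneg[OF c v0 v0] v0 by (simp only: ennreal_inj)
      then show ?thesis using step[OF that] by (simp add: algebra_simps)
    qed
  qed (use hs C in auto)
  then have "ennreal (W h s) \<le> v h s" using v[OF hs] by (simp add: ennreal_leI)
  with upper[OF hs] show "(\<integral>\<^sup>+xy. ennreal (race A z c f h s xy) \<partial>N) = ennreal (W h s)"
    unfolding v_def by (rule antisym)
qed

section \<open>Expected values including the pre-mining\<close>

lemma nn_integral_attack_value_step: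
  assumes "0 \<le> c" and f: "\<And>h s. 0 \<le> f h s"
    and ended: "c = 0 \<or> (AE xy in N. (\<exists>t. attack_ended A z (zip_seq xy) t))"
  shows "(\<integral>\<^sup>+xy. ennreal (attack_value A z c f (zip_seq xy)) \<partial>N) = ennreal (c * tau0)
     + ennreal p * (\<integral>\<^sup>+xy. ennreal (attack_value A z c f (zip_seq xy)) \<partial>N)
     + ennreal q * (\<integral>\<^sup>+xy. ennreal (race A z c f 0 1 xy) \<partial>N)"
proof (rule nn_integral_step)
  have "AE xy in N. c = 0 \<or> (\<exists>t. attack_ended A z (zip_seq xy) t)"
    using ended by auto
  moreover have "AE xy in N. \<exists>t. race_ended A z 0 1 xy t" by (rule AE_race_ended) simp
  ultimately show "AE xy in N. \<forall>u>0. ennreal (attack_value A z c f (zip_seq (case_nat u (fst xy), delay u (snd xy)))) =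
        ennreal (c * u) + ennreal (attack_value A z c f (zip_seq xy)) \<and>
      ennreal (attack_value A z c f (zip_seq (delay u (fst xy), case_nat u (snd xy)))) =
        ennreal (c * u) + ennreal (race A z c f 0 1 xy)"
    using AE_good
  proof eventually_elim
    case (elim xy)
    obtain x y where xy: "xy = (x, y)" by fastforce
    show ?case
      using elim assms(1) race_nonneg[OF assms(1), of f A z 0 1 "(x, y)"] f attack_value_nonneg[OF _ assms(1), of y f A z x]
        attack_value_not_ended[of A z "zip_seq (x, y)" 0 f]
      by (auto simp: xy attack_value_step_honest attack_value_step_attacker)
  qed
qed (use assms in measurable)

lemma nn_integral_attack_value_min_step:
  assumes "0 \<le> c" and f: "\<And>h s. 0 \<le> f h s" and K: "0 \<le> K"
  shows "(\<integral>\<^sup>+xy. ennreal (min (attack_value A z c f (zip_seq xy)) K) \<partial>N) \<le> ennreal (c * tau0)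
     + ennreal p * (\<integral>\<^sup>+xy. ennreal (min (attack_value A z c f (zip_seq xy)) K) \<partial>N)
     + ennreal q * (\<integral>\<^sup>+xy. ennreal (race A z c f 0 1 xy) \<partial>N)"
proof (rule nn_integral_step_le)
  have b: "ennreal (min r K) \<le> ennreal (c * u) + ennreal (min r' K)" if "0 < u" "0 \<le> r'" "r \<le> c * u + r'" for r r' u :: real
    using that assms(1) K by (intro ennreal_min_le_add) auto
  have b': "ennreal (min r K) \<le> ennreal (c * u) + ennreal r'" if "0 < u" "0 \<le> r'" "r \<le> c * u + r'" for r r' u :: real
    using b[OF that] by (rule order_trans) (intro add_left_mono ennreal_leI, simp)
  show "AE xy in N. \<forall>u>0. ennreal (min (attack_value A z c f (zip_seq (case_nat u (fst xy), delay u (snd xy)))) K) \<le>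
        ennreal (c * u) + ennreal (min (attack_value A z c f (zip_seq xy)) K) \<and>
      ennreal (min (attack_value A z c f (zip_seq (delay u (fst xy), case_nat u (snd xy)))) K) \<le>
        ennreal (c * u) + ennreal (race A z c f 0 1 xy)"
    using AE_good
  proof eventually_elim
    case (elim xy)
    obtain x y where xy: "xy = (x, y)" by fastforce
    have nn: "0 \<le> race A z c f 0 1 (x, y)" using race_nonneg[OF assms(1)] f by simp
    have nn': "0 \<le> attack_value A z c f (zip_seq (x, y))" using elim attack_value_nonneg[OF _ assms(1), of y f] f by (simp add: xy)
    show ?case
      unfolding xy
    proof (intro allI impI conjI b b' nn nn')
      fix u :: real assume "0 < u"
      then show "attack_value A z c f (zip_seq (case_nat u (fst (x, y)), delay u (snd (x, y)))) \<le> c * u + attack_value A z c f (zip_seq (x, y))"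
        "attack_value A z c f (zip_seq (delay u (fst (x, y)), case_nat u (snd (x, y)))) \<le> c * u + race A z c f 0 1 (x, y)"
        using elim assms nn nn'
        by (auto simp: xy attack_value_step_honest attack_value_step_attacker)
    qed
  qed
qed (use assms in measurable)

text \<open>The ending probability satisfies \<open>r = p * r + q\<close>: an honest block restarts
  the pre-mining, an attacker block leads to a race that ends almost surely. Since
  \<open>q > 0\<close>, \<open>r = 1\<close>.\<close>

lemma AE_attack_ended: "AE xy in N. \<exists>t. attack_ended A z (zip_seq xy) t"
proof -
  let ?r = "\<lambda>xy. attack_value A z 0 (\<lambda>_ _. 1) (zip_seq xy)"
  have r1: "?r xy = (if \<exists>t. attack_ended A z (zip_seq xy) t then 1 else 0)" for xy
    by (simp add: attack_value_def outcome_def)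
  have "(\<integral>\<^sup>+xy. ennreal (?r xy) \<partial>N) \<le> (\<integral>\<^sup>+xy. 1 \<partial>N)"
    by (intro nn_integral_mono) (simp add: r1)
  then have "(\<integral>\<^sup>+xy. ennreal (?r xy) \<partial>N) \<le> ennreal 1" by (simp add: N.emeasure_space_1)
  from ennreal_enn2real_le[OF this] obtain r where r: "(\<integral>\<^sup>+xy. ennreal (?r xy) \<partial>N) = ennreal r" "0 \<le> r"
    using enn2real_nonneg by blast
  have "(\<integral>\<^sup>+xy. ennreal (race A z 0 (\<lambda>_ _. 1) 0 1 xy) \<partial>N) = (\<integral>\<^sup>+xy. 1 \<partial>N)"
    using AE_race_ended[of 0 1]
    by (intro nn_integral_cong_AE) (auto elim!: eventually_mono simp: race_def outcome_def)
  then have "ennreal r = ennreal p * ennreal r + ennreal q"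
    using nn_integral_attack_value_step[of 0 "\<lambda>_ _. 1"] by (simp add: r N.emeasure_space_1)
  then have "r = p * r + q"
    using p_pos q r(2) by (simp add: ennreal_mult[symmetric] ennreal_plus[symmetric] del: ennreal_plus)
  then have "q * (r - 1) = 0" using p by (simp add: algebra_simps)
  then have "r = 1" using q by simp
  with r have "1 = (\<integral>\<^sup>+xy. ennreal (?r xy) \<partial>N)" by simp
  also have "\<dots> = (\<integral>\<^sup>+xy. indicator {xy\<in>space N. \<exists>t. attack_ended A z (zip_seq xy) t} xy \<partial>N)"
    by (intro nn_integral_cong) (simp add: r1 indicator_def)
  also have "\<dots> = emeasure N {xy\<in>space N. \<exists>t. attack_ended A z (zip_seq xy) t}"
  proof -
    have "Measurable.pred N (\<lambda>xy. \<exists>t. attack_ended A z (zip_seq xy) t)"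
      by (rule measurable_compose[OF zip_seq_measurable pred_attack_ended]) measurable
    then show ?thesis by (intro nn_integral_indicator) (simp add: pred_def)
  qed
  finally have "N.prob {xy\<in>space N. \<exists>t. attack_ended A z (zip_seq xy) t} = 1"
    by (simp add: N.emeasure_eq_measure)
  from N.AE_prob_1[OF this] show ?thesis by simp
qed

text \<open>The unknown occurs on both sides of \<open>u = c * tau0 + p * u + q * W\<close>, and
  solving for it needs finiteness, which truncation provides. \<open>tau0 / q\<close> is the mean
  pre-mining time.\<close>

lemma nn_integral_attack_value:
  assumes c: "0 \<le> c" and f: "\<And>h s. 0 \<le> f h s"
    and W: "(\<integral>\<^sup>+xy. ennreal (race A z c f 0 1 xy) \<partial>N) = ennreal W" "0 \<le> W"
  shows "(\<integral>\<^sup>+xy. ennreal (attack_value A z c f (zip_seq xy)) \<partial>N) = ennreal (c * tau0 / q + W)"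
proof -
  let ?U = "\<lambda>K. \<integral>\<^sup>+xy. ennreal (min (attack_value A z c f (zip_seq xy)) K) \<partial>N"
  have upperK: "?U K \<le> ennreal (c * tau0 / q + W)" if "0 \<le> K" for K
  proof -
    have "?U K \<le> (\<integral>\<^sup>+xy. ennreal K \<partial>N)"
      by (intro nn_integral_mono ennreal_leI) simp
    then have "?U K \<le> ennreal K" by (simp add: N.emeasure_space_1)
    from ennreal_enn2real_le[OF this] obtain w where w: "?U K = ennreal w" "0 \<le> w"
      using enn2real_nonneg by blast
    have "ennreal w \<le> ennreal (c * tau0 + p * w + q * W)"
      using nn_integral_attack_value_min_step[of c f K] c f that w(2) W(2) by (simp only: w W ennreal_affine)
    then have "w \<le> c * tau0 + p * w + q * W"
      using affine_nonneg[OF c w(2) W(2)] by (simp only: ennreal_le_iff)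
    then have "q * w \<le> c * tau0 + q * W" unfolding p by (simp add: algebra_simps)
    then have "w \<le> c * tau0 / q + W" using q by (simp add: field_simps)
    then show ?thesis by (simp add: w ennreal_leI)
  qed
  have "(\<integral>\<^sup>+xy. ennreal (attack_value A z c f (zip_seq xy)) \<partial>N) = (\<integral>\<^sup>+xy. (SUP n. ennreal (min (attack_value A z c f (zip_seq xy)) (real n))) \<partial>N)"
  proof (intro nn_integral_cong)
    fix xy
    show "ennreal (attack_value A z c f (zip_seq xy)) = (SUP n. ennreal (min (attack_value A z c f (zip_seq xy)) (real n)))" (is "?l = ?r")
    proof (rule antisym)
      obtain n where "attack_value A z c f (zip_seq xy) \<le> real n" using real_arch_simple by blast
      then show "?l \<le> ?r" by (intro SUP_upper2[of n]) auto
      show "?r \<le> ?l" by (intro SUP_least ennreal_leI) simp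
    qed
  qed
  also have "\<dots> = (SUP n. ?U (real n))"
    by (intro nn_integral_monotone_convergence_SUP) (auto simp: incseq_def le_fun_def intro!: ennreal_leI)
  also have "\<dots> \<le> ennreal (c * tau0 / q + W)"
    using upperK by (intro SUP_least) auto
  finally have "(\<integral>\<^sup>+xy. ennreal (attack_value A z c f (zip_seq xy)) \<partial>N) \<le> ennreal (c * tau0 / q + W)" .
  from ennreal_enn2real_le[OF this]
  obtain u where u: "(\<integral>\<^sup>+xy. ennreal (attack_value A z c f (zip_seq xy)) \<partial>N) = ennreal u" "0 \<le> u"
    using enn2real_nonneg by blast
  have "ennreal u = ennreal (c * tau0 + p * u + q * W)"
    using nn_integral_attack_value_step[of c f, OF c f disjI2[OF AE_attack_ended]]
    by (simp only: u W ennreal_affine[OF c u(2) W(2)])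
  then have "u = c * tau0 + p * u + q * W"
    using affine_nonneg[OF c u(2) W(2)] u(2) by (simp only: ennreal_inj)
  then have "q * u = c * tau0 + q * W" unfolding p by (simp add: algebra_simps)
  then have "u = c * tau0 / q + W" using q by (simp add: field_simps)
  with u show ?thesis by simp
qed

end

section \<open>Closed forms\<close>

context mining
begin

text \<open>Probability of exactly \<open>k\<close> attacker blocks before the \<open>n\<close>-th
  honest one. For \<open>n = 0\<close> truncated subtraction yields the point mass at 0, as
  \<open>(k - 1) choose k\<close> is 0 for positive \<open>k\<close>.\<close>

definition nbin_weight :: "nat \<Rightarrow> nat \<Rightarrow> real" where
  "nbin_weight n k = real ((n + k - 1) choose k) * p ^ n * q ^ k"

definition nbin_avg :: "(nat \<Rightarrow> real) \<Rightarrow> nat \<Rightarrow> nat \<Rightarrow> real" where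
  "nbin_avg \<phi> n s = (\<Sum>k\<le>z. nbin_weight n k * \<phi> (s + k))"

lemma nbin_weight_simps: "nbin_weight 0 0 = 1" "nbin_weight 0 (Suc k) = 0" "nbin_weight (Suc n) 0 = p * nbin_weight n 0"
  "nbin_weight (Suc n) (Suc k) = p * nbin_weight n (Suc k) + q * nbin_weight (Suc n) k"
  by (simp_all add: nbin_weight_def algebra_simps)

lemma nbin_avg_0: "nbin_avg \<phi> 0 s = \<phi> s"
  unfolding nbin_avg_def by (subst sum.atMost_shift) (simp add: nbin_weight_simps)

text \<open>Pascal's rule for the weights. The index shift produces one term with argument beyond
  \<open>z\<close>, where \<open>\<phi>\<close> vanishes.\<close>

lemma nbin_avg_Suc:
  assumes "\<And>t. z < t \<Longrightarrow> \<phi> t = 0"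
  shows "nbin_avg \<phi> (Suc n) s = p * nbin_avg \<phi> n s + q * nbin_avg \<phi> (Suc n) (Suc s)"
proof -
  have "nbin_avg \<phi> (Suc n) (Suc s) = (\<Sum>k<z. nbin_weight (Suc n) k * \<phi> (s + Suc k))"
    unfolding nbin_avg_def lessThan_Suc_atMost[symmetric] using assms by simp
  then show ?thesis
    unfolding nbin_avg_def sum.atMost_shift
    by (simp add: nbin_weight_simps sum.distrib sum_distrib_left algebra_simps)
qed

lemma nbin_avg_eq_0: "(\<And>t. z < t \<Longrightarrow> \<phi> t = 0) \<Longrightarrow> z < s \<Longrightarrow> nbin_avg \<phi> n s = 0"
  unfolding nbin_avg_def by (intro sum.neutral) auto

text \<open>Before the z-th honest block no stopping is possible, so the value there is an affine solution
  \<open>L\<close> of the one-step equation plus a negative binomial average of the defect \<open>g - L\<close> at \<open>h = z\<close>.\<close>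

lemma nn_integral_race_start:
  fixes g L :: "nat \<Rightarrow> nat \<Rightarrow> real"
  assumes c: "0 \<le> c" and f: "\<And>h s. 0 \<le> f h s"
    and gfin: "\<And>h s. z \<le> h \<Longrightarrow> h \<le> s + A \<Longrightarrow> final A z h s \<Longrightarrow> g h s = f h s"
    and gstep: "\<And>h s. z \<le> h \<Longrightarrow> s \<le> h \<Longrightarrow> h < s + A \<Longrightarrow> g h s = c * tau0 + p * g (Suc h) s + q * g h (Suc s)"
    and gbd: "\<And>h s. z \<le> h \<Longrightarrow> h \<le> s + A \<Longrightarrow> \<bar>g h s\<bar> \<le> Cg * (1 + real s)"
    and Lstep: "\<And>h s. h < z \<Longrightarrow> L h s = c * tau0 + p * L (Suc h) s + q * L h (Suc s)"
    and Lbd: "\<And>h s. h < z \<Longrightarrow> \<bar>L h s\<bar> \<le> CL * (1 + real s)"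
    and gL: "\<And>s. z < s \<Longrightarrow> g z s = L z s"
  defines "w \<equiv> L 0 1 + (\<Sum>k<z. nbin_weight z k * (g z (Suc k) - L z (Suc k)))"
  shows "(\<integral>\<^sup>+xy. ennreal (race A z c f 0 1 xy) \<partial>N) = ennreal w \<and> 0 \<le> w"
proof -
  \<comment> \<open>A secret length above \<open>z\<close> means immediate success at the
    \<open>z\<close>-th official block; there \<open>g\<close> and \<open>L\<close> agree, so the
    defect has finite support.\<close>
  define \<phi> where "\<phi> t = (if t \<le> z then g z t - L z t else 0)" for t
  define W where "W h s = (if z \<le> h then g h s else L h s + nbin_avg \<phi> (z - h) s)" for h s
  have \<phi>0: "\<phi> t = 0" if "z < t" for t using that by (simp add: \<phi>_def)
  have W1: "W h s = L h s + nbin_avg \<phi> (z - h) s" if "h \<le> z" for h s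
  proof (cases "h = z")
    case True
    have "g z s = L z s + \<phi> s" using gL[of s] by (cases "s \<le> z") (auto simp: \<phi>_def)
    then show ?thesis unfolding True W_def by (simp add: nbin_avg_0)
  next
    case False
    then show ?thesis using that by (simp add: W_def)
  qed
  \<comment> \<open>The pre-mined block makes \<open>s = 1\<close>, hence the argument
    \<open>Suc k\<close>; the term \<open>k = z\<close> falls outside the support of
    \<open>\<phi>\<close>.\<close>
  have W01: "W 0 1 = w"
    unfolding W1[OF le0] w_def nbin_avg_def lessThan_Suc_atMost[symmetric] by (simp add: \<phi>_def)
  \<comment> \<open>Here \<open>z \<le> A\<close> enters: \<open>h = s + A\<close> forces
    \<open>z \<le> h\<close>, so no state with fewer than \<open>z\<close> official blocks is
    final.\<close>
  have fin: "W h s = f h s" if "h \<le> s + A" "final A z h s" for h s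
    using that gfin A by (auto simp: W_def final_def)
  have step: "W h s = c * tau0 + p * W (Suc h) s + q * W h (Suc s)" if "h \<le> s + A" "\<not> final A z h s" for h s
  proof (cases "z \<le> h")
    case True
    then show ?thesis using gstep[of h s] that by (auto simp: W_def final_def)
  next
    case False
    then have zh: "z - h = Suc (z - Suc h)" by simp
    show ?thesis using False Lstep[of h s] nbin_avg_Suc[of \<phi> "z - Suc h" s, OF \<phi>0]
      by (simp add: W1 zh algebra_simps)
  qed
  define Cw where "Cw = (\<Sum>n\<le>z. \<Sum>s\<le>z. \<bar>nbin_avg \<phi> n s\<bar>)"
  have Cw: "\<bar>nbin_avg \<phi> n s\<bar> \<le> Cw * (1 + real s)" if "n \<le> z" for n s
  proof (cases "s \<le> z")
    case True
    have "\<bar>nbin_avg \<phi> n s\<bar> \<le> (\<Sum>s\<le>z. \<bar>nbin_avg \<phi> n s\<bar>)" using True by (intro member_le_sum) auto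
    also have "\<dots> \<le> Cw" unfolding Cw_def using that by (intro member_le_sum) (auto intro: sum_nonneg)
    also have "\<dots> \<le> Cw * (1 + real s)"
      unfolding Cw_def by (simp add: algebra_simps sum_nonneg)
    finally show ?thesis .
  next
    case False
    then show ?thesis using nbin_avg_eq_0[of \<phi> s n, OF \<phi>0] by (simp add: Cw_def sum_nonneg)
  qed
  have bd: "\<bar>W h s\<bar> \<le> (\<bar>Cg\<bar> + \<bar>CL\<bar> + Cw) * (1 + real s)" if "h \<le> s + A" for h s
  proof -
    have n: "0 \<le> \<bar>Cg\<bar> * (1 + real s)" "0 \<le> \<bar>CL\<bar> * (1 + real s)" "0 \<le> Cw * (1 + real s)"
      "Cg * (1 + real s) \<le> \<bar>Cg\<bar> * (1 + real s)" "CL * (1 + real s) \<le> \<bar>CL\<bar> * (1 + real s)"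
      by (auto simp: Cw_def intro!: mult_right_mono mult_nonneg_nonneg sum_nonneg)
    show ?thesis
    proof (cases "z \<le> h")
      case True
      then have "\<bar>W h s\<bar> \<le> Cg * (1 + real s)" using gbd[of h s] that by (simp add: W_def)
      with n show ?thesis unfolding distrib_right by linarith
    next
      case False
      then have "W h s = L h s + nbin_avg \<phi> (z - h) s" "\<bar>L h s\<bar> \<le> CL * (1 + real s)"
        using Lbd[of h s] by (auto simp: W_def)
      moreover have "\<bar>nbin_avg \<phi> (z - h) s\<bar> \<le> Cw * (1 + real s)" by (rule Cw) simp
      ultimately show ?thesis using n unfolding distrib_right by linarith
    qed
  qed
  have "0 \<le> (1::nat) + A" by simp
  note * = nn_integral_race[where W=W and f=f, OF c f fin step bd this]
  show "(\<integral>\<^sup>+xy. ennreal (race A z c f 0 1 xy) \<partial>N) = ennreal w \<and> 0 \<le> w"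
    using * W01 by auto
qed

text \<open>In the gambler's ruin phase \<open>n\<close> is the lag plus one: \<open>ruin n\<close> is the probability that the lag
  reaches \<open>A\<close> before \<open>-1\<close>, \<open>mined n\<close> the expected number of attacker blocks on the event of success,
  and \<open>ruin_time n\<close> the expected remaining time.\<close>

definition "l = q / p"
definition "Lam = l ^ (A + 1)"
definition "Den = 1 - Lam"
definition "ruin n = (1 - l ^ n) / Den"
definition "mined n = (p * real n * l ^ n + q * real n * Lam) / ((p - q) * Den)
   - real (A + 1) * Lam * (1 - l ^ n) / ((p - q) * Den\<^sup>2)"

lemma l_props: "0 < l" "l < 1" "p * l = q" "q < p"
  using p_pos p_gt q by (auto simp: l_def)

lemma Den_pos: "0 < Den"
  unfolding Den_def Lam_def using power_Suc_less_one[of l A] l_props by simp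

lemma ruin_0: "ruin 0 = 0" and ruin_top: "ruin (Suc A) = 1"
  using Den_pos by (auto simp: ruin_def Den_def Lam_def)

text \<open>\<open>l\<close> is a root of \<open>p * X\<^sup>2 - X + q\<close>, so
  \<open>l ^ n\<close> is harmonic for the walk of the lag: the exponential martingale of gambler's
  ruin.\<close>

lemma l_pow: "l ^ Suc n = p * l ^ Suc (Suc n) + q * l ^ n"
proof -
  have "p * l ^ Suc (Suc n) + q * l ^ n = (p * l) * l ^ Suc n + p * l * l ^ n"
    by (simp add: l_props mult_ac)
  also have "\<dots> = (p + q) * l ^ Suc n" unfolding l_props(3) using l_props(3) by (simp add: algebra_simps)
  finally show ?thesis by (simp add: pq)
qed

lemma ruin_step: "ruin (Suc n) = p * ruin (Suc (Suc n)) + q * ruin n"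
proof -
  have "p * ruin (Suc (Suc n)) + q * ruin n = (p + q - (p * l ^ Suc (Suc n) + q * l ^ n)) / Den"
    unfolding ruin_def by (simp add: diff_divide_distrib add_divide_distrib right_diff_distrib)
  then show ?thesis unfolding ruin_def l_pow[symmetric] pq by simp
qed

lemma mined_0: "mined 0 = 0" and mined_top: "mined (Suc A) = 0"
proof -
  show "mined 0 = 0" by (simp add: mined_def)
  have "l ^ Suc A = Lam" by (simp add: Lam_def)
  then have "mined (Suc A) = (p + q) * real (Suc A) * Lam / ((p - q) * Den) - real (Suc A) * Lam * Den / ((p - q) * Den\<^sup>2)"
    unfolding mined_def by (simp add: Den_def algebra_simps)
  then show "mined (Suc A) = 0" using Den_pos l_props by (simp add: pq power2_eq_square)
qed

text \<open>An attacker block leads from \<open>Suc n\<close> to \<open>n\<close> and counts if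
  success follows, which has probability \<open>1 - ruin n\<close>; this is the source term. The
  multiples of \<open>n * l ^ n\<close> and of \<open>n\<close> in \<open>mined\<close> form a
  particular solution, and the harmonic function \<open>1 - l ^ n\<close> is scaled to give the
  value 0 at \<open>Suc A\<close>.\<close>

lemma mined_step: "mined (Suc n) = p * mined (Suc (Suc n)) + q * (mined n + (1 - ruin n))"
proof -
  define a where "a = 1 / ((p - q) * Den)"
  define k where "k = real (A + 1) * Lam / ((p - q) * Den\<^sup>2)"
  define x where "x = l ^ n"
  have e': "mined m = (p * real m * l ^ m + q * real m * Lam) * a - k * (1 - l ^ m)" for m
    by (simp add: mined_def a_def k_def)
  have u: "1 - ruin n = (x - Lam) * ((p - q) * a)"
  proof -
    have "(p - q) * a = 1 / Den" using l_props by (simp add: a_def)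
    moreover have "1 - ruin n = (Den - (1 - x)) / Den"
      using Den_pos by (simp add: ruin_def x_def diff_divide_distrib)
    ultimately show ?thesis by (simp add: Den_def)
  qed
  have y: "l ^ Suc n = l * x" "l ^ Suc (Suc n) = l * (l * x)" by (simp_all add: x_def)
  have l1: "p * (l * (l * x)) = q * (l * x)" "p * (1 - l) = p - q"
    using l_props(3) by (simp_all add: algebra_simps)
  have l2: "l * x = q * (l * x) + q * x" using l_pow[of n] unfolding y x_def[symmetric] l1 .
  \<comment> \<open>\<open>S1\<close>, \<open>S2\<close> and \<open>S3\<close> evaluate
    \<open>f (n + 1) - p * f (n + 2) - q * f n\<close> for \<open>f n\<close> equal to
    \<open>n * l ^ n\<close>, \<open>n\<close> and \<open>1 - l ^ n\<close>.\<close>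
  have "(real n + 1) * (l * x) - (real n + 2) * (p * (l * (l * x))) - q * (real n * x)
      = real n * (l * x - q * (l * x) - q * x) + (l * x - 2 * (q * (l * x)))"
    unfolding l1 by (simp add: algebra_simps)
  also have "\<dots> = q * x * (1 - l)" using l2 by (simp add: algebra_simps)
  finally have S1: "(real n + 1) * (l * x) - (real n + 2) * (p * (l * (l * x))) - q * (real n * x) = q * x * (1 - l)" .
  have S2: "(real n + 1) - p * (real n + 2) - q * real n = q - p"
    unfolding p by (simp add: algebra_simps)
  have S3: "(1 - l * x) - p * (1 - l * (l * x)) - q * (1 - x) = 0"
  proof -
    have "(1 - l * x) - p * (1 - l * (l * x)) - q * (1 - x) = (1 - (p + q)) - (l * x - p * (l * (l * x)) - q * x)"
      by (simp add: algebra_simps)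
    then show ?thesis unfolding l1(1) pq using l2 by linarith
  qed
  have "mined (Suc n) - p * mined (Suc (Suc n)) - q * mined n
      = a * p * ((real n + 1) * (l * x) - (real n + 2) * (p * (l * (l * x))) - q * (real n * x))
        + a * q * Lam * ((real n + 1) - p * (real n + 2) - q * real n)
        - k * ((1 - l * x) - p * (1 - l * (l * x)) - q * (1 - x))"
    unfolding e' y x_def[symmetric] of_nat_Suc by (simp add: algebra_simps)
  also have "\<dots> = a * q * x * (p * (1 - l)) + a * q * Lam * (q - p)"
    unfolding S1 S2 S3 by simp
  also have "\<dots> = q * (1 - ruin n)"
    unfolding u l1(2) by (simp add: algebra_simps)
  finally show ?thesis by (simp add: algebra_simps)
qed

text \<open>Wald's identity: a block takes \<open>tau0\<close> on average and moves the lag by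
  \<open>p - q\<close> on average, and the mean displacement from \<open>n\<close> until 0 or
  \<open>A + 1\<close> is reached is \<open>(A + 1) * ruin n - n\<close>.\<close>

definition "ruin_time n = tau0 * (real (A + 1) * ruin n - real n) / (p - q)"

lemma ruin_time_0: "ruin_time 0 = 0" and ruin_time_top: "ruin_time (Suc A) = 0"
  by (simp_all add: ruin_time_def ruin_0 ruin_top)

lemma ruin_time_step: "ruin_time (Suc n) = tau0 + p * ruin_time (Suc (Suc n)) + q * ruin_time n"
proof -
  define r where "r = 1 / (p - q)"
  have r: "(p - q) * r = 1" using l_props by (simp add: r_def)
  have *: "ruin_time m = tau0 * (real (A + 1) * ruin m - real m) * r" for m
    by (simp add: ruin_time_def r_def)
  show ?thesis
    unfolding * ruin_step[of n] of_nat_Suc using pq r by algebra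
qed

section \<open>Values of the race for the two reward functions\<close>

lemma bounded_head: "n \<le> Suc A \<Longrightarrow> \<bar>F n\<bar> \<le> (\<Sum>n\<le>Suc A. \<bar>F n :: real\<bar>)"
  by (intro member_le_sum) auto

text \<open>\<open>L\<close> charges the mean time \<open>tau0 / p\<close> for every missing
  official block. In \<open>g\<close>, truncated subtraction makes \<open>Suc h - s\<close> equal to
  0 exactly when the secret fork is ahead.\<close>

lemma nn_integral_race_time:
  defines "w \<equiv> tau0 * real z / p + (\<Sum>k<z. nbin_weight z k * ruin_time (z - k))"
  shows "(\<integral>\<^sup>+xy. ennreal (race A z 1 (\<lambda>_ _. 0) 0 1 xy) \<partial>N) = ennreal w \<and> 0 \<le> w"
proof -
  let ?g = "\<lambda>h s. ruin_time (Suc h - s)" and ?L = "\<lambda>h (s::nat). tau0 * (real z - real h) / p"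
  have w: "w = ?L 0 1 + (\<Sum>k<z. nbin_weight z k * (?g z (Suc k) - ?L z (Suc k)))"
    by (simp add: w_def)
  show "(\<integral>\<^sup>+xy. ennreal (race A z 1 (\<lambda>_ _. 0) 0 1 xy) \<partial>N) = ennreal w \<and> 0 \<le> w"
    unfolding w
  proof (rule nn_integral_race_start[where Cg="\<Sum>n\<le>Suc A. \<bar>ruin_time n\<bar>" and CL="tau0 * real z / p"])
    fix h s :: nat
    show "?g h s = 0" if "final A z h s"
      using that ruin_time_0 ruin_time_top by (auto simp: final_def Suc_diff_le)
    show "?g h s = 1 * tau0 + p * ?g (Suc h) s + q * ?g h (Suc s)" if "s \<le> h"
      using ruin_time_step[of "h - s"] that by (simp add: Suc_diff_le)
    show "\<bar>?g h s\<bar> \<le> (\<Sum>n\<le>Suc A. \<bar>ruin_time n\<bar>) * (1 + real s)" if "h \<le> s + A"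
    proof -
      have "\<bar>?g h s\<bar> \<le> (\<Sum>n\<le>Suc A. \<bar>ruin_time n\<bar>)" using that by (intro bounded_head) auto
      also have "\<dots> \<le> (\<Sum>n\<le>Suc A. \<bar>ruin_time n\<bar>) * (1 + real s)"
        by (simp add: distrib_left sum_nonneg del: sum.atMost_Suc)
      finally show ?thesis .
    qed
    show "?L h s = 1 * tau0 + p * ?L (Suc h) s + q * ?L h (Suc s)"
    proof -
      define X Y where "X = ?L h s" and "Y = ?L (Suc h) s"
      have "p * Y = tau0 * (real z - real (Suc h))" "p * X = tau0 * (real z - real h)"
        using p_pos by (simp_all add: X_def Y_def)
      then have "p * Y = p * X - tau0" by (simp add: algebra_simps)
      then have "1 * tau0 + p * Y + q * X = (p + q) * X" by (simp add: algebra_simps)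
      then show ?thesis unfolding X_def[symmetric] Y_def[symmetric] pq by simp
    qed
    show "\<bar>?L h s\<bar> \<le> tau0 * real z / p * (1 + real s)" if "h < z"
    proof -
      have "\<bar>?L h s\<bar> = tau0 * (real z - real h) / p" using that tau0 p_pos by simp
      also have "\<dots> \<le> tau0 * real z / p" using tau0 p_pos by (intro divide_right_mono mult_left_mono) auto
      also have "\<dots> \<le> tau0 * real z / p * (1 + real s)" using tau0 p_pos by (simp add: distrib_left)
      finally show ?thesis .
    qed
    show "?g z s = ?L z s" if "z < s" using that by (simp add: ruin_time_0)
  qed auto
qed

text \<open>The reward omits the pre-mined block, which is paid later together with
  \<open>v\<close>. \<open>L\<close> is the value if success were certain at the \<open>z\<close>-th
  official block, with \<open>q / p\<close> expected attacker blocks per missing official block; the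
  defect subtracts what failure loses and adds what the ruin phase gains.\<close>

lemma nn_integral_race_blocks:
  defines "w \<equiv> real z * q / p + (\<Sum>k<z. nbin_weight z k * (mined (z - k) - real k * ruin (z - k)))"
  shows "(\<integral>\<^sup>+xy. ennreal (race A z 0 (\<lambda>h s. if h < s then real s - 1 else 0) 0 1 xy) \<partial>N) = ennreal w \<and> 0 \<le> w"
proof -
  let ?g = "\<lambda>h s. (real s - 1) * (1 - ruin (Suc h - s)) + mined (Suc h - s)"
    and ?L = "\<lambda>h s. real s - 1 + (real z - real h) * q / p"
  have w: "w = ?L 0 1 + (\<Sum>k<z. nbin_weight z k * (?g z (Suc k) - ?L z (Suc k)))"
    by (simp add: w_def algebra_simps)
  let ?C = "(\<Sum>n\<le>Suc A. \<bar>1 - ruin n\<bar>)" and ?C' = "\<Sum>n\<le>Suc A. \<bar>mined n\<bar>"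
  show "(\<integral>\<^sup>+xy. ennreal (race A z 0 (\<lambda>h s. if h < s then real s - 1 else 0) 0 1 xy) \<partial>N) = ennreal w \<and> 0 \<le> w"
    unfolding w
  proof (rule nn_integral_race_start[where Cg="?C + ?C'" and CL="1 + real z * q / p"])
    fix h s :: nat
    show "?g h s = (if h < s then real s - 1 else 0)" if "final A z h s"
      using that ruin_0 ruin_top mined_0 mined_top by (auto simp: final_def Suc_diff_le)
    show "?g h s = 0 * tau0 + p * ?g (Suc h) s + q * ?g h (Suc s)" if "s \<le> h"
    proof -
      define n where "n = h - s"
      have n: "Suc h - s = Suc n" "Suc (Suc h) - s = Suc (Suc n)" "Suc h - Suc s = n"
        using that by (auto simp: n_def)
      have "1 - ruin (Suc n) = p * (1 - ruin (Suc (Suc n))) + q * (1 - ruin n)"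
        using ruin_step[of n] pq by algebra
      then show ?thesis
        unfolding n mined_step[of n] of_nat_Suc by algebra
    qed
    show "\<bar>?g h s\<bar> \<le> (?C + ?C') * (1 + real s)" if "h \<le> s + A"
    proof -
      have n: "Suc h - s \<le> Suc A" using that by simp
      have "\<bar>?g h s\<bar> \<le> \<bar>real s - 1\<bar> * \<bar>1 - ruin (Suc h - s)\<bar> + \<bar>mined (Suc h - s)\<bar>"
        by (metis abs_mult abs_triangle_ineq)
      also have "\<dots> \<le> (1 + real s) * ?C + ?C'"
        by (intro add_mono mult_mono bounded_head[OF n]) auto
      also have "\<dots> \<le> (?C + ?C') * (1 + real s)"
        by (simp add: algebra_simps sum_nonneg del: sum.atMost_Suc)
      finally show ?thesis .
    qed
    show "?L h s = 0 * tau0 + p * ?L (Suc h) s + q * ?L h (Suc s)"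
    proof -
      define X Y where "X = ?L h s" and "Y = ?L (Suc h) s"
      have "p * Y = p * (real s - 1) + (real z - real (Suc h)) * q" "p * X = p * (real s - 1) + (real z - real h) * q"
        using p_pos by (simp_all add: X_def Y_def distrib_left)
      then have "p * Y = p * X - q" by (simp add: algebra_simps)
      then have "0 * tau0 + p * Y + q * (X + 1) = (p + q) * X" by (simp add: algebra_simps)
      moreover have "?L h (Suc s) = X + 1" by (simp add: X_def)
      ultimately show ?thesis unfolding X_def[symmetric] Y_def[symmetric] pq by simp
    qed
    show "\<bar>?L h s\<bar> \<le> (1 + real z * q / p) * (1 + real s)" if "h < z"
    proof -
      have "0 \<le> (real z - real h) * q / p" using that q p_pos by simp
      moreover have "(real z - real h) * q / p \<le> real z * q / p"
        using that q p_pos by (intro divide_right_mono mult_right_mono) auto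
      moreover have "0 \<le> real s * (real z * q / p)" using q p_pos by simp
      moreover have "(1 + real z * q / p) * (1 + real s) = 1 + real s + real z * q / p + real s * (real z * q / p)"
        by (simp add: distrib_left distrib_right)
      ultimately show ?thesis by linarith
    qed
    show "?g z s = ?L z s" if "z < s" using that by (simp add: ruin_0 mined_0)
  qed auto
qed

text \<open>The factor \<open>l ^ (z - k)\<close> converts \<open>p ^ z * q ^ k\<close> into
  \<open>q ^ z * p ^ k\<close>; this exchange of the two miners produces the heads for
  \<open>(q, p)\<close>.\<close>

lemma nbin_weight_sums:
  shows "(\<Sum>k<z. nbin_weight z k * (1 - l ^ (z - k))) = nbin_head z p q - nbin_head z q p"
    and "(\<Sum>k<z. nbin_weight z k * real (z - k)) = real z * nbin_head z p q - nbin_head_mean z p q"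
    and "(\<Sum>k<z. nbin_weight z k * (real (z - k) * l ^ (z - k))) = real z * nbin_head z q p - nbin_head_mean z q p"
    and "(\<Sum>k<z. nbin_weight z k * (real k * (1 - l ^ (z - k)))) = nbin_head_mean z p q - nbin_head_mean z q p"
proof -
  have wl: "nbin_weight z k * l ^ (z - k) = real ((z + k - 1) choose k) * q ^ z * p ^ k" if "k < z" for k
  proof -
    have "p ^ z * l ^ (z - k) = p ^ k * q ^ (z - k)"
    proof -
      have "p ^ z = p ^ k * p ^ (z - k)" using that by (simp flip: power_add)
      then have "p ^ z * l ^ (z - k) = p ^ k * (p * l) ^ (z - k)" by (simp only: power_mult_distrib mult.assoc)
      then show ?thesis by (simp only: l_props(3))
    qed
    moreover have "q ^ k * q ^ (z - k) = q ^ z" using that by (simp flip: power_add)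
    moreover have "nbin_weight z k * l ^ (z - k) = real ((z + k - 1) choose k) * (p ^ z * l ^ (z - k)) * q ^ k"
      by (simp add: nbin_weight_def)
    ultimately show ?thesis by (simp add: mult_ac)
  qed
  have n1: "nbin_head z p q = (\<Sum>k<z. nbin_weight z k)" "nbin_head_mean z p q = (\<Sum>k<z. real k * nbin_weight z k)"
    by (simp_all add: nbin_head_def nbin_head_mean_def nbin_weight_def)
  have n2: "nbin_head z q p = (\<Sum>k<z. nbin_weight z k * l ^ (z - k))" "nbin_head_mean z q p = (\<Sum>k<z. real k * (nbin_weight z k * l ^ (z - k)))"
    by (simp_all add: nbin_head_def nbin_head_mean_def wl)
  show "(\<Sum>k<z. nbin_weight z k * (1 - l ^ (z - k))) = nbin_head z p q - nbin_head z q p"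
    unfolding n1 n2 sum_subtractf[symmetric] by (intro sum.cong) (auto simp: algebra_simps)
  show "(\<Sum>k<z. nbin_weight z k * real (z - k)) = real z * nbin_head z p q - nbin_head_mean z p q"
    unfolding n1 sum_subtractf[symmetric] sum_distrib_left
    by (intro sum.cong) (auto simp: algebra_simps of_nat_diff)
  show "(\<Sum>k<z. nbin_weight z k * (real (z - k) * l ^ (z - k))) = real z * nbin_head z q p - nbin_head_mean z q p"
    unfolding n2 sum_subtractf[symmetric] sum_distrib_left
    by (intro sum.cong) (auto simp: algebra_simps of_nat_diff)
  show "(\<Sum>k<z. nbin_weight z k * (real k * (1 - l ^ (z - k)))) = nbin_head_mean z p q - nbin_head_mean z q p"
    unfolding n1 n2 sum_subtractf[symmetric] by (intro sum.cong) (auto simp: algebra_simps)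
qed

lemma time_sum:
  "(\<Sum>k<z. nbin_weight z k * ruin_time (z - k)) = tau0 * (real (A + 1) * (nbin_head z p q - nbin_head z q p) / Den
     - (real z * nbin_head z p q - nbin_head_mean z p q)) / (p - q)"
proof -
  have "nbin_weight z k * ruin_time (z - k) = tau0 * real (A + 1) / (Den * (p - q)) * (nbin_weight z k * (1 - l ^ (z - k)))
      - tau0 / (p - q) * (nbin_weight z k * real (z - k))" for k
    unfolding ruin_time_def ruin_def divide_inverse inverse_mult_distrib by (simp add: algebra_simps)
  then have "(\<Sum>k<z. nbin_weight z k * ruin_time (z - k)) = tau0 * real (A + 1) / (Den * (p - q)) * (nbin_head z p q - nbin_head z q p)
      - tau0 / (p - q) * (real z * nbin_head z p q - nbin_head_mean z p q)"
    by (simp only: sum_subtractf sum_distrib_left[symmetric] nbin_weight_sums)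
  also have "\<dots> = tau0 * (real (A + 1) * (nbin_head z p q - nbin_head z q p) / Den
     - (real z * nbin_head z p q - nbin_head_mean z p q)) / (p - q)"
    unfolding divide_inverse inverse_mult_distrib by (simp add: algebra_simps)
  finally show ?thesis .
qed

lemma blocks_sum:
  "(\<Sum>k<z. nbin_weight z k * (mined (z - k) - real k * ruin (z - k))) =
     (p * (real z * nbin_head z q p - nbin_head_mean z q p) + q * Lam * (real z * nbin_head z p q - nbin_head_mean z p q)) / ((p - q) * Den)
     - real (A + 1) * Lam / ((p - q) * Den\<^sup>2) * (nbin_head z p q - nbin_head z q p)
     - (nbin_head_mean z p q - nbin_head_mean z q p) / Den"
proof -
  have "nbin_weight z k * (mined (z - k) - real k * ruin (z - k)) =
      p / ((p - q) * Den) * (nbin_weight z k * (real (z - k) * l ^ (z - k)))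
      + q * Lam / ((p - q) * Den) * (nbin_weight z k * real (z - k))
      - real (A + 1) * Lam / ((p - q) * Den\<^sup>2) * (nbin_weight z k * (1 - l ^ (z - k)))
      - 1 / Den * (nbin_weight z k * (real k * (1 - l ^ (z - k))))" for k
    unfolding mined_def ruin_def divide_inverse inverse_mult_distrib by (simp add: algebra_simps)
  then have "(\<Sum>k<z. nbin_weight z k * (mined (z - k) - real k * ruin (z - k))) =
      p / ((p - q) * Den) * (real z * nbin_head z q p - nbin_head_mean z q p)
      + q * Lam / ((p - q) * Den) * (real z * nbin_head z p q - nbin_head_mean z p q)
      - real (A + 1) * Lam / ((p - q) * Den\<^sup>2) * (nbin_head z p q - nbin_head z q p)
      - 1 / Den * (nbin_head_mean z p q - nbin_head_mean z q p)"
    by (simp only: sum_subtractf sum.distrib sum_distrib_left[symmetric] nbin_weight_sums)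
  then show ?thesis by (simp add: add_divide_distrib)
qed

end

section \<open>The expected revenue and duration\<close>

text \<open>The algebra of the revenue formula with denominators cleared: \<open>x\<close> is
  \<open>z\<close>, \<open>a\<close> and \<open>b\<close> are the heads, \<open>m\<close> and
  \<open>n\<close> the truncated means, \<open>La\<close> is \<open>Lam\<close>. The factor
  \<open>p * q\<close> lets the means be eliminated through \<open>p * m\<close> and
  \<open>q * n\<close>.\<close>

lemma blocks_identity:
  fixes p q x a b m n K La :: real
  assumes "p + q = 1" and a: "a = 1 - b" and m: "p * m = x * q * a - K" and n: "q * n = x * p * b - K"
  shows "p * q * ((p - q) * (1 - La) * (x * q) + p * (p * (x * b - n) + q * La * (x * a - m)) - p * (p - q) * (m - n))
      = p * q * ((p - q) * (1 - La) * (q * x * b) + (2 * p - q + q * La) * K)"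
proof -
  have q: "q = 1 - p" using assms(1) by simp
  have "p * q * ((p - q) * (1 - La) * (x * q) + p * (p * (x * b - n) + q * La * (x * a - m)) - p * (p - q) * (m - n))
       = p * q * (p - q) * (1 - La) * (x * q) + p * p * (p * q * x * b - p * (q * n))
          + p * q * q * La * (p * x * a - p * m) - p * (p - q) * (q * (p * m) - p * (q * n))"
    by (simp add: algebra_simps)
  also have "\<dots> = p * q * ((p - q) * (1 - La) * (q * x * b) + (2 * p - q + q * La) * K)"
    unfolding m n unfolding a q by (simp add: algebra_simps)
  finally show ?thesis .
qed

context mining
begin

text \<open>The boundary term is symmetric in \<open>p\<close> and \<open>q\<close>, so a single
  \<open>K\<close> serves both truncated means.\<close>

lemma nbin_head_relations:
  obtains K where "K = p ^ z * q ^ z / Beta (real z) (real z)"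
    and "p * nbin_head_mean z p q = real z * q * nbin_head z p q - K"
    and "q * nbin_head_mean z q p = real z * p * nbin_head z q p - K"
    and "nbin_head z p q + nbin_head z q p = 1"
    and "inc_beta ((p - q)\<^sup>2) (1/2) (real z) = nbin_head z p q - nbin_head z q p"
    and "inc_beta (4 * p * q) (real z) (1/2) = 2 * nbin_head z q p"
proof -
  obtain n where n: "z = Suc n" using z by (cases z) auto
  have pq': "q + p = 1" using pq by simp
  have y: "0 < p - q" "p - q < 1" using l_props q p by auto
  have 4: "4 * p * q = 1 - (p - q)\<^sup>2"
    unfolding p by (simp add: power2_eq_square algebra_simps)
  have s: "nbin_head z p q + nbin_head z q p = 1" unfolding n by (rule nbin_head_symmetric[OF pq])
  show ?thesis
  proof (rule that)
    show "beta_const n * p ^ Suc n * q ^ Suc n = p ^ z * q ^ z / Beta (real z) (real z)"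
    proof -
      have "beta_const n = 1 / Beta (real z) (real z)"
        unfolding n using Beta_diag[of n] beta_const_pos[of n]
        by (metis mult_zero_left nonzero_eq_divide_eq mult.commute zero_neq_one)
      then show ?thesis by (simp add: n)
    qed
    show "p * nbin_head_mean z p q = real z * q * nbin_head z p q - beta_const n * p ^ Suc n * q ^ Suc n"
      unfolding n by (rule nbin_head_mean_eq[OF pq])
    show "q * nbin_head_mean z q p = real z * p * nbin_head z q p - beta_const n * p ^ Suc n * q ^ Suc n"
      unfolding n nbin_head_mean_eq[OF pq'] by (simp add: mult_ac)
    show "inc_beta ((p - q)\<^sup>2) (1/2) (real z) = nbin_head z p q - nbin_head z q p"
      unfolding n using inc_beta_half_left[of "p - q" n] y nbin_gap_eq[OF pq, of n] by simp
    show "inc_beta (4 * p * q) (real z) (1/2) = 2 * nbin_head z q p"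
      unfolding 4 using inc_beta_half_right[of "p - q" n] y nbin_gap_eq[OF pq, of n] s by (simp add: n)
  qed (rule s)
qed

lemma qint_eq: "qint l (A + 1) = Den / (1 - l)"
  by (simp add: qint_def Den_def Lam_def)

lemma p_one_minus_l: "p * (1 - l) = p - q"
  using l_props(3) by (simp add: algebra_simps)

lemma time_formula:
  "(tau0 / q + (tau0 * real z / p + (\<Sum>k<z. nbin_weight z k * ruin_time (z - k)))) / tau0 =
     real z / (2 * p) * inc_beta (4 * p * q) (real z) (1/2)
     + real (A + 1) / (p * (1 - l)\<^sup>2 * qint l (A + 1)) * inc_beta ((p - q)\<^sup>2) (1/2) (real z)
     - p ^ (z - 1) * q ^ z / (p * (1 - l) * Beta (real z) (real z)) + 1 / q"
proof -
  obtain K where K: "K = p ^ z * q ^ z / Beta (real z) (real z)"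
    and mu: "p * nbin_head_mean z p q = real z * q * nbin_head z p q - K"
    and s: "nbin_head z p q + nbin_head z q p = 1"
    and I1: "inc_beta ((p - q)\<^sup>2) (1/2) (real z) = nbin_head z p q - nbin_head z q p"
    and I2: "inc_beta (4 * p * q) (real z) (1/2) = 2 * nbin_head z q p"
    using nbin_head_relations by metis
  define a b m where "a = nbin_head z p q" and "b = nbin_head z q p" and "m = nbin_head_mean z p q"
  have a: "a = 1 - b" using s by (simp add: a_def b_def)
  have m: "m = (real z * q * a - K) / p" using mu p_pos by (simp add: a_def m_def field_simps)
  have pne: "p \<noteq> 0" "q \<noteq> 0" "tau0 \<noteq> 0" "Den \<noteq> 0" "p - q \<noteq> 0" "1 - l \<noteq> 0"
    using p_pos q tau0 Den_pos l_props by auto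
  have c1: "p * (1 - l)\<^sup>2 * qint l (A + 1) = (p - q) * Den"
    unfolding qint_eq p_one_minus_l[symmetric] using pne by (simp add: power2_eq_square)
  have "p ^ z = p * p ^ (z - 1)" using z by (cases z) auto
  then have c2: "p ^ (z - 1) * q ^ z / (p * (1 - l) * Beta (real z) (real z)) = K / (p * (p - q))"
    unfolding K p_one_minus_l using pne by simp
  have lhs: "(tau0 / q + (tau0 * real z / p + (\<Sum>k<z. nbin_weight z k * ruin_time (z - k)))) / tau0 =
     1 / q + real z / p + (real (A + 1) * (a - b) / Den - (real z * a - m)) / (p - q)"
    unfolding time_sum a_def[symmetric] b_def[symmetric] m_def[symmetric]
    using pne by (simp add: add_divide_distrib)
  have "real z * a - m = real z * a * (p - q) / p + K / p"
    unfolding m using pne by (simp add: field_simps)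
  then have "(real (A + 1) * (a - b) / Den - (real z * a - m)) / (p - q)
     = real (A + 1) * (a - b) / ((p - q) * Den) - real z * a / p - K / (p * (p - q))"
    using pne by (simp add: diff_divide_distrib add_divide_distrib mult.commute)
  \<comment> \<open>The heads sum to 1, so \<open>z / p\<close> and the correction by
    \<open>z * a / p\<close> combine to the term with argument \<open>4 * p * q\<close>.\<close>
  moreover have "real z / p - real z * a / p = real z / (2 * p) * (2 * b)"
    unfolding a using pne by (simp add: field_simps)
  ultimately show ?thesis
    unfolding lhs I1 I2 c1 c2 a_def[symmetric] b_def[symmetric] by simp
qed

lemma blocks_formula:
  "real z * q / p + (\<Sum>k<z. nbin_weight z k * (mined (z - k) - real k * ruin (z - k))) =
     q * real z / (2 * p) * inc_beta (4 * p * q) (real z) (1/2)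
     - real (A + 1) * l ^ (A + 1) / (p * (1 - l) ^ 3 * (qint l (A + 1))\<^sup>2) * inc_beta ((p - q)\<^sup>2) (1/2) (real z)
     + (2 - l + l ^ (A + 2)) / ((1 - l)\<^sup>2 * qint l (A + 1)) * (p ^ (z - 1) * q ^ z / Beta (real z) (real z))"
proof -
  obtain K where K: "K = p ^ z * q ^ z / Beta (real z) (real z)"
    and mu: "p * nbin_head_mean z p q = real z * q * nbin_head z p q - K"
    and nu: "q * nbin_head_mean z q p = real z * p * nbin_head z q p - K"
    and s: "nbin_head z p q + nbin_head z q p = 1"
    and I1: "inc_beta ((p - q)\<^sup>2) (1/2) (real z) = nbin_head z p q - nbin_head z q p"
    and I2: "inc_beta (4 * p * q) (real z) (1/2) = 2 * nbin_head z q p"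
    using nbin_head_relations by metis
  define a b m n where "a = nbin_head z p q" and "b = nbin_head z q p" and "m = nbin_head_mean z p q" and "n = nbin_head_mean z q p"
  have a: "a = 1 - b" using s by (simp add: a_def b_def)
  have m: "p * m = real z * q * a - K" and n: "q * n = real z * p * b - K"
    using mu nu by (auto simp: a_def m_def b_def n_def)
  have pne: "p \<noteq> 0" "q \<noteq> 0" "tau0 \<noteq> 0" "Den \<noteq> 0" "p - q \<noteq> 0" "1 - l \<noteq> 0"
    using p_pos q tau0 Den_pos l_props by auto
  have c1: "p * (1 - l) ^ 3 * (qint l (A + 1))\<^sup>2 = (p - q) * Den\<^sup>2"
    unfolding qint_eq p_one_minus_l[symmetric] using pne by (simp add: power2_eq_square power3_eq_cube)
  have "p ^ z = p * p ^ (z - 1)" using z by (cases z) auto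
  then have c2: "p ^ (z - 1) * q ^ z / Beta (real z) (real z) = K / p"
    unfolding K using pne by simp
  have c3: "(2 - l + l ^ (A + 2)) / ((1 - l)\<^sup>2 * qint l (A + 1)) * (K / p) = (2 - l + l * Lam) * K / ((p - q) * Den)"
    unfolding qint_eq p_one_minus_l[symmetric] using pne by (simp add: power2_eq_square Lam_def mult_ac)
  \<comment> \<open>The claim times \<open>(p - q) * Den\<close>, without the term in
    \<open>A + 1\<close>, which agrees on both sides by \<open>c1\<close>.\<close>
  have key: "(p - q) * Den * (real z * q / p) + (p * (real z * b - n) + q * Lam * (real z * a - m)) - (p - q) * (m - n)
     = (p - q) * Den * (q * real z * b / p) + (2 - l + l * Lam) * K"
  proof -
    have "p * q * ((p - q) * Den * (real z * q) + p * (p * (real z * b - n) + q * Lam * (real z * a - m)) - p * (p - q) * (m - n))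
      = p * q * ((p - q) * Den * (q * real z * b) + (2 * p - q + q * Lam) * K)"
      unfolding Den_def by (rule blocks_identity[OF pq a m n])
    then have "(p - q) * Den * (real z * q) + p * (p * (real z * b - n) + q * Lam * (real z * a - m)) - p * (p - q) * (m - n)
      = (p - q) * Den * (q * real z * b) + (2 * p - q + q * Lam) * K"
      using pne by simp
    also have "(2 * p - q + q * Lam) = p * (2 - l + l * Lam)"
      using l_props(3) by (simp add: algebra_simps)
    finally have "p * ((p - q) * Den * (real z * q / p) + (p * (real z * b - n) + q * Lam * (real z * a - m)) - (p - q) * (m - n))
      = p * ((p - q) * Den * (q * real z * b / p) + (2 - l + l * Lam) * K)"
      using pne by (simp add: algebra_simps)
    then show ?thesis using pne by simp
  qed
  have d: "X = Y" if "(p - q) * Den * X = (p - q) * Den * Y" for X Y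
    using that pne by simp
  have "real z * q / p + ((p * (real z * b - n) + q * Lam * (real z * a - m)) / ((p - q) * Den) - (m - n) / Den)
     = q * real z * b / p + (2 - l + l * Lam) * K / ((p - q) * Den)"
  proof (rule d)
    have "(p - q) * Den * (r + (U / ((p - q) * Den) - V / Den)) = (p - q) * Den * r + U - (p - q) * V" for r U V
    proof -
      have "(p - q) * Den * (U / ((p - q) * Den)) = U" "(p - q) * Den * (V / Den) = (p - q) * V"
        using pne by simp_all
      then show ?thesis by (simp only: distrib_left right_diff_distrib[of "(p - q) * Den"])
    qed
    moreover have "(p - q) * Den * (r + V / ((p - q) * Den)) = (p - q) * Den * r + V" for r V
      using pne by (simp add: distrib_left)
    ultimately show "(p - q) * Den * (real z * q / p + ((p * (real z * b - n) + q * Lam * (real z * a - m)) / ((p - q) * Den) - (m - n) / Den))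
      = (p - q) * Den * (q * real z * b / p + (2 - l + l * Lam) * K / ((p - q) * Den))"
      using key by (simp only:)
  qed
  moreover have "q * real z / (2 * p) * (2 * b) = q * real z * b / p" using pne by simp
  ultimately show ?thesis
    unfolding blocks_sum I1 I2 c1 c2 c3 Lam_def[symmetric] a_def[symmetric] b_def[symmetric] m_def[symmetric] n_def[symmetric]
    by linarith
qed

section \<open>From the race to expectations on the sample space\<close>

lemma integral_attack_value:
  assumes c: "0 \<le> c" and f: "\<And>h s. 0 \<le> f h s"
    and W: "(\<integral>\<^sup>+xy. ennreal (race A z c f 0 1 xy) \<partial>N) = ennreal W \<and> 0 \<le> W"
  shows "integrable N (\<lambda>xy. attack_value A z c f (zip_seq xy))"
    and "(\<integral>xy. attack_value A z c f (zip_seq xy) \<partial>N) = c * tau0 / q + W"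
proof -
  have v: "(\<integral>\<^sup>+xy. ennreal (attack_value A z c f (zip_seq xy)) \<partial>N) = ennreal (c * tau0 / q + W)"
    using nn_integral_attack_value[of c f W, OF c f] W by blast
  have nn: "AE xy in N. 0 \<le> attack_value A z c f (zip_seq xy)"
    using AE_good by eventually_elim (metis attack_value_nonneg c f prod.collapse)
  show "integrable N (\<lambda>xy. attack_value A z c f (zip_seq xy))"
    by (rule integrableI_nn_integral_finite[OF _ nn v]) measurable
  show "(\<integral>xy. attack_value A z c f (zip_seq xy) \<partial>N) = c * tau0 / q + W"
  proof -
    have "0 \<le> c * tau0 / q + W" using W c tau0 q by simp
    then show ?thesis
      using integral_eq_nn_integral[OF measurable_attack_value_N nn] by (simp only: v enn2real_ennreal)
  qed
qed

lemma integral_mining_space: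
  fixes F :: "(nat \<Rightarrow> real \<times> real) \<Rightarrow> real"
  assumes "F \<in> borel_measurable (mining_space q tau0)"
  shows "(\<integral>\<omega>. F \<omega> \<partial>mining_space q tau0) = (\<integral>xy. F (zip_seq xy) \<partial>N)"
  using integral_distr[OF zip_seq_measurable assms] unfolding distr_zip_seq .

lemma duration_eq: "duration A z = attack_value A z 1 (\<lambda>_ _. 0)"
  by (auto simp: fun_eq_iff duration_def attack_value_def outcome_def end_time_def)

lemma pred_attack_success[measurable]: "Measurable.pred (mining_space q tau0) (attack_success A z)"
proof -
  note [measurable] = pred_attack_ended[of "mining_space q tau0" A z, OF measurable_fst_mining measurable_snd_mining]
    measurable_off_len[of "mining_space q tau0" A z, OF measurable_fst_mining measurable_snd_mining]
    measurable_sec_len[of "mining_space q tau0" A z, OF measurable_fst_mining measurable_snd_mining]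
  show ?thesis unfolding attack_success_def[abs_def] by measurable
qed

lemma measurable_revenue: "revenue v b A z \<in> borel_measurable (mining_space q tau0)"
proof -
  note [measurable] = measurable_sec_len[of "mining_space q tau0" A z, OF measurable_fst_mining measurable_snd_mining]
  show ?thesis unfolding revenue_def[abs_def] by measurable
qed

text \<open>Truncation by \<open>nat\<close> is harmless: the attack ends no earlier than the
  pre-mining, so the official length is at least 0 and the secret length at least 1.\<close>

lemma attack_value_success:
  assumes "good x" "good y"
  defines "w \<equiv> zip_seq (x, y)"
  shows "attack_value A z 0 (\<lambda>h s. if h < s then real s - 1 else 0) w =
       (if attack_success A z w then real_of_int (sec_len w (end_time A z w)) - 1 else 0)"
    and "attack_value A z 0 (\<lambda>h s. if h < s then 1 else 0) w = (if attack_success A z w then 1 else 0)"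
proof -
  have len: "0 \<le> off_len w (end_time A z w)" "1 \<le> sec_len w (end_time A z w)"
    if "\<exists>t. attack_ended A z w t"
    using premine_le_end_time[OF that] cnt_mono[OF assms(1)] cnt_mono[OF assms(2)]
    by (auto simp: off_len_def sec_len_def w_def Nh_zip Na_zip)
  then have lt: "nat (off_len w (end_time A z w)) < nat (sec_len w (end_time A z w))
      \<longleftrightarrow> off_len w (end_time A z w) < sec_len w (end_time A z w)"
    if "\<exists>t. attack_ended A z w t" using that by auto
  show "attack_value A z 0 (\<lambda>h s. if h < s then real s - 1 else 0) w =
       (if attack_success A z w then real_of_int (sec_len w (end_time A z w)) - 1 else 0)"
    using len lt unfolding attack_value_def outcome_def end_time_def[symmetric] attack_success_def by auto
  show "attack_value A z 0 (\<lambda>h s. if h < s then 1 else 0) w = (if attack_success A z w then 1 else 0)"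
    using len lt unfolding attack_value_def outcome_def end_time_def[symmetric] attack_success_def by auto
qed

lemma expected_duration:
  "(\<integral>\<omega>. duration A z \<omega> \<partial>mining_space q tau0) / tau0 =
     real z / (2 * p) * inc_beta (4 * p * q) (real z) (1/2)
     + real (A + 1) / (p * (1 - l)\<^sup>2 * qint l (A + 1)) * inc_beta ((p - q)\<^sup>2) (1/2) (real z)
     - p ^ (z - 1) * q ^ z / (p * (1 - l) * Beta (real z) (real z)) + 1 / q"
proof -
  have "duration A z \<in> borel_measurable (mining_space q tau0)"
    unfolding duration_eq by (rule measurable_attack_value) measurable
  then have "(\<integral>\<omega>. duration A z \<omega> \<partial>mining_space q tau0) = tau0 / q + (tau0 * real z / p + (\<Sum>k<z. nbin_weight z k * ruin_time (z - k)))"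
    using integral_attack_value(2)[OF _ _ nn_integral_race_time]
    by (simp add: integral_mining_space duration_eq)
  then show ?thesis using time_formula by simp
qed

lemma expected_revenue:
  assumes b: "0 < b"
  shows "(\<integral>\<omega>. revenue v b A z \<omega> \<partial>mining_space q tau0) / b =
     q * real z / (2 * p) * inc_beta (4 * p * q) (real z) (1/2)
     - real (A + 1) * l ^ (A + 1) / (p * (1 - l) ^ 3 * (qint l (A + 1))\<^sup>2) * inc_beta ((p - q)\<^sup>2) (1/2) (real z)
     + (2 - l + l ^ (A + 2)) / ((1 - l)\<^sup>2 * qint l (A + 1)) * (p ^ (z - 1) * q ^ z / Beta (real z) (real z))
     + measure (mining_space q tau0) {\<omega> \<in> space (mining_space q tau0). attack_success A z \<omega>} * (v / b + 1)"
proof -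
  let ?M = "mining_space q tau0"
  let ?f1 = "\<lambda>xy. attack_value A z 0 (\<lambda>h s. if h < s then real s - 1 else 0) (zip_seq xy)"
  let ?f2 = "\<lambda>xy. attack_value A z 0 (\<lambda>h s. if h < s then 1 else 0) (zip_seq xy)"
  have i1: "integrable N ?f1" and e1: "(\<integral>xy. ?f1 xy \<partial>N) = real z * q / p + (\<Sum>k<z. nbin_weight z k * (mined (z - k) - real k * ruin (z - k)))"
    using integral_attack_value[OF _ _ nn_integral_race_blocks] by auto
  have i2: "integrable N ?f2"
  proof (rule N.integrable_const_bound[where B=1])
    show "AE xy in N. norm (?f2 xy) \<le> 1" by (auto simp: attack_value_def outcome_def)
  qed measurable
  \<comment> \<open>On success \<open>v + b * s = b * (s - 1) + (v + b)\<close>. The second part is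
    a multiple of the success indicator, so the success probability enters without being computed,
    with factor \<open>v / b + 1\<close> after division by \<open>b\<close>.\<close>
  have "(\<integral>\<omega>. revenue v b A z \<omega> \<partial>?M) = (\<integral>xy. b * ?f1 xy + (v + b) * ?f2 xy \<partial>N)"
    unfolding integral_mining_space[OF measurable_revenue]
  proof (rule integral_cong_AE)
    show "AE xy in N. revenue v b A z (zip_seq xy) = b * ?f1 xy + (v + b) * ?f2 xy"
      using AE_good
    proof eventually_elim
      case (elim xy)
      obtain x y where xy: "xy = (x, y)" by fastforce
      with elim have g: "good x" "good y" by auto
      show ?case
        unfolding xy attack_value_success[OF g] by (simp add: revenue_def algebra_simps)
    qed
    show "(\<lambda>xy. revenue v b A z (zip_seq xy)) \<in> borel_measurable N"
      by (rule measurable_compose[OF zip_seq_measurable measurable_revenue])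
  qed measurable
  also have "\<dots> = b * (\<integral>xy. ?f1 xy \<partial>N) + (v + b) * (\<integral>xy. ?f2 xy \<partial>N)"
    using i1 i2 by simp
  also have "(\<integral>xy. ?f2 xy \<partial>N) = measure ?M {\<omega> \<in> space ?M. attack_success A z \<omega>}"
  proof -
    have "measure ?M {\<omega> \<in> space ?M. attack_success A z \<omega>} = (\<integral>\<omega>. indicator {\<omega> \<in> space ?M. attack_success A z \<omega>} \<omega> \<partial>?M)"
      by (simp add: Collect_conj_eq Int_commute)
    also have "\<dots> = (\<integral>xy. indicator {\<omega> \<in> space ?M. attack_success A z \<omega>} (zip_seq xy) \<partial>N)"
      by (rule integral_mining_space) measurable
    also have "\<dots> = (\<integral>xy. ?f2 xy \<partial>N)"
    proof (rule integral_cong_AE)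
      show "AE xy in N. indicator {\<omega> \<in> space ?M. attack_success A z \<omega>} (zip_seq xy) = ?f2 xy"
        using AE_good AE_space
      proof eventually_elim
        case (elim xy)
        obtain x y where xy: "xy = (x, y)" by fastforce
        with elim have g: "good x" "good y" by auto
        have "zip_seq xy \<in> space ?M" using elim measurable_space[OF zip_seq_measurable] by blast
        then show ?case
          unfolding xy attack_value_success[OF g] by (simp add: indicator_def)
      qed
    qed measurable
    finally show ?thesis by simp
  qed
  finally show ?thesis
    unfolding e1 blocks_formula using b by (simp add: field_simps)
qed

end

theorem theorem2:
  fixes q tau0 b v :: real and z A :: nat
  assumes "0 < q" "q < 1/2" "0 < tau0" "0 < b" "0 \<le> v" "1 \<le> z" "z \<le> A"
  defines "(p::real) \<equiv> 1 - q"
  defines "(l::real) \<equiv> q / p"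
  defines "M \<equiv> mining_space q tau0"
  defines "PA \<equiv> measure M {\<omega> \<in> space M. attack_success A z \<omega>}"
  shows "((\<integral>\<omega>. revenue v b A z \<omega> \<partial>M) / b =
           q * real z / (2 * p) * inc_beta (4 * p * q) (real z) (1/2)
         - real (A + 1) * l ^ (A + 1) / (p * (1 - l) ^ 3 * (qint l (A + 1))\<^sup>2)
             * inc_beta ((p - q)\<^sup>2) (1/2) (real z)
         + (2 - l + l ^ (A + 2)) / ((1 - l)\<^sup>2 * qint l (A + 1))
             * (p ^ (z - 1) * q ^ z / Beta (real z) (real z))
         + PA * (v / b + 1)) \<and>
         ((\<integral>\<omega>. duration A z \<omega> \<partial>M) / tau0 =
           real z / (2 * p) * inc_beta (4 * p * q) (real z) (1/2)
         + real (A + 1) / (p * (1 - l)\<^sup>2 * qint l (A + 1)) * inc_beta ((p - q)\<^sup>2) (1/2) (real z)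
         - p ^ (z - 1) * q ^ z / (p * (1 - l) * Beta (real z) (real z))
         + 1 / q)"
proof -
  interpret mining q p tau0 A z
    by unfold_locales (use assms in \<open>auto simp: p_def\<close>)
  \<comment> \<open>After the interpretation \<open>l_def\<close> refers to the locale constant,
    while \<open>assms(9)\<close> is the definition made in the statement.\<close>
  have l: "mining.l q p = l" by (simp add: l_def assms(9))
  show ?thesis
    using expected_revenue[OF assms(4), of v] expected_duration
    unfolding M_def PA_def l by blast
qed

end
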